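(* Let $G$ be a countable strongly connected directed graph with finite out-degree at each vertex, and assume that $G$ is not finite. Let $\sigma$ be the left shift on the space $\mathcal P(G)$ of infinite paths in $G$. Let $\phi : \mathcal P(G) \to \mathbb R$ be a function such that $\lim_{k \to \infty} \operatorname{var}_k(\phi) = 0$, and let $t \in \mathbb R$. There is a non-zero regular Borel measure $m$ on $\mathcal P(G)$ such that $L_\phi^*(m) = e^t m$ if and only if $t \geq \mathbb P(\phi)$.
   Context: $G$ has countable vertex set and countable edge set; $r(e)$ and $s(e)$ denote range and source of an edge $e$. Strongly connected means that for any two vertices $v,w$ there is a finite path from $v$ to $w$. An infinite path is a sequence $p=(p_i)_{i=1}^\infty$ of edges with $r(p_i) = s(p_{i+1})$ for all $i$; $\mathcal P(G)$ is the set of infinite paths, with the topology having as base the cylinders $Z(\mu) = \{p \in \mathcal P(G) : p_i = e_i,\ i=1,\dots,n\}$ for finite paths $\mu = e_1\cdots e_n$. It is a locally compact second countable Hausdorff space, and the left shift $\sigma(p_1p_2p_3\cdots) = p_2p_3\cdots$ is a local homeomorphism. $\operatorname{var}_k(\phi) = \sup\{|\phi(x)-\phi(y)| : x_i = y_i,\ i = 1,\dots,k\}$. The Ruelle operator $L_\phi : C_c(\mathcal P(G)) \to C_c(\mathcal P(G))$ is $L_\phi(f)(x) = \sum_{y \in \sigma^{-1}(x)} e^{\phi(y)} f(y)$, where $C_c(\mathcal P(G))$ denotes the continuous compactly supported functions. For a regular Borel measure $m$ (non-negative, finite on compact sets), $L_\phi^*(m)$ is the regular Borel measure with $\int f \,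 dL_\phi^*(m) = \int L_\phi(f)\, dm$ for all $f \in C_c(\mathcal P(G))$. The pressure is $\mathbb P(\phi) = \sup_{x \in \mathcal P(G)} \mathbb P_x(\phi)$, where $\mathbb P_x(\phi) = \log\left( \limsup_n \left(L_\phi^n(f)(x)\right)^{1/n}\right) \in [-\infty,\infty]$ (with $\log 0=-\infty$, $\log \infty=\infty$) for any non-negative non-zero $f \in C_c(\mathcal P(G))$; this does not depend on the choice of $f$. *)

theory Defs
  imports "HOL-Analysis.Analysis" "Graph_Theory.Graph_Theory"
begin

text \<open>
  The source of an edge is its \<^const>\<open>tail\<close>, the range its \<^const>\<open>head\<close>.
  Infinite paths are indexed from 0, so the edge written \<open>p\<^sub>i\<close> on paper (\<open>i \<ge> 1\<close>) is \<open>p (i - 1)\<close>.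
\<close>

definition inf_paths :: "('v, 'e) pre_digraph \<Rightarrow> (nat \<Rightarrow> 'e) set" where
  "inf_paths G = {p. \<forall>i. p i \<in> arcs G \<and> head G (p i) = tail G (p (Suc i))}"

definition shift :: "(nat \<Rightarrow> 'e) \<Rightarrow> nat \<Rightarrow> 'e" where
  "shift p = (\<lambda>i. p (Suc i))"

definition cylinder :: "('v, 'e) pre_digraph \<Rightarrow> 'e list \<Rightarrow> (nat \<Rightarrow> 'e) set" where
  "cylinder G es = {p \<in> inf_paths G. \<forall>i < length es. p i = es ! i}"

definition finite_paths :: "('v, 'e) pre_digraph \<Rightarrow> 'e list set" where
  "finite_paths G = {es. es \<noteq> [] \<and> (\<exists>u v. pre_digraph.awalk G u es v)}"

definition path_topology :: "('v, 'e) pre_digraph \<Rightarrow> (nat \<Rightarrow> 'e) topology" where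
  "path_topology G = topology (arbitrary union_of (\<lambda>U. U \<in> cylinder G ` finite_paths G))"

text \<open>
  The cylinders are indeed a base of a topology on the space of infinite paths:
  two cylinders are nested or disjoint.
\<close>

lemma openin_path_topology:
  "openin (path_topology G) = arbitrary union_of (\<lambda>U. U \<in> cylinder G ` finite_paths G)"
proof -
  have nested: "cylinder G a \<inter> cylinder G b = {} \<or> cylinder G a \<inter> cylinder G b = cylinder G b"
    if "length a \<le> length b" for a b
  proof (cases "take (length a) b = a")
    case True
    then have "\<forall>i < length a. a ! i = b ! i"
      by (metis nth_take)
    then have "cylinder G b \<subseteq> cylinder G a"
      using that unfolding cylinder_def by force
    then show ?thesis by blast
  next
    case False
    have "\<exists>i < length a. a ! i \<noteq> b ! i"
    proof (rule ccontr)
      assume "\<not> ?thesis"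
      then have "take (length a) b = a"
        using that by (intro nth_equalityI) auto
      with False show False ..
    qed
    then obtain i where "i < length a" "a ! i \<noteq> b ! i"
      by blast
    moreover have "p i = a ! i" "p i = b ! i" if "p \<in> cylinder G a" "p \<in> cylinder G b" for p
      using that \<open>i < length a\<close> \<open>length a \<le> length b\<close> unfolding cylinder_def by force+
    ultimately have "cylinder G a \<inter> cylinder G b = {}"
      by (metis disjoint_iff)
    then show ?thesis by blast
  qed
  have inter: "(arbitrary union_of (\<lambda>U. U \<in> cylinder G ` finite_paths G)) (S \<inter> T)"
    if "S \<in> cylinder G ` finite_paths G" "T \<in> cylinder G ` finite_paths G" for S T
  proof -
    obtain a b where ab: "S = cylinder G a" "T = cylinder G b" "a \<in> finite_paths G" "b \<in> finite_paths G"
      using \<open>S \<in> _\<close> \<open>T \<in> _\<close> by blast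
    consider "length a \<le> length b" | "length b \<le> length a" by linarith
    then have "S \<inter> T = {} \<or> S \<inter> T = S \<or> S \<inter> T = T"
      using nested[of a b] nested[of b a] ab by (metis Int_commute)
    then show ?thesis
      using that arbitrary_union_of_empty arbitrary_union_of_inc by metis
  qed
  have "istopology (arbitrary union_of (\<lambda>U. U \<in> cylinder G ` finite_paths G))"
    unfolding istopology_base_alt arbitrary_union_of_Int_eq
    using inter by blast
  then show ?thesis
    by (simp add: path_topology_def)
qed

lemma topspace_path_topology:
  assumes "wf_digraph G"
  shows "topspace (path_topology G) = inf_paths G"
proof
  show "topspace (path_topology G) \<subseteq> inf_paths G"
  proof
    fix p assume "p \<in> topspace (path_topology G)"
    then obtain U where "openin (path_topology G) U" "p \<in> U"
      by (auto simp: topspace_def)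
    then obtain \<U> where "\<U> \<subseteq> cylinder G ` finite_paths G" "p \<in> \<Union>\<U>"
      unfolding openin_path_topology union_of_def by (auto simp: subset_eq)
    then obtain es where "p \<in> cylinder G es"
      by blast
    then show "p \<in> inf_paths G"
      by (simp add: cylinder_def)
  qed
  show "inf_paths G \<subseteq> topspace (path_topology G)"
  proof
    fix p assume p: "p \<in> inf_paths G"
    interpret wf_digraph G by fact
    have "[p 0] \<in> finite_paths G"
      using p arc_implies_awalk[of "p 0"] by (auto simp: finite_paths_def inf_paths_def)
    then have "openin (path_topology G) (cylinder G [p 0])"
      unfolding openin_path_topology by (intro arbitrary_union_of_inc) auto
    moreover have "p \<in> cylinder G [p 0]"
      using p by (auto simp: cylinder_def)
    ultimately show "p \<in> topspace (path_topology G)"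
      using openin_subset by blast
  qed
qed

text \<open>
  Extended-real valued, because the supremum may well be infinite for small \<open>k\<close>.
\<close>

definition var :: "('v, 'e) pre_digraph \<Rightarrow> nat \<Rightarrow> ((nat \<Rightarrow> 'e) \<Rightarrow> real) \<Rightarrow> ereal" where
  "var G k \<phi> = (SUP (x, y) \<in> {(x, y). x \<in> inf_paths G \<and> y \<in> inf_paths G \<and> (\<forall>i < k. x i = y i)}.
     ereal \<bar>\<phi> x - \<phi> y\<bar>)"

text \<open>
  Functions on the path space are functions on the whole type \<^typ>\<open>nat \<Rightarrow> 'e\<close>
  whose values outside \<^term>\<open>inf_paths G\<close> are irrelevant.
\<close>

definition Cc :: "('v, 'e) pre_digraph \<Rightarrow> ((nat \<Rightarrow> 'e) \<Rightarrow> real) set" where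
  "Cc G = {f. continuous_map (path_topology G) euclideanreal f \<and>
     compactin (path_topology G) (path_topology G closure_of {x \<in> inf_paths G. f x \<noteq> 0})}"

text \<open>
  The fibres of the shift can be infinite since in-degrees are not bounded, so the sum is an
  unordered infinite sum; for \<^term>\<open>f \<in> Cc G\<close> only finitely many of its terms are non-zero.
\<close>

definition ruelle ::
  "('v, 'e) pre_digraph \<Rightarrow> ((nat \<Rightarrow> 'e) \<Rightarrow> real) \<Rightarrow> ((nat \<Rightarrow> 'e) \<Rightarrow> real) \<Rightarrow> (nat \<Rightarrow> 'e) \<Rightarrow> real" where
  "ruelle G \<phi> f x = (\<Sum>\<^sub>\<infinity> y \<in> {y \<in> inf_paths G. shift y = x}. exp (\<phi> y) * f y)"

text \<open>
  Regularity is taken in the sense customary on locally compact spaces: finite on compact sets,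
  outer regular on Borel sets, inner regular on open sets.
\<close>

definition regular_borel_measure :: "('v, 'e) pre_digraph \<Rightarrow> (nat \<Rightarrow> 'e) measure \<Rightarrow> bool" where
  "regular_borel_measure G m \<longleftrightarrow>
     space m = inf_paths G \<and>
     sets m = sigma_sets (inf_paths G) {U. openin (path_topology G) U} \<and>
     (\<forall>K. compactin (path_topology G) K \<longrightarrow> emeasure m K < \<infinity>) \<and>
     (\<forall>A \<in> sets m. emeasure m A = (INF U \<in> {U. openin (path_topology G) U \<and> A \<subseteq> U}. emeasure m U)) \<and>
     (\<forall>U. openin (path_topology G) U \<longrightarrow>
        emeasure m U = (SUP K \<in> {K. compactin (path_topology G) K \<and> K \<subseteq> U}. emeasure m K))"

text \<open>
  When all out-degrees are finite (so that the path space is locally compact), \<open>\<phi>\<close> is continuous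
  and \<open>m\<close> is a regular Borel measure, existence and uniqueness of the measure described here are
  given by the Riesz representation theorem.
\<close>

definition ruelle_dual ::
  "('v, 'e) pre_digraph \<Rightarrow> ((nat \<Rightarrow> 'e) \<Rightarrow> real) \<Rightarrow> (nat \<Rightarrow> 'e) measure \<Rightarrow> (nat \<Rightarrow> 'e) measure" where
  "ruelle_dual G \<phi> m = (THE m'. regular_borel_measure G m' \<and>
     (\<forall>f \<in> Cc G. (\<integral>x. f x \<partial>m') = (\<integral>x. ruelle G \<phi> f x \<partial>m)))"

definition log_ereal :: "ereal \<Rightarrow> ereal" where
  "log_ereal a = (if a \<le> 0 then - \<infinity> else if a = \<infinity> then \<infinity> else ereal (ln (real_of_ereal a)))"

text \<open>
  The value at \<open>x\<close> is the common value obtained from all non-negative non-zero \<open>f\<close>;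
  it does not depend on \<open>f\<close> when the graph is strongly connected.
\<close>

definition pressure_at ::
  "('v, 'e) pre_digraph \<Rightarrow> ((nat \<Rightarrow> 'e) \<Rightarrow> real) \<Rightarrow> (nat \<Rightarrow> 'e) \<Rightarrow> ereal" where
  "pressure_at G \<phi> x = (THE c. \<forall>f \<in> Cc G.
     (\<forall>y \<in> inf_paths G. f y \<ge> 0) \<and> (\<exists>y \<in> inf_paths G. f y \<noteq> 0) \<longrightarrow>
     c = log_ereal (limsup (\<lambda>n. ereal (root n ((ruelle G \<phi> ^^ n) f x)))))"

definition pressure :: "('v, 'e) pre_digraph \<Rightarrow> ((nat \<Rightarrow> 'e) \<Rightarrow> real) \<Rightarrow> ereal" where
  "pressure G \<phi> = (SUP x \<in> inf_paths G. pressure_at G \<phi> x)"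

end

theory Submission
  imports Defs "HOL-Library.Sublist" "HOL-Complex_Analysis.Great_Picard"
begin

text \<open>
  Everything is controlled by the numbers
  \<open>L\<^sup>n(1\<^sub>w)(x)\<close>: as the variations of \<open>\<phi>\<close> tend to zero, their exponential growth rate depends neither on \<open>x\<close>
  nor, by strong connectedness, on \<open>w\<close>.

  If \<open>L\<^sup>*m = e\<^sup>t m\<close>, then integrating \<open>L\<^sup>n(1\<^sub>w)\<close> over a long cylinder of positive mass bounds that rate by \<open>e\<^sup>t\<close>.

  Conversely, let \<open>t\<^sub>j\<close> decrease strictly to \<open>t \<ge> \<P>(\<phi>)\<close> and let \<open>x\<^sub>j\<close> be paths with pairwise distinct first edges, which
  exist because the graph is infinite. The Green sums \<open>\<Sum>\<^sub>n e\<^sup>-\<^sup>n\<^sup>t\<^sup>j L\<^sup>n(1\<^sub>w)(x\<^sub>j)\<close> converge, are additive in \<open>w\<close>, and satisfy the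
  eigenvalue equation up to an error supported at \<open>x\<^sub>j\<close>. A Harnack inequality makes the normalised sums bounded in \<open>j\<close> for
  each \<open>w\<close>; a diagonal limit has no error left, because the \<open>x\<^sub>j\<close> leave every cylinder, and extends to a measure since
  out-degrees are finite.
\<close>

subsection \<open>Words and cylinders\<close>

text \<open>The variations of \<phi> tend to zero at no prescribed rate, so there is no bounded
  distortion: iterates at two paths with a long common initial segment are comparable only up to a
  factor exp(n \<epsilon>). Exponential rates survive this, individual values do not. So the
  pressure is used only through bounds of the form \<open>C * r ^ n\<close>, and the eigenvalue
  equation of the limit is checked only up to factors exp(\<epsilon>) on long cylinders and carried
  back to short ones by additivity.

  In-degrees may be infinite and \<phi> unbounded, so \<open>L\<close> need not make sense on
  constants. All estimates concern indicators of cylinders, where \<phi> is bounded by compactness.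

  The detour through t_j > t is needed because the Green series may diverge when t equals the
  pressure; letting the base paths escape at the same time treats the convergent and the divergent
  case alike. For a finite graph the path space is compact, nothing can escape, and t has to be the
  pressure.\<close>

definition pre :: "(nat \<Rightarrow> 'e) \<Rightarrow> nat \<Rightarrow> 'e list" where
  "pre p n = map p [0..<n]"

definition conc :: "'e list \<Rightarrow> (nat \<Rightarrow> 'e) \<Rightarrow> nat \<Rightarrow> 'e" where
  "conc w x = (\<lambda>i. if i < length w then w ! i else x (i - length w))"

lemma length_pre [simp]: "length (pre p n) = n"
  by (simp add: pre_def)

lemma pre_Suc: "pre p (Suc n) = pre p n @ [p n]"
  by (simp add: pre_def)

lemma pre_eq_Nil [simp]: "pre p n = [] \<longleftrightarrow> n = 0"
  by (simp add: pre_def)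

lemma nth_pre [simp]: "i < n \<Longrightarrow> pre p n ! i = p i"
  by (simp add: pre_def)

lemma pre_length_cylinder: "p \<in> cylinder G w \<Longrightarrow> pre p (length w) = w"
  by (intro nth_equalityI) (auto simp: cylinder_def)

lemma conc_Cons: "conc (e # w) x = case_nat e (conc w x)"
  by (auto simp: conc_def split: nat.split)

lemma conc_Nil [simp]: "conc [] x = x"
  by (simp add: conc_def)

lemma shift_case_nat [simp]: "shift (case_nat e x) = x"
  by (simp add: shift_def)

lemma case_nat_shift: "case_nat (y 0) (shift y) = y"
  by (auto simp: shift_def split: nat.split)

lemma cylinder_subset_inf_paths: "cylinder G w \<subseteq> inf_paths G"
  by (auto simp: cylinder_def)

lemma in_cylinder_pre: "q \<in> cylinder G (pre p n) \<longleftrightarrow> q \<in> inf_paths G \<and> (\<forall>i<n. q i = p i)"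
  by (auto simp: cylinder_def)

lemma cylinder_append: "cylinder G (u @ v) \<subseteq> cylinder G u"
  by (auto simp: cylinder_def nth_append)

lemma cylinder_disjoint:
  assumes "length u \<le> length v" "take (length u) v \<noteq> u"
  shows "cylinder G u \<inter> cylinder G v = {}"
proof (rule ccontr)
  assume "cylinder G u \<inter> cylinder G v \<noteq> {}"
  then obtain p where p: "p \<in> cylinder G u" "p \<in> cylinder G v" by blast
  have "take (length u) v = u"
  proof (rule nth_equalityI)
    show "length (take (length u) v) = length u" using assms by simp
    fix i assume "i < length (take (length u) v)"
    then show "take (length u) v ! i = u ! i"
      using p assms(1) by (auto simp: cylinder_def)
  qed
  with assms show False by blast
qed

lemma cylinder_cases:
  assumes "length u \<le> length v"
  shows "cylinder G v \<subseteq> cylinder G u \<or> cylinder G u \<inter> cylinder G v = {}"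
proof (cases "take (length u) v = u")
  case True
  then have "v = u @ drop (length u) v" by (metis append_take_drop_id)
  then show ?thesis by (metis cylinder_append)
qed (use cylinder_disjoint[OF assms] in blast)

lemma cylinder_disjoint_snoc: "e \<noteq> e' \<Longrightarrow> cylinder G (w @ [e]) \<inter> cylinder G (w @ [e']) = {}"
  by (rule cylinder_disjoint) auto

text \<open>The graph being infinite enters as infinitely many edges, which is what escaping paths
  need; \<open>strongly_connected_infinite_arcs\<close> makes the translation.\<close>

locale path_graph = wf_digraph G for G :: "('v, 'e) pre_digraph" +
  assumes countable_arcs: "countable (arcs G)"
    and strong: "strongly_connected G"
    and finite_out: "v \<in> verts G \<Longrightarrow> finite (out_arcs G v)"
    and infinite_arcs: "infinite (arcs G)"
begin

abbreviation "X \<equiv> inf_paths G"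
abbreviation "Z \<equiv> cylinder G"
abbreviation "FP \<equiv> finite_paths G"
abbreviation "T \<equiv> path_topology G"

section \<open>Finite paths as words: splitting, extending, connecting\<close>

lemma FP_not_Nil: "w \<in> FP \<Longrightarrow> w \<noteq> []"
  by (simp add: finite_paths_def)

lemma Nil_notin_FP [simp]: "[] \<notin> FP"
  by (simp add: finite_paths_def)

lemma FP_iff: "w \<in> FP \<longleftrightarrow> w \<noteq> [] \<and> awalk (tail G (hd w)) w (head G (last w))"
proof -
  have "u = tail G (hd w) \<and> v = head G (last w)" if "awalk u w v" "w \<noteq> []" for u v
    using that by (induction w arbitrary: u) (auto simp: awalk_Cons_iff awalk_Nil_iff split: if_splits)
  then show ?thesis by (auto simp: finite_paths_def)
qed

lemma FP_single [simp]: "[e] \<in> FP \<longleftrightarrow> e \<in> arcs G"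
  by (auto simp: FP_iff awalk_Cons_iff awalk_Nil_iff)

lemma FP_Cons:
  assumes "w \<noteq> []"
  shows "e # w \<in> FP \<longleftrightarrow> e \<in> arcs G \<and> w \<in> FP \<and> head G e = tail G (hd w)"
  using assms by (cases w) (auto simp: FP_iff awalk_Cons_iff)

lemma FP_append:
  assumes "u \<noteq> []" "v \<noteq> []"
  shows "u @ v \<in> FP \<longleftrightarrow> u \<in> FP \<and> v \<in> FP \<and> head G (last u) = tail G (hd v)"
  using assms
proof (induction u)
  case (Cons e u)
  then show ?case
    by (cases "u = []") (auto simp: FP_Cons hd_append)
qed simp

lemma FP_snoc:
  assumes "w \<noteq> []"
  shows "w @ [e] \<in> FP \<longleftrightarrow> w \<in> FP \<and> e \<in> arcs G \<and> head G (last w) = tail G e"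
  using FP_append[of w "[e]"] assms by auto

lemma FP_arcs: "w \<in> FP \<Longrightarrow> set w \<subseteq> arcs G"
  by (auto simp: finite_paths_def awalk_def)

lemma finite_extensions: "w \<noteq> [] \<Longrightarrow> finite {e. w @ [e] \<in> FP}"
proof (cases "w \<in> FP")
  case True
  assume "w \<noteq> []"
  then have "{e. w @ [e] \<in> FP} \<subseteq> out_arcs G (head G (last w))"
    by (auto simp: FP_snoc out_arcs_def)
  moreover have "head G (last w) \<in> verts G"
    using FP_arcs[OF True] last_in_set[OF \<open>w \<noteq> []\<close>] by auto
  ultimately show ?thesis using finite_out finite_subset by blast
qed (simp add: FP_snoc)

lemma pre_in_FP:
  assumes "p \<in> X" "n > 0"
  shows "pre p n \<in> FP"
  using assms(2)
proof (induction n)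
  case (Suc n)
  show ?case
  proof (cases "n = 0")
    case True
    then show ?thesis using assms(1) by (simp add: pre_def inf_paths_def)
  next
    case False
    then obtain k where k: "n = Suc k" using not0_implies_Suc by blast
    have "last (pre p n) = p k" by (simp add: k pre_Suc)
    then show ?thesis
      using Suc False assms(1) unfolding pre_Suc[of p n]
      by (subst FP_snoc) (auto simp: inf_paths_def k)
  qed
qed simp

lemma Z_single: "Z [e] = {p \<in> X. p 0 = e}"
  by (auto simp: cylinder_def)

lemma X_eq_Union: "X = (\<Union>e\<in>arcs G. Z [e])"
  by (auto simp: Z_single inf_paths_def)

lemma Z_extend:
  assumes "w \<in> FP"
  shows "Z w = (\<Union>e\<in>{e. w @ [e] \<in> FP}. Z (w @ [e]))"
proof
  show "Z w \<subseteq> (\<Union>e\<in>{e. w @ [e] \<in> FP}. Z (w @ [e]))"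
  proof
    fix p assume p: "p \<in> Z w"
    then have "pre p (Suc (length w)) = w @ [p (length w)]" "p \<in> X"
      using pre_length_cylinder[OF p] by (auto simp: pre_Suc cylinder_def)
    moreover from this have "w @ [p (length w)] \<in> FP" "p \<in> Z (w @ [p (length w)])"
      using pre_in_FP[of p "Suc (length w)"] in_cylinder_pre[of p G p "Suc (length w)"] by auto
    ultimately show "p \<in> (\<Union>e\<in>{e. w @ [e] \<in> FP}. Z (w @ [e]))"
      by blast
  qed
qed (use cylinder_append in blast)

text \<open>Take a walk from \<open>v\<close> to the tail of any edge. Either it begins with an edge
  out of \<open>v\<close>, or it is empty and the chosen edge itself starts at \<open>v\<close>. So
  there are no dead ends, and every finite path continues to an infinite one.\<close>

lemma out_arc_exists:
  assumes "v \<in> verts G"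
  shows "\<exists>e\<in>arcs G. tail G e = v"
proof -
  obtain a where a: "a \<in> arcs G" using infinite_arcs by (metis finite.emptyI ex_in_conv)
  have "v \<rightarrow>\<^sup>*\<^bsub>G\<^esub> tail G a" using strong assms a by (auto simp: strongly_connected_def)
  then obtain p where "awalk v p (tail G a)" by (auto simp: reachable_awalk)
  then show ?thesis using a
    by (cases p) (auto simp: awalk_Cons_iff awalk_Nil_iff)
qed

lemma inf_path_from_arc:
  assumes "e \<in> arcs G"
  shows "\<exists>x\<in>X. x 0 = e"
proof -
  have "\<exists>x. \<forall>n. (x n \<in> arcs G \<and> (n = 0 \<longrightarrow> x n = e)) \<and> head G (x n) = tail G (x (Suc n))"
  proof (rule dependent_nat_choice)
    show "\<exists>x. x \<in> arcs G \<and> ((0::nat) = 0 \<longrightarrow> x = e)" using assms by auto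
    show "\<exists>y. (y \<in> arcs G \<and> (Suc n = 0 \<longrightarrow> y = e)) \<and> head G x = tail G y"
      if "x \<in> arcs G \<and> (n = 0 \<longrightarrow> x = e)" for x n
      using that out_arc_exists[of "head G x"] by (metis head_in_verts nat.simps(3))
  qed
  then show ?thesis by (auto simp: inf_paths_def)
qed

lemma case_nat_in_X:
  "case_nat e x \<in> X \<longleftrightarrow> e \<in> arcs G \<and> x \<in> X \<and> head G e = tail G (x 0)"
proof -
  have "(\<forall>i. case_nat e x i \<in> arcs G \<and> head G (case_nat e x i) = tail G (case_nat e x (Suc i)))
     \<longleftrightarrow> (e \<in> arcs G \<and> head G e = tail G (x 0)) \<and> (\<forall>i. x i \<in> arcs G \<and> head G (x i) = tail G (x (Suc i)))"
    (is "(\<forall>i. ?P i) \<longleftrightarrow> ?R")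
  proof
    assume L: "\<forall>i. ?P i"
    have "?P (Suc i)" for i using L by blast
    then show ?R using L[rule_format, of 0] by simp
  next
    assume R: ?R
    show "\<forall>i. ?P i"
    proof
      fix i show "?P i" using R by (cases i) auto
    qed
  qed
  then show ?thesis by (auto simp: inf_paths_def)
qed

lemma case_nat_in_Z:
  "case_nat e x \<in> Z (a # w) \<longleftrightarrow> e = a \<and> case_nat e x \<in> X \<and> x \<in> Z w"
proof -
  have "(\<forall>i<length (a#w). case_nat e x i = (a#w) ! i) \<longleftrightarrow> e = a \<and> (\<forall>i<length w. x i = w ! i)"
    by (auto simp: less_Suc_eq_0_disj)
  then show ?thesis unfolding cylinder_def mem_Collect_eq by (auto simp: case_nat_in_X)
qed

text \<open>The non-empty overlap \<open>v\<close> records the first edge of \<open>x\<close>, and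
  this makes the junction between \<open>w\<close> and \<open>x\<close> admissible.\<close>

lemma conc_in_Z:
  assumes "w @ v \<in> FP" "v \<noteq> []" "x \<in> Z v"
  shows "conc w x \<in> Z (w @ v)"
  using assms(1)
proof (induction w)
  case Nil
  then show ?case using assms by simp
next
  case (Cons e w)
  have "w @ v \<in> FP" "head G e = tail G (hd (w @ v))" "e \<in> arcs G"
    using Cons.prems assms(2) by (auto simp: FP_Cons)
  moreover from this have in': "conc w x \<in> Z (w @ v)" using Cons by auto
  then have "conc w x 0 = hd (w @ v)"
    using assms(2) by (auto simp: cylinder_def hd_conv_nth)
  ultimately show ?case
    using in' cylinder_subset_inf_paths[of G "w@v"] by (auto simp: conc_Cons case_nat_in_Z case_nat_in_X)
qed

lemma Z_nonempty:
  assumes "w \<in> FP"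
  shows "Z w \<noteq> {}"
proof -
  obtain x where x: "x \<in> X" "x 0 = last w"
    using inf_path_from_arc[of "last w"] FP_arcs[OF assms] last_in_set[OF FP_not_Nil[OF assms]] by blast
  have w: "butlast w @ [last w] = w" using FP_not_Nil[OF assms] by simp
  have "conc (butlast w) x \<in> Z (butlast w @ [last w])"
    by (rule conc_in_Z) (use assms w x in \<open>auto simp: Z_single\<close>)
  then show ?thesis by (metis w empty_iff)
qed

text \<open>Strong connectedness in the form behind all comparisons of different words and different
  base points. The connecting word may be empty.\<close>

lemma connecting_word:
  assumes "u \<in> FP" "v \<in> FP"
  obtains w where "u @ w @ v \<in> FP"
proof -
  have uv: "u \<noteq> []" "v \<noteq> []" using assms by auto
  then have "last u \<in> arcs G" "hd v \<in> arcs G"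
    using FP_arcs[OF assms(1)] FP_arcs[OF assms(2)] last_in_set[of u] hd_in_set[of v] by blast+
  then have "head G (last u) \<in> verts G" "tail G (hd v) \<in> verts G" by simp_all
  then obtain w where w: "awalk (head G (last u)) w (tail G (hd v))"
    using strong by (auto simp: strongly_connected_def reachable_awalk)
  have "u @ w @ v \<in> FP"
  proof (cases "w = []")
    case True
    then show ?thesis using w assms uv by (auto simp: FP_append awalk_Nil_iff)
  next
    case False
    obtain a b where ab: "awalk a v b" using assms(2) by (auto simp: finite_paths_def)
    then have "a = tail G (hd v)" using uv by (cases v) (auto simp: awalk_Cons_iff)
    then have wv: "awalk (head G (last u)) (w @ v) b"
      using w ab by (auto intro: awalk_appendI)
    then have "head G (last u) = tail G (hd (w @ v))"
      using False by (cases w) (auto simp: awalk_Cons_iff)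
    moreover have "w @ v \<in> FP"
      unfolding finite_paths_def using uv wv by (intro CollectI conjI exI) simp_all
    ultimately show ?thesis using assms uv by (subst FP_append) auto
  qed
  then show ?thesis by (rule that)
qed

text \<open>
  Bar induction, i.e. the lemma of Koenig read contrapositively. It stands in for the compactness
  of cylinders throughout.
\<close>

lemma cylinder_induct [consumes 1, case_names extend path]:
  assumes "w \<in> FP"
    and step: "\<And>v. v \<in> FP \<Longrightarrow> (\<And>e. v @ [e] \<in> FP \<Longrightarrow> P (v @ [e])) \<Longrightarrow> P v"
    and bar: "\<And>p. p \<in> Z w \<Longrightarrow> \<exists>n0. \<forall>n\<ge>n0. n > 0 \<longrightarrow> P (pre p n)"
  shows "P w"
proof (rule ccontr)
  assume "\<not> P w"
  have "\<exists>f. \<forall>n. (f n \<in> FP \<and> \<not> P (f n) \<and> (n = 0 \<longrightarrow> f n = w)) \<and> (\<exists>e. f (Suc n) = f n @ [e])"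
    using \<open>\<not> P w\<close> \<open>w \<in> FP\<close> step
    by (intro dependent_nat_choice[where P="\<lambda>n v. v \<in> FP \<and> \<not> P v \<and> (n = 0 \<longrightarrow> v = w)"
        and Q="\<lambda>n v v'. \<exists>e. v' = v @ [e]"]) blast+
  then obtain f where f: "\<And>n. f n \<in> FP" "\<And>n. \<not> P (f n)" "f 0 = w" "\<And>n. \<exists>e. f (Suc n) = f n @ [e]"
    by metis
  have len: "length (f n) = length w + n" for n
    by (induction n) (use f(3,4) in \<open>auto, metis length_append_singleton\<close>)
  have ext: "\<exists>u. f (n + k) = f n @ u" for n k
  proof (induction k)
    case (Suc k)
    then show ?case using f(4)[of "n+k"] by auto
  qed simp
  \<comment> \<open>The words \<open>f n\<close> form a chain of extensions, and \<open>f i\<close>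
    is longer than \<open>i\<close> because \<open>w\<close> is non-empty; so the diagonal reads off
    their common limit path.\<close>
  define p where "p i = f i ! i" for i
  have "w \<noteq> []" using \<open>w \<in> FP\<close> by auto
  have p: "f n ! i = p i" if "i < length w + n" for i n
  proof (cases "i \<le> n")
    case True
    then obtain k where "n = i + k" using le_Suc_ex by blast
    then show ?thesis using ext[of i k] len[of i] \<open>w \<noteq> []\<close> by (auto simp: p_def nth_append)
  next
    case False
    then obtain k where "i = n + k" using le_Suc_ex nat_le_linear by blast
    then show ?thesis using ext[of n k] len[of n] that by (auto simp: p_def nth_append)
  qed
  have pre: "pre p (length w + n) = f n" for n
    by (intro nth_equalityI) (auto simp: len p)
  have "p i \<in> arcs G \<and> head G (p i) = tail G (p (Suc i))" for i
  proof -
    define v where "v = pre p (length w + i + 2)"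
    have v: "v \<in> FP" "length v = length w + i + 2"
      using pre[of "i+2"] f(1) by (simp add: add.assoc v_def) (simp add: v_def)
    have nth: "v ! i = p i" "v ! Suc i = p (Suc i)" by (simp_all add: v_def)
    have ne: "take (Suc i) v \<noteq> []" "drop (Suc i) v \<noteq> []" using v(2) by auto
    have "take (Suc i) v @ drop (Suc i) v \<in> FP" using v by simp
    note A = this[unfolded FP_append[OF ne]]
    have "last (take (Suc i) v) = p i" "hd (drop (Suc i) v) = p (Suc i)"
      using v(2) nth by (simp_all add: take_Suc_conv_app_nth hd_drop_conv_nth)
    moreover have "last (take (Suc i) v) \<in> arcs G"
      using A FP_arcs last_in_set[OF ne(1)] by blast
    ultimately show ?thesis using A by simp
  qed
  then have "p \<in> X" by (simp add: inf_paths_def)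
  then have "p \<in> Z w" using pre[of 0] f(3) in_cylinder_pre[of p G p "length w"] by simp
  then obtain n0 where "\<forall>n\<ge>n0. n > 0 \<longrightarrow> P (pre p n)" using bar by blast
  then have "P (pre p (length w + n0))" using \<open>w \<noteq> []\<close> by simp
  then show False using f(2) pre by simp
qed

end

subsection \<open>The path space\<close>

context path_graph
begin

lemma topspace_T [simp]: "topspace T = X"
  using topspace_path_topology wf_digraph_axioms by blast

lemma openin_Z: "w \<in> FP \<Longrightarrow> openin T (Z w)"
  unfolding openin_path_topology by (intro arbitrary_union_of_inc) auto

lemma in_Z_pre: "p \<in> X \<Longrightarrow> p \<in> Z (pre p n)"
  by (simp add: cylinder_def)

lemma Z_pre_mono: "n \<le> n' \<Longrightarrow> Z (pre p n') \<subseteq> Z (pre p n)"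
  by (auto simp: cylinder_def)

lemma openin_imp_cylinder:
  assumes "openin T U" "p \<in> U"
  shows "\<exists>n>0. Z (pre p n) \<subseteq> U"
proof -
  obtain \<U> where "\<U> \<subseteq> Z ` FP" "p \<in> \<Union>\<U>" "\<Union>\<U> = U"
    using assms unfolding openin_path_topology union_of_def by (auto simp: subset_eq)
  then obtain w where w: "w \<in> FP" "p \<in> Z w" "Z w \<subseteq> U" by blast
  then have "pre p (length w) = w" "length w > 0"
    using pre_length_cylinder[OF w(2)] FP_not_Nil[OF w(1)] by simp_all
  then show ?thesis using w by metis
qed

lemma openin_T_iff: "openin T U \<longleftrightarrow> U \<subseteq> X \<and> (\<forall>p\<in>U. \<exists>n>0. Z (pre p n) \<subseteq> U)"
proof
  assume U: "openin T U"
  show "U \<subseteq> X \<and> (\<forall>p\<in>U. \<exists>n>0. Z (pre p n) \<subseteq> U)"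
    using openin_subset[OF U] openin_imp_cylinder[OF U] by (simp only: topspace_T) blast
next
  assume U: "U \<subseteq> X \<and> (\<forall>p\<in>U. \<exists>n>0. Z (pre p n) \<subseteq> U)"
  have "\<exists>V. openin T V \<and> p \<in> V \<and> V \<subseteq> U" if "p \<in> U" for p
    using U that openin_Z[OF pre_in_FP] in_Z_pre by (meson subsetD)
  then show "openin T U" by (subst openin_subopen) blast
qed

lemma countable_FP: "countable FP"
  by (rule countable_subset[OF _ countable_lists[OF countable_arcs]]) (use FP_arcs in auto)

lemma openin_eq_Union: "openin T U \<Longrightarrow> U = (\<Union>w\<in>{w \<in> FP. Z w \<subseteq> U}. Z w)"
proof
  assume U: "openin T U"
  show "U \<subseteq> (\<Union>w\<in>{w \<in> FP. Z w \<subseteq> U}. Z w)"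
  proof
    fix p assume p: "p \<in> U"
    then obtain n where n: "n > 0" "Z (pre p n) \<subseteq> U" using U openin_imp_cylinder by blast
    have "p \<in> X" using p U openin_subset[of T U] by auto
    then show "p \<in> (\<Union>w\<in>{w \<in> FP. Z w \<subseteq> U}. Z w)"
      using n pre_in_FP[of p n] in_Z_pre[of p n] by blast
  qed
qed auto

lemma closedin_Z: "closedin T (Z w)"
proof -
  have "openin T (X - Z w)"
    unfolding openin_T_iff
  proof safe
    fix p assume p: "p \<in> X" "p \<notin> Z w"
    \<comment> \<open>A prefix of length \<open>length w\<close> would already decide membership;
      one more edge keeps the prefix non-empty when \<open>w\<close> is empty.\<close>
    let ?n = "Suc (length w)"
    have "Z (pre p ?n) \<subseteq> Z w \<or> Z w \<inter> Z (pre p ?n) = {}"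
      by (rule cylinder_cases) simp
    then have "Z (pre p ?n) \<subseteq> X - Z w"
      using p in_Z_pre[of p ?n] cylinder_subset_inf_paths[of G "pre p ?n"] by blast
    then show "\<exists>n>0. Z (pre p n) \<subseteq> X - Z w" by blast
  qed
  then show ?thesis
    using cylinder_subset_inf_paths[of G w] by (simp only: closedin_def topspace_T simp_thms)
qed

text \<open>Finite out-degree enters through the extension step, where a cylinder splits into
  finitely many and their finite subcovers are united. Along a path, a single member of the cover
  eventually contains the whole cylinder.\<close>

lemma compactin_Z:
  assumes "w \<in> FP"
  shows "compactin T (Z w)"
  unfolding compactin_def
proof (intro conjI allI impI)
  show "Z w \<subseteq> topspace T" by (simp add: cylinder_subset_inf_paths)
  fix \<U> assume \<U>: "(\<forall>U\<in>\<U>. openin T U) \<and> Z w \<subseteq> \<Union>\<U>"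
  show "\<exists>\<F>. finite \<F> \<and> \<F> \<subseteq> \<U> \<and> Z w \<subseteq> \<Union>\<F>"
    using assms
  proof (induction rule: cylinder_induct)
    case (extend v)
    then obtain F where F: "\<And>e. v @ [e] \<in> FP \<Longrightarrow> finite (F e) \<and> F e \<subseteq> \<U> \<and> Z (v @ [e]) \<subseteq> \<Union>(F e)"
      by metis
    let ?E = "{e. v @ [e] \<in> FP}"
    show ?case
    proof (intro exI conjI)
      show "finite (\<Union>e\<in>?E. F e)"
        using F finite_extensions[OF FP_not_Nil[OF extend(1)]] by (intro finite_UN_I) auto
      show "(\<Union>e\<in>?E. F e) \<subseteq> \<U>" using F by (intro UN_least) simp
      have "Z (v @ [e]) \<subseteq> \<Union>(\<Union>e\<in>?E. F e)" if "e \<in> ?E" for e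
        using F[of e] that by blast
      then show "Z v \<subseteq> \<Union>(\<Union>e\<in>?E. F e)"
        unfolding Z_extend[OF extend(1)] by (rule UN_least)
    qed
  next
    case (path p)
    then obtain U where U: "U \<in> \<U>" "p \<in> U" using \<U> by blast
    then obtain n0 where "Z (pre p n0) \<subseteq> U" using \<U> openin_imp_cylinder by blast
    then have "Z (pre p n) \<subseteq> U" if "n \<ge> n0" for n using Z_pre_mono[OF that] by blast
    then show ?case using U by (intro exI[of _ n0] allI impI exI[of _ "{U}"]) auto
  qed
qed

text \<open>Turns a property that holds locally at each point of a compact set into finitely many
  words that have it.\<close>

lemma compactin_finite_cover:
  assumes "compactin T K" and "\<And>p. p \<in> K \<Longrightarrow> \<exists>n>0. Q (pre p n)"
  obtains F where "finite F" "F \<subseteq> FP" "\<And>w. w \<in> F \<Longrightarrow> Q w" "K \<subseteq> (\<Union>w\<in>F. Z w)"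
proof -
  have KX: "K \<subseteq> X" using assms(1) by (simp add: compactin_def)
  let ?\<U> = "Z ` {w \<in> FP. Q w}"
  have "K \<subseteq> \<Union>?\<U>"
  proof
    fix p assume p: "p \<in> K"
    then obtain n where "n > 0" "Q (pre p n)" using assms(2) by blast
    then show "p \<in> \<Union>?\<U>" using p KX pre_in_FP[of p n] in_Z_pre[of p n] by blast
  qed
  moreover have "\<forall>U\<in>?\<U>. openin T U" using openin_Z by blast
  ultimately obtain \<F> where \<F>: "finite \<F>" "\<F> \<subseteq> ?\<U>" "K \<subseteq> \<Union>\<F>"
    using assms(1) unfolding compactin_def by meson
  then obtain F where "finite F" "F \<subseteq> {w \<in> FP. Q w}" "\<F> = Z ` F"
    by (meson finite_subset_image)
  then show ?thesis using \<F> by (intro that[of F]) auto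
qed

lemma finite_union_Z_compact:
  assumes "finite F" "F \<subseteq> FP"
  shows "compactin T (\<Union>w\<in>F. Z w)"
  using assms compactin_Z by (intro compactin_Union) auto

section \<open>Indicators of cylinders and compactly supported functions\<close>

definition ind :: "'e list \<Rightarrow> (nat \<Rightarrow> 'e) \<Rightarrow> real" where
  "ind w = indicator (Z w)"

lemma ind_nonneg [simp]: "ind w x \<ge> 0"
  by (simp add: ind_def)

lemma ind_eq_1: "x \<in> Z w \<Longrightarrow> ind w x = 1"
  by (simp add: ind_def)

lemma ind_eq_0: "x \<notin> Z w \<Longrightarrow> ind w x = 0"
  by (simp add: ind_def)

lemma ind_cong:
  assumes "x \<in> X" "y \<in> X" "\<forall>i<length w. x i = y i"
  shows "ind w x = ind w y"
proof -
  have "x \<in> Z w \<longleftrightarrow> y \<in> Z w"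
    unfolding cylinder_def mem_Collect_eq using assms by metis
  then show ?thesis by (simp add: ind_def indicator_def)
qed

lemma continuous_ind:
  assumes "w \<in> FP"
  shows "continuous_map T euclideanreal (ind w)"
  unfolding continuous_map_def
proof (intro conjI allI impI)
  fix U :: "real set"
  have "{x \<in> topspace T. ind w x \<in> U} = (if 1 \<in> U then Z w else {}) \<union> (if 0 \<in> U then X - Z w else {})"
    using cylinder_subset_inf_paths[of G w] by (auto simp: ind_def indicator_def)
  moreover have "openin T (X - Z w)" using closedin_Z[of w] by (simp only: closedin_def topspace_T)
  ultimately show "openin T {x \<in> topspace T. ind w x \<in> U}"
    using openin_Z[OF assms] by (simp add: openin_Un)
qed simp

lemma ind_in_Cc:
  assumes "w \<in> FP"
  shows "ind w \<in> Cc G"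
proof -
  have "{x \<in> X. ind w x \<noteq> 0} = Z w"
    using cylinder_subset_inf_paths[of G w] by (auto simp: ind_def indicator_def)
  moreover have "T closure_of Z w = Z w" using closedin_Z[of w] by (simp only: closure_of_eq)
  ultimately show ?thesis
    using continuous_ind[OF assms] compactin_Z[OF assms] closedin_Z[of w]
    by (simp add: Cc_def)
qed

lemma continuous_at_cylinder:
  assumes "continuous_map T euclideanreal f" "p \<in> X" "e > 0"
  shows "\<exists>n>0. \<forall>q\<in>Z (pre p n). \<bar>f q - f p\<bar> < e"
proof -
  have "openin T {x \<in> topspace T. f x \<in> ball (f p) e}"
    using assms(1) by (auto simp: continuous_map_def)
  then have "\<exists>n>0. Z (pre p n) \<subseteq> {x \<in> topspace T. f x \<in> ball (f p) e}"
    by (rule openin_imp_cylinder) (use assms in auto)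
  then show ?thesis by (fastforce simp: dist_real_def)
qed

text \<open>A continuous function is bounded near each point of its compact support, so finitely
  many cylinders suffice. This domination reduces growth and integrability questions for all of
  \<open>Cc G\<close> to indicators.\<close>

lemma Cc_bound:
  assumes "f \<in> Cc G"
  obtains F c where "finite F" "F \<subseteq> FP" "c \<ge> 0" "\<And>x. x \<in> X \<Longrightarrow> \<bar>f x\<bar> \<le> c * (\<Sum>w\<in>F. ind w x)"
proof -
  let ?S = "{x \<in> X. f x \<noteq> 0}"
  let ?K = "T closure_of ?S"
  have cont: "continuous_map T euclideanreal f" and K: "compactin T ?K"
    using assms by (auto simp: Cc_def)
  have "\<exists>n>0. \<exists>b\<ge>0. \<forall>x\<in>Z (pre p n). \<bar>f x\<bar> \<le> b" if "p \<in> ?K" for p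
  proof -
    have "p \<in> X" using that closure_of_subset_topspace[of T ?S] by auto
    from continuous_at_cylinder[OF cont this, of 1] obtain n
      where "n > 0" "\<forall>q\<in>Z (pre p n). \<bar>f q - f p\<bar> < 1" by auto
    then show ?thesis by (intro exI[of _ n] conjI exI[of _ "\<bar>f p\<bar> + 1"]) auto
  qed
  from compactin_finite_cover[OF K, of "\<lambda>w. \<exists>b\<ge>0. \<forall>x\<in>Z w. \<bar>f x\<bar> \<le> b", OF this]
  obtain F where F: "finite F" "F \<subseteq> FP" "\<And>w. w \<in> F \<Longrightarrow> \<exists>b\<ge>0. \<forall>x\<in>Z w. \<bar>f x\<bar> \<le> b"
    "?K \<subseteq> (\<Union>w\<in>F. Z w)" by blast
  then obtain b where b: "\<And>w. w \<in> F \<Longrightarrow> b w \<ge> 0 \<and> (\<forall>x\<in>Z w. \<bar>f x\<bar> \<le> b w)" by metis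
  define c where "c = sum b F"
  show ?thesis
  proof (rule that[of F c])
    show c0: "c \<ge> 0" unfolding c_def using b by (intro sum_nonneg) auto
    show "\<bar>f x\<bar> \<le> c * (\<Sum>w\<in>F. ind w x)" if "x \<in> X" for x
    proof (cases "f x = 0")
      case False
      then have "x \<in> ?K" using that closure_of_subset[of ?S T] by auto
      then obtain w where w: "w \<in> F" "x \<in> Z w" using F by blast
      have "\<bar>f x\<bar> \<le> b w" using b w by blast
      also have "\<dots> \<le> c" unfolding c_def using F b w by (intro member_le_sum) auto
      also have "\<dots> = c * ind w x" using w by (simp add: ind_eq_1)
      also have "\<dots> \<le> c * (\<Sum>w\<in>F. ind w x)"
        using c0 F w by (intro mult_left_mono member_le_sum) auto
      finally show ?thesis .
    qed (use c0 in \<open>simp add: sum_nonneg\<close>)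
  qed (use F in auto)
qed

end


subsection \<open>The Ruelle operator on functions with finitely many first edges\<close>

text \<open>The convergence of the variations to 0 in the form used below (see
  \<open>osc_of_var\<close>). The condition \<open>k > 0\<close> makes prefixes of length
  \<open>k\<close> genuine finite paths.\<close>

locale path_potential = path_graph G for G :: "('v, 'e) pre_digraph" +
  fixes \<phi> :: "(nat \<Rightarrow> 'e) \<Rightarrow> real"
  assumes osc: "\<epsilon> > 0 \<Longrightarrow> \<exists>k>0. \<forall>x\<in>inf_paths G. \<forall>y\<in>inf_paths G. (\<forall>i<k. x i = y i) \<longrightarrow> \<bar>\<phi> x - \<phi> y\<bar> \<le> \<epsilon>"
begin

abbreviation "L \<equiv> ruelle G \<phi>"

text \<open>The variation is controlled only from some depth on, so boundedness is clear on long
  cylinders; finite out-degree carries it back to short ones as a maximum over the extensions. No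
  bound uniform in \<open>w\<close> is claimed.\<close>

lemma phi_bounded:
  assumes "w \<in> FP"
  shows "\<exists>B. \<forall>x\<in>Z w. \<bar>\<phi> x\<bar> \<le> B"
  using assms
proof (induction rule: cylinder_induct)
  case (extend v)
  then obtain B where B: "\<And>e. v @ [e] \<in> FP \<Longrightarrow> \<forall>x\<in>Z (v @ [e]). \<bar>\<phi> x\<bar> \<le> B e" by metis
  let ?E = "{e. v @ [e] \<in> FP}"
  have "\<bar>\<phi> x\<bar> \<le> Max (B ` ?E)" if x: "x \<in> Z v" for x
  proof -
    obtain e where "e \<in> ?E" "x \<in> Z (v @ [e])"
      using x[unfolded Z_extend[OF extend(1)]] by blast
    then have "\<bar>\<phi> x\<bar> \<le> B e" using B by blast
    also have "\<dots> \<le> Max (B ` ?E)"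
      using \<open>e \<in> ?E\<close> finite_extensions[OF FP_not_Nil[OF extend(1)]] by (intro Max_ge) auto
    finally show ?thesis .
  qed
  then show ?case by blast
next
  case (path p)
  obtain k where k: "\<forall>x\<in>X. \<forall>y\<in>X. (\<forall>i<k. x i = y i) \<longrightarrow> \<bar>\<phi> x - \<phi> y\<bar> \<le> 1"
    using osc[of 1] by auto
  have p: "p \<in> X" using path cylinder_subset_inf_paths by blast
  have "\<bar>\<phi> x\<bar> \<le> \<bar>\<phi> p\<bar> + 1" if "n \<ge> k" "x \<in> Z (pre p n)" for n x
  proof -
    have "\<bar>\<phi> x - \<phi> p\<bar> \<le> 1" using that p by (intro k[rule_format]) (auto simp: in_cylinder_pre)
    then show ?thesis by linarith
  qed
  then show ?case by blast
qed

lemma continuous_phi: "continuous_map T euclideanreal \<phi>"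
  unfolding continuous_map_def
proof (intro conjI allI impI)
  fix U :: "real set" assume U: "openin euclideanreal U"
  show "openin T {x \<in> topspace T. \<phi> x \<in> U}"
    unfolding openin_T_iff
  proof safe
    fix p assume "p \<in> topspace T" "\<phi> p \<in> U"
    then obtain e where e: "e > 0" "ball (\<phi> p) e \<subseteq> U" and p: "p \<in> X"
      using U by (auto simp: open_contains_ball)
    obtain k where k: "k > 0" "\<forall>x\<in>X. \<forall>y\<in>X. (\<forall>i<k. x i = y i) \<longrightarrow> \<bar>\<phi> x - \<phi> y\<bar> \<le> e/2"
      using osc[of "e/2"] e by auto
    have "\<phi> q \<in> U" if "q \<in> Z (pre p k)" for q
    proof -
      have "\<bar>\<phi> p - \<phi> q\<bar> \<le> e/2" using that p by (intro k(2)[rule_format]) (auto simp: in_cylinder_pre)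
      then show ?thesis using e by (auto simp: dist_real_def)
    qed
    then have "Z (pre p k) \<subseteq> {x \<in> topspace T. \<phi> x \<in> U}"
      by (auto simp: in_cylinder_pre)
    then show "\<exists>n>0. Z (pre p n) \<subseteq> {x \<in> topspace T. \<phi> x \<in> U}" using k(1) by blast
  qed simp
qed simp

text \<open>On these functions \<open>L\<close> is a finite sum. Finite out-degree is enough for
  \<open>L\<close> to preserve the class, so iterates need no continuity or compact support to be
  carried along. Values off the path space do not count.\<close>

definition fin_rooted :: "((nat \<Rightarrow> 'e) \<Rightarrow> real) \<Rightarrow> bool" where
  "fin_rooted f \<longleftrightarrow> (\<exists>E. finite E \<and> E \<subseteq> arcs G \<and> (\<forall>y\<in>X. f y \<noteq> 0 \<longrightarrow> y 0 \<in> E))"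

text \<open>A preimage of \<open>x\<close> under the shift is determined by its first edge, so the
  sum over the fibre becomes one over edges. If \<open>x\<close> is not a path then no edge
  contributes and both sides vanish.\<close>

lemma ruelle_eq_sum:
  assumes "finite E" "\<forall>y\<in>X. f y \<noteq> 0 \<longrightarrow> y 0 \<in> E"
  shows "L f x = (\<Sum>e\<in>E. if case_nat e x \<in> X then exp (\<phi> (case_nat e x)) * f (case_nat e x) else 0)"
proof -
  let ?E = "{e \<in> E. case_nat e x \<in> X}"
  let ?h = "\<lambda>y. exp (\<phi> y) * f y"
  have "L f x = infsum ?h ((\<lambda>e. case_nat e x) ` ?E)"
    unfolding ruelle_def
  proof (rule infsum_cong_neutral)
    show "?h y = 0" if "y \<in> {y \<in> X. shift y = x} - (\<lambda>e. case_nat e x) ` ?E" for y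
    proof (rule ccontr)
      assume "?h y \<noteq> 0"
      then have "y 0 \<in> E" "y \<in> X" "y = case_nat (y 0) x" using that assms(2) case_nat_shift[of y] by auto
      then have "y \<in> (\<lambda>e. case_nat e x) ` ?E" by force
      then show False using that by blast
    qed
  qed auto
  also have "\<dots> = sum ?h ((\<lambda>e. case_nat e x) ` ?E)"
    using assms(1) by simp
  also have "\<dots> = (\<Sum>e\<in>?E. ?h (case_nat e x))"
  proof (rule sum.reindex_cong[OF _ refl refl])
    show "inj_on (\<lambda>e. case_nat e x) ?E" by (rule inj_onI) (metis old.nat.simps(4))
  qed
  also have "\<dots> = (\<Sum>e\<in>E. if case_nat e x \<in> X then ?h (case_nat e x) else 0)"
    using assms(1) by (rule sum.inter_filter)
  finally show ?thesis .
qed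

lemma fin_rooted_ruelle:
  assumes "fin_rooted f"
  shows "fin_rooted (L f)"
proof -
  obtain E where E: "finite E" "E \<subseteq> arcs G" "\<forall>y\<in>X. f y \<noteq> 0 \<longrightarrow> y 0 \<in> E"
    using assms by (auto simp: fin_rooted_def)
  let ?E' = "\<Union>e\<in>E. out_arcs G (head G e)"
  have "x 0 \<in> ?E'" if x: "x \<in> X" "L f x \<noteq> 0" for x
  proof -
    from x(2)[unfolded ruelle_eq_sum[OF E(1,3)]] obtain e where "e \<in> E" "case_nat e x \<in> X"
      by (rule sum.not_neutral_contains_not_neutral) (meson)
    then have "tail G (x 0) = head G e" by (simp add: case_nat_in_X)
    then show ?thesis using x(1) \<open>e \<in> E\<close> by (auto simp: inf_paths_def)
  qed
  moreover have "finite ?E'" using E finite_out by auto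
  moreover have "?E' \<subseteq> arcs G" by auto
  ultimately show ?thesis unfolding fin_rooted_def by blast
qed

lemma fin_rooted_ind: "w \<in> FP \<Longrightarrow> fin_rooted (ind w)"
  unfolding fin_rooted_def
  by (rule exI[of _ "{hd w}"])
     (use FP_arcs[of w] FP_not_Nil[of w] in \<open>auto simp: ind_def cylinder_def hd_conv_nth indicator_def\<close>)

lemma fin_rooted_sum:
  assumes "finite I" "\<And>i. i \<in> I \<Longrightarrow> fin_rooted (f i)"
  shows "fin_rooted (\<lambda>x. \<Sum>i\<in>I. c i * f i x)"
proof -
  obtain E where E: "\<And>i. i \<in> I \<Longrightarrow> finite (E i) \<and> E i \<subseteq> arcs G \<and> (\<forall>y\<in>X. f i y \<noteq> 0 \<longrightarrow> y 0 \<in> E i)"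
    using assms unfolding fin_rooted_def by metis
  show ?thesis
    unfolding fin_rooted_def
  proof (intro exI conjI ballI impI)
    show "finite (\<Union>i\<in>I. E i)" "(\<Union>i\<in>I. E i) \<subseteq> arcs G" using E assms by auto
    fix y assume "y \<in> X" "(\<Sum>i\<in>I. c i * f i y) \<noteq> 0"
    then obtain i where "i \<in> I" "f i y \<noteq> 0"
      by (metis (mono_tags, lifting) mult_zero_right sum.not_neutral_contains_not_neutral)
    then show "y 0 \<in> (\<Union>i\<in>I. E i)" using E \<open>y \<in> X\<close> by blast
  qed
qed

lemma fin_rooted_dominated: "fin_rooted g \<Longrightarrow> (\<And>x. x \<in> X \<Longrightarrow> \<bar>f x\<bar> \<le> g x) \<Longrightarrow> fin_rooted f"
  unfolding fin_rooted_def by (metis abs_le_zero_iff)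

lemma fin_rooted_Cc: "f \<in> Cc G \<Longrightarrow> fin_rooted f"
proof -
  assume "f \<in> Cc G"
  then obtain F c where F: "finite F" "F \<subseteq> FP" "c \<ge> 0" "\<And>x. x \<in> X \<Longrightarrow> \<bar>f x\<bar> \<le> c * (\<Sum>w\<in>F. ind w x)"
    by (rule Cc_bound) blast
  then have "fin_rooted (\<lambda>x. \<Sum>w\<in>F. c * ind w x)" by (intro fin_rooted_sum fin_rooted_ind) auto
  then show ?thesis by (rule fin_rooted_dominated) (use F in \<open>simp add: sum_distrib_left\<close>)
qed

lemma fin_rooted_common:
  assumes "finite I" "\<And>i. i \<in> I \<Longrightarrow> fin_rooted (f i)"
  obtains E where "finite E" "\<And>i. i \<in> I \<Longrightarrow> \<forall>y\<in>X. f i y \<noteq> 0 \<longrightarrow> y 0 \<in> E"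
proof -
  obtain E where E: "\<And>i. i \<in> I \<Longrightarrow> finite (E i) \<and> E i \<subseteq> arcs G \<and> (\<forall>y\<in>X. f i y \<noteq> 0 \<longrightarrow> y 0 \<in> E i)"
    using assms unfolding fin_rooted_def by metis
  show ?thesis by (rule that[of "\<Union>i\<in>I. E i"]) (use E assms in auto)
qed

lemma ruelle_sum:
  assumes "finite I" "\<And>i. i \<in> I \<Longrightarrow> fin_rooted (f i)"
  shows "L (\<lambda>x. \<Sum>i\<in>I. c i * f i x) x = (\<Sum>i\<in>I. c i * L (f i) x)"
proof -
  obtain E where E: "finite E" "\<And>i. i \<in> I \<Longrightarrow> \<forall>y\<in>X. f i y \<noteq> 0 \<longrightarrow> y 0 \<in> E"
    using fin_rooted_common[where I=I and f=f] assms by metis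
  have E2: "\<forall>y\<in>X. (\<Sum>i\<in>I. c i * f i y) \<noteq> 0 \<longrightarrow> y 0 \<in> E"
    using E(2) by (metis (mono_tags, lifting) mult_zero_right sum.not_neutral_contains_not_neutral)
  have "(\<Sum>i\<in>I. c i * L (f i) x) = (\<Sum>i\<in>I. \<Sum>e\<in>E. c i * (if case_nat e x \<in> X then exp (\<phi> (case_nat e x)) * f i (case_nat e x) else 0))"
    using ruelle_eq_sum[OF E(1) E(2)] by (auto simp: sum_distrib_left intro!: sum.cong)
  also have "\<dots> = (\<Sum>e\<in>E. \<Sum>i\<in>I. c i * (if case_nat e x \<in> X then exp (\<phi> (case_nat e x)) * f i (case_nat e x) else 0))"
    by (rule sum.swap)
  also have "\<dots> = L (\<lambda>x. \<Sum>i\<in>I. c i * f i x) x"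
    unfolding ruelle_eq_sum[OF E(1) E2] by (auto simp: sum_distrib_left mult_ac intro!: sum.cong)
  finally show ?thesis by simp
qed

lemma ruelle_mono:
  assumes "fin_rooted f" "fin_rooted g" "\<And>y. y \<in> X \<Longrightarrow> f y \<le> g y"
  shows "L f x \<le> L g x"
proof -
  obtain E where E: "finite E" "\<And>i. i \<in> {f,g} \<Longrightarrow> \<forall>y\<in>X. i y \<noteq> 0 \<longrightarrow> y 0 \<in> E"
    using fin_rooted_common[of "{f,g}" "\<lambda>i. i"] assms(1,2) by (metis finite.emptyI finite.insertI insertE singletonD)
  show ?thesis
    unfolding ruelle_eq_sum[OF E(1) E(2)[of f, simplified]] ruelle_eq_sum[OF E(1) E(2)[of g, simplified]]
    using assms(3) by (intro sum_mono) auto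
qed

lemma ruelle_nonneg: "(\<And>y. y \<in> X \<Longrightarrow> f y \<ge> 0) \<Longrightarrow> L f x \<ge> 0"
  unfolding ruelle_def by (intro infsum_nonneg) auto

lemma ruelle_ge:
  assumes "fin_rooted f" "\<And>y. y \<in> X \<Longrightarrow> f y \<ge> 0" "case_nat e x \<in> X"
  shows "exp (\<phi> (case_nat e x)) * f (case_nat e x) \<le> L f x"
proof -
  obtain E where E: "finite E" "\<forall>y\<in>X. f y \<noteq> 0 \<longrightarrow> y 0 \<in> E"
    using assms by (auto simp: fin_rooted_def)
  then have E': "finite (insert e E)" "\<forall>y\<in>X. f y \<noteq> 0 \<longrightarrow> y 0 \<in> insert e E" by auto
  have "(if case_nat e x \<in> X then exp (\<phi> (case_nat e x)) * f (case_nat e x) else 0) \<le> L f x"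
    unfolding ruelle_eq_sum[OF E'] by (rule member_le_sum) (use assms E' in auto)
  then show ?thesis using assms(3) by simp
qed

text \<open>Only the preimage beginning with \<open>a\<close> can contribute. As \<open>w\<close> is
  non-empty, every path in its cylinder may be preceded by \<open>a\<close>.\<close>

lemma ruelle_ind_Cons:
  assumes "w \<noteq> []" "a # w \<in> FP"
  shows "L (ind (a # w)) x = (if x \<in> Z w then exp (\<phi> (case_nat a x)) else 0)"
proof -
  have "\<forall>y\<in>X. ind (a # w) y \<noteq> 0 \<longrightarrow> y 0 \<in> {a}"
    by (auto simp: ind_def cylinder_def indicator_def)
  from ruelle_eq_sum[OF _ this, of x]
  have "L (ind (a # w)) x = (if case_nat a x \<in> X then exp (\<phi> (case_nat a x)) * ind (a # w) (case_nat a x) else 0)"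
    by simp
  moreover have "x \<in> Z w \<Longrightarrow> case_nat a x \<in> X"
    using conc_in_Z[of "[a]" w x] assms cylinder_subset_inf_paths by (fastforce simp: conc_Cons)
  ultimately show ?thesis
    by (auto simp: ind_def indicator_def case_nat_in_Z)
qed

lemma fin_rooted_ruelle_pow: "fin_rooted f \<Longrightarrow> fin_rooted ((L ^^ n) f)"
  by (induction n) (auto intro: fin_rooted_ruelle)

lemma ruelle_pow_mono:
  assumes "fin_rooted f" "fin_rooted g" "\<And>y. y \<in> X \<Longrightarrow> f y \<le> g y" "x \<in> X"
  shows "(L ^^ n) f x \<le> (L ^^ n) g x"
proof -
  have "\<forall>x\<in>X. (L ^^ n) f x \<le> (L ^^ n) g x"
    by (induction n) (use assms in \<open>auto intro!: ruelle_mono fin_rooted_ruelle_pow\<close>)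
  then show ?thesis using assms by blast
qed

lemma ruelle_pow_nonneg: 
  assumes "\<And>y. y \<in> X \<Longrightarrow> f y \<ge> 0" "x \<in> X"
  shows "(L ^^ n) f x \<ge> 0"
proof -
  have "\<forall>x\<in>X. (L ^^ n) f x \<ge> 0"
    by (induction n) (use assms in \<open>auto intro!: ruelle_nonneg\<close>)
  then show ?thesis using assms by blast
qed

lemma ruelle_pow_sum:
  assumes "finite I" "\<And>i. i \<in> I \<Longrightarrow> fin_rooted (f i)"
  shows "(L ^^ n) (\<lambda>x. \<Sum>i\<in>I. c i * f i x) x = (\<Sum>i\<in>I. c i * (L ^^ n) (f i) x)"
proof (induction n arbitrary: x)
  case (Suc n)
  then have "(L ^^ n) (\<lambda>x. \<Sum>i\<in>I. c i * f i x) = (\<lambda>x. \<Sum>i\<in>I. c i * (L ^^ n) (f i) x)" by blast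
  then show ?case using assms by (simp add: ruelle_sum fin_rooted_ruelle_pow)
qed simp

section \<open>Comparing iterates at different words and paths\<close>

lemma ruelle_pow_add: "(L ^^ (n + l)) f x = (L ^^ n) ((L ^^ l) f) x"
  by (simp add: funpow_add)

text \<open>Of all preimages of \<open>z\<close> under \<open>length w\<close> shifts only
  \<open>conc w z\<close> is kept. Its weight is bounded below independently of \<open>z\<close> and
  \<open>f\<close>, because \<phi> is bounded on each of the cylinders visited.\<close>

lemma ruelle_pow_conc_ge:
  assumes "w @ v \<in> FP" "v \<noteq> []"
  shows "\<exists>c>0. \<forall>f. fin_rooted f \<and> (\<forall>y\<in>X. 0 \<le> f y) \<longrightarrow> (\<forall>z\<in>Z v. c * f (conc w z) \<le> (L ^^ length w) f z)"
  using assms(1)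
proof (induction w)
  case Nil
  then show ?case by (intro exI[of _ 1]) auto
next
  case (Cons e w)
  have wv: "w @ v \<in> FP" using Cons.prems assms(2) by (simp add: FP_Cons)
  then obtain c where c: "c > 0" "\<And>f z. fin_rooted f \<Longrightarrow> (\<forall>y\<in>X. 0 \<le> f y) \<Longrightarrow> z \<in> Z v \<Longrightarrow> c * f (conc w z) \<le> (L ^^ length w) f z"
    using Cons.IH by blast
  obtain B where B: "\<forall>x\<in>Z ((e # w) @ v). \<bar>\<phi> x\<bar> \<le> B" using phi_bounded Cons.prems by blast
  show ?case
  proof (intro exI[of _ "c * exp (- B)"] conjI allI impI ballI)
    fix f z assume f: "fin_rooted f \<and> (\<forall>y\<in>X. 0 \<le> f y)" and z: "z \<in> Z v"
    have y: "conc (e # w) z \<in> Z ((e # w) @ v)"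
      using conc_in_Z Cons.prems assms(2) z by blast
    then have yX: "case_nat e (conc w z) \<in> X"
      using cylinder_subset_inf_paths by (metis conc_Cons subsetD)
    have "c * exp (- B) * f (conc (e # w) z) \<le> c * exp (\<phi> (conc (e # w) z)) * f (conc (e # w) z)"
      using c(1) f B y yX by (intro mult_right_mono mult_left_mono) (auto simp: conc_Cons abs_le_iff)
    also have "\<dots> \<le> c * L f (conc w z)"
      using ruelle_ge[OF _ _ yX, of f] f c(1) by (auto simp: conc_Cons)
    also have "\<dots> \<le> (L ^^ length w) (L f) z"
      using f z by (intro c(2) fin_rooted_ruelle) (auto intro: ruelle_nonneg)
    also have "\<dots> = (L ^^ length (e # w)) f z" by (simp add: funpow_swap1)
    finally show "c * exp (- B) * f (conc (e # w) z) \<le> (L ^^ length (e # w)) f z" .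
  qed (use c in auto)
qed

text \<open>The source of the Harnack inequality: if \<open>w\<close> connects \<open>u\<close> to
  \<open>v\<close>, then every path of \<open>Z v\<close> has a preimage in \<open>Z u\<close> under
  \<open>length (u @ w)\<close> shifts, of weight bounded below. The constants depend on
  \<open>u\<close> and \<open>v\<close> alone.\<close>

lemma ind_le_ruelle_pow:
  assumes "u \<in> FP" "v \<in> FP"
  shows "\<exists>c>0. \<exists>l. \<forall>x\<in>X. ind v x \<le> c * (L ^^ l) (ind u) x"
proof -
  obtain w where w: "(u @ w) @ v \<in> FP" using connecting_word[OF assms] by (metis append.assoc)
  have v: "v \<noteq> []" using assms by auto
  obtain c where c: "c > 0" "\<And>z. z \<in> Z v \<Longrightarrow> c * ind u (conc (u @ w) z) \<le> (L ^^ length (u @ w)) (ind u) z"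
    using ruelle_pow_conc_ge[OF w v] fin_rooted_ind[OF assms(1)] by force
  have "ind v x \<le> inverse c * (L ^^ length (u @ w)) (ind u) x" if "x \<in> X" for x
  proof (cases "x \<in> Z v")
    case True
    have "conc (u @ w) x \<in> Z u"
      using conc_in_Z[OF w v True] cylinder_append[of G u "w @ v"] by auto
    then have "c \<le> (L ^^ length (u @ w)) (ind u) x" using c(2)[OF True] by (simp add: ind_eq_1)
    then show ?thesis using True c(1) by (simp add: ind_eq_1 field_simps)
  next
    case False
    have "(L ^^ length (u @ w)) (ind u) x \<ge> 0" using that by (intro ruelle_pow_nonneg) auto
    then show ?thesis using False c(1) by (simp add: ind_eq_0)
  qed
  then show ?thesis using c(1) by (intro exI[of _ "inverse c"] conjI exI) auto
qed

text \<open>Prepending the same edge to two paths keeps their first \<open>k\<close> edges equal, so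
  each application of \<open>L\<close> costs at most exp(\<epsilon>). \<open>k > 0\<close> makes the
  same edges available for both paths, and \<open>length w \<le> k\<close> makes the indicators
  agree at the start.\<close>

lemma ruelle_pow_distortion:
  assumes w: "w \<in> FP" "length w \<le> k" "k > 0"
    and k: "\<forall>x\<in>X. \<forall>y\<in>X. (\<forall>i<k. x i = y i) \<longrightarrow> \<bar>\<phi> x - \<phi> y\<bar> \<le> \<epsilon>"
    and x: "x \<in> X" "y \<in> X" "\<forall>i<k. x i = y i"
  shows "(L ^^ n) (ind w) x \<le> exp (real n * \<epsilon>) * (L ^^ n) (ind w) y"
  using x
proof (induction n arbitrary: x y)
  case 0
  then have "ind w x = ind w y" by (intro ind_cong) (use w in auto)
  then show ?case by simp
next
  case (Suc n)
  let ?g = "(L ^^ n) (ind w)"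
  obtain E where E: "finite E" "\<forall>y\<in>X. ?g y \<noteq> 0 \<longrightarrow> y 0 \<in> E"
    using fin_rooted_ruelle_pow[OF fin_rooted_ind[OF w(1)], of n] by (auto simp: fin_rooted_def)
  have iff: "case_nat e x \<in> X \<longleftrightarrow> case_nat e y \<in> X" for e
    using Suc.prems w(3) by (simp add: case_nat_in_X)
  have "exp (\<phi> (case_nat e x)) * ?g (case_nat e x)
      \<le> exp (real (Suc n) * \<epsilon>) * (exp (\<phi> (case_nat e y)) * ?g (case_nat e y))"
    if X: "case_nat e x \<in> X" "case_nat e y \<in> X" for e
  proof -
    have agree: "\<forall>i<k. case_nat e x i = case_nat e y i"
      using Suc.prems(3) by (auto split: nat.split)
    then have "\<phi> (case_nat e x) \<le> \<epsilon> + \<phi> (case_nat e y)"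
      using k X by (fastforce simp: abs_le_iff)
    then have "exp (\<phi> (case_nat e x)) * ?g (case_nat e x)
        \<le> exp (\<epsilon> + \<phi> (case_nat e y)) * (exp (real n * \<epsilon>) * ?g (case_nat e y))"
      using Suc.IH[OF X agree] X(1) by (intro mult_mono) (auto intro: ruelle_pow_nonneg)
    also have "\<dots> = exp (real (Suc n) * \<epsilon>) * (exp (\<phi> (case_nat e y)) * ?g (case_nat e y))"
      by (simp add: exp_add algebra_simps)
    finally show ?thesis .
  qed
  then have "(\<Sum>e\<in>E. if case_nat e x \<in> X then exp (\<phi> (case_nat e x)) * ?g (case_nat e x) else 0)
      \<le> (\<Sum>e\<in>E. exp (real (Suc n) * \<epsilon>) * (if case_nat e y \<in> X then exp (\<phi> (case_nat e y)) * ?g (case_nat e y) else 0))"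
    unfolding iff by (intro sum_mono) (simp del: of_nat_Suc)
  then have "L ?g x \<le> exp (real (Suc n) * \<epsilon>) * L ?g y"
    unfolding ruelle_eq_sum[OF E] sum_distrib_left .
  then show ?case by (simp only: funpow.simps o_apply)
qed

end

subsection \<open>Growth rates and the pressure\<close>

text \<open>Replaces the limit superior of n-th roots: this notion passes directly through sums,
  domination and shifts of the index.\<close>

definition exp_bounded :: "(nat \<Rightarrow> real) \<Rightarrow> real \<Rightarrow> bool" where
  "exp_bounded a r \<longleftrightarrow> (\<exists>C. \<forall>n. a n \<le> C * r ^ n)"

definition growth :: "(nat \<Rightarrow> real) \<Rightarrow> ereal" where
  "growth a = limsup (\<lambda>n. ereal (root n (a n)))"

lemma growth_nonneg:
  assumes "\<And>n. a n \<ge> 0"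
  shows "growth a \<ge> 0"
  unfolding growth_def
  by (rule le_Limsup) (use assms in \<open>auto simp: real_root_ge_zero\<close>)

lemma exp_bounded_scale: "exp_bounded a r \<Longrightarrow> c \<ge> 0 \<Longrightarrow> exp_bounded (\<lambda>n. c * a n) r"
  unfolding exp_bounded_def by (metis mult.assoc mult_left_mono)

lemma exp_bounded_mono: "exp_bounded a r \<Longrightarrow> (\<And>n. b n \<le> a n) \<Longrightarrow> exp_bounded b r"
  unfolding exp_bounded_def by (meson order.trans)

lemma exp_bounded_sum:
  assumes "finite I" "\<And>i. i \<in> I \<Longrightarrow> exp_bounded (a i) r"
  shows "exp_bounded (\<lambda>n. \<Sum>i\<in>I. a i n) r"
proof -
  obtain C where C: "\<And>i n. i \<in> I \<Longrightarrow> a i n \<le> C i * r ^ n"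
    using assms(2) unfolding exp_bounded_def by metis
  have "(\<Sum>i\<in>I. a i n) \<le> (\<Sum>i\<in>I. C i) * r ^ n" for n
    unfolding sum_distrib_right by (intro sum_mono C)
  then show ?thesis unfolding exp_bounded_def by blast
qed

lemma exp_bounded_offset:
  assumes "exp_bounded a r"
  shows "exp_bounded (\<lambda>n. a (n + l)) r"
proof -
  obtain C where "\<And>n. a n \<le> C * r ^ n" using assms unfolding exp_bounded_def by blast
  then have "a (n + l) \<le> (C * r ^ l) * r ^ n" for n by (metis mult.assoc mult.commute power_add)
  then show ?thesis unfolding exp_bounded_def by blast
qed

text \<open>A bound on the rate does not give one at \<open>r\<close> itself, since subexponential
  factors may remain; the rates \<open>s > r\<close> absorb them.\<close>

lemma growth_le_iff:
  assumes a: "\<And>n. a n \<ge> 0" and r: "r > 0"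
  shows "growth a \<le> ereal r \<longleftrightarrow> (\<forall>s>r. exp_bounded a s)"
proof (intro iffI allI impI)
  fix s assume gr: "growth a \<le> ereal r" and s: "r < s"
  then have "limsup (\<lambda>n. ereal (root n (a n))) < ereal s"
    unfolding growth_def by (meson less_ereal.simps(1) order_le_less_trans)
  then have "\<forall>\<^sub>F n in sequentially. ereal (root n (a n)) < ereal s"
    by (rule Limsup_lessD)
  then obtain N where N: "\<And>n. n \<ge> N \<Longrightarrow> root n (a n) < s"
    unfolding eventually_sequentially by auto
  \<comment> \<open>The sum takes care of the indices up to \<open>N\<close>, the summand 1 of those
    beyond.\<close>
  define C where "C = 1 + (\<Sum>i\<le>N. a i / s ^ i)"
  have s0: "s > 0" using r s by simp
  have "a n \<le> C * s ^ n" for n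
  proof (cases "n \<le> N")
    case True
    have "a n / s ^ n \<le> (\<Sum>i\<le>N. a i / s ^ i)"
      using True a s0 by (intro member_le_sum) auto
    then have "a n / s ^ n \<le> C" by (simp add: C_def)
    then show ?thesis using s0 by (simp add: field_simps)
  next
    case False
    then have "n > 0" by simp
    then have "a n = root n (a n) ^ n" using a by simp
    also have "\<dots> \<le> s ^ n"
      using N[of n] False a by (intro power_mono) (auto intro: less_imp_le real_root_ge_zero)
    also have "\<dots> \<le> C * s ^ n"
      using s0 a by (simp add: C_def sum_nonneg)
    finally show ?thesis .
  qed
  then show "exp_bounded a s" unfolding exp_bounded_def by blast
next
  assume B: "\<forall>s>r. exp_bounded a s"
  have le: "growth a \<le> ereal q" if q: "q > r" for q
  proof -
    obtain s where s: "r < s" "s < q" using q dense by blast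
    obtain C where C: "\<And>n. a n \<le> C * s ^ n" using B s unfolding exp_bounded_def by blast
    \<comment> \<open>A positive constant is needed for its n-th root to tend to 1.\<close>
    define D where "D = max C 1"
    have D: "D > 0" "\<And>n. a n \<le> D * s ^ n"
    proof -
      fix n
      have "C * s ^ n \<le> D * s ^ n" using r s by (intro mult_right_mono) (auto simp: D_def)
      then show "a n \<le> D * s ^ n" using C[of n] by linarith
    qed (simp add: D_def)
    have "(\<lambda>n. root n D * s) \<longlonglongrightarrow> 1 * s"
      by (intro tendsto_intros LIMSEQ_root_const D)
    then have "\<forall>\<^sub>F n in sequentially. root n D * s < q"
      using s by (intro order_tendstoD) auto
    then have "\<forall>\<^sub>F n in sequentially. ereal (root n (a n)) \<le> ereal q"
      using eventually_gt_at_top[of 0]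
    proof eventually_elim
      case (elim n)
      have "root n (a n) \<le> root n (D * s ^ n)" using elim D by simp
      also have "\<dots> = root n D * s"
        using elim r s by (simp add: real_root_mult real_root_power_cancel)
      finally show ?case using elim by simp
    qed
    then show ?thesis unfolding growth_def by (rule Limsup_bounded)
  qed
  show "growth a \<le> ereal r"
  proof (rule ccontr)
    assume "\<not> growth a \<le> ereal r"
    then obtain q where "ereal r < ereal q" "ereal q < growth a"
      using ereal_dense2[of "ereal r" "growth a"] by (auto simp: not_le)
    then show False using le[of q] by simp
  qed
qed

lemma growth_mono:
  assumes "\<And>n. a n \<ge> 0" "\<And>n. b n \<ge> 0" "\<And>s. s > 0 \<Longrightarrow> exp_bounded b s \<Longrightarrow> exp_bounded a s"
  shows "growth a \<le> growth b"
proof (rule ccontr)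
  assume "\<not> growth a \<le> growth b"
  then obtain r where r: "growth b < ereal r" "ereal r < growth a"
    using ereal_dense2[of "growth b" "growth a"] by (auto simp: not_le)
  then have "r > 0" using growth_nonneg[of b] assms(2) by (metis ereal_less(2) order_le_less_trans)
  have "\<forall>s>r. exp_bounded b s" using growth_le_iff[of b r] assms(2) r \<open>r > 0\<close> by auto
  then have "\<forall>s>r. exp_bounded a s" using assms(3) \<open>r > 0\<close> by auto
  then have "growth a \<le> ereal r" using growth_le_iff[of a r] assms(1) \<open>r > 0\<close> by auto
  then show False using r by simp
qed

lemma log_ereal_le_iff: "log_ereal a \<le> ereal t \<longleftrightarrow> a \<le> ereal (exp t)"
proof (cases a)
  case (real r)
  show ?thesis
  proof (cases "r \<le> 0")
    case True
    then have "r \<le> exp t" using exp_gt_zero[of t] by linarith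
    then show ?thesis using True real by (simp add: log_ereal_def)
  next
    case False
    then have "ln r \<le> t \<longleftrightarrow> r \<le> exp t"
      by (metis exp_le_cancel_iff exp_ln not_le)
    then show ?thesis using False real by (simp add: log_ereal_def)
  qed
qed (auto simp: log_ereal_def)

context path_potential
begin

section \<open>The growth rate does not depend on the function or the path\<close>

lemma ruelle_pow_scale: "fin_rooted f \<Longrightarrow> (L ^^ n) (\<lambda>x. c * f x) x = c * (L ^^ n) f x"
  using ruelle_pow_sum[of "{()}" "\<lambda>_. f" n "\<lambda>_. c" x] by simp

lemma exp_bounded_dominated:
  assumes "fin_rooted f" "fin_rooted g" "\<And>y. y \<in> X \<Longrightarrow> f y \<le> c * (L ^^ l) g y" "c \<ge> 0" "x \<in> X"
    and "exp_bounded (\<lambda>n. (L ^^ n) g x) s"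
  shows "exp_bounded (\<lambda>n. (L ^^ n) f x) s"
proof (rule exp_bounded_mono)
  show "exp_bounded (\<lambda>n. c * (L ^^ (n + l)) g x) s"
    using assms by (intro exp_bounded_scale exp_bounded_offset)
  have fin_rooted: "fin_rooted ((L ^^ l) g)" using assms by (intro fin_rooted_ruelle_pow)
  then have "fin_rooted (\<lambda>y. c * (L ^^ l) g y)"
    unfolding fin_rooted_def by (metis mult_zero_right)
  then have "(L ^^ n) f x \<le> (L ^^ n) (\<lambda>y. c * (L ^^ l) g y) x" for n
    using assms by (intro ruelle_pow_mono) auto
  then show "(L ^^ n) f x \<le> c * (L ^^ (n + l)) g x" for n
    unfolding ruelle_pow_add ruelle_pow_scale[OF fin_rooted] .
qed

lemma exp_bounded_ind:
  assumes "u \<in> FP" "v \<in> FP" "x \<in> X" "exp_bounded (\<lambda>n. (L ^^ n) (ind u) x) s"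
  shows "exp_bounded (\<lambda>n. (L ^^ n) (ind v) x) s"
proof -
  obtain c l where c: "c > 0" "\<forall>x\<in>X. ind v x \<le> c * (L ^^ l) (ind u) x"
    using ind_le_ruelle_pow[OF assms(1,2)] by blast
  show ?thesis
    by (rule exp_bounded_dominated[OF fin_rooted_ind[OF assms(2)] fin_rooted_ind[OF assms(1)] _ _ assms(3,4), of c l])
       (use c in auto)
qed

text \<open>Up to a constant, an iterate at \<open>conc u x\<close> is one of the terms of an
  iterate at \<open>x\<close> with \<open>length u\<close> more steps. So growth bounds pass from a
  path to its backward extensions.\<close>

lemma exp_bounded_conc:
  assumes "u @ v \<in> FP" "v \<noteq> []" "x \<in> Z v" "w \<in> FP" "exp_bounded (\<lambda>n. (L ^^ n) (ind w) x) s"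
  shows "exp_bounded (\<lambda>n. (L ^^ n) (ind w) (conc u x)) s"
proof -
  obtain c where c: "c > 0" "\<And>f. fin_rooted f \<Longrightarrow> \<forall>y\<in>X. 0 \<le> f y \<Longrightarrow> c * f (conc u x) \<le> (L ^^ length u) f x"
    using ruelle_pow_conc_ge[OF assms(1,2)] assms(3) by blast
  show ?thesis
  proof (rule exp_bounded_mono)
    show "exp_bounded (\<lambda>n. inverse c * (L ^^ (n + length u)) (ind w) x) s"
      using assms c by (intro exp_bounded_scale exp_bounded_offset) auto
    fix n
    have "c * (L ^^ n) (ind w) (conc u x) \<le> (L ^^ length u) ((L ^^ n) (ind w)) x"
      using assms by (intro c(2) fin_rooted_ruelle_pow fin_rooted_ind) (auto intro: ruelle_pow_nonneg)
    then show "(L ^^ n) (ind w) (conc u x) \<le> inverse c * (L ^^ (n + length u)) (ind w) x"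
      using c(1) unfolding add.commute[of n] ruelle_pow_add by (simp add: field_simps)
  qed
qed

text \<open>Strong connectedness supplies a backward extension \<open>z\<close> of \<open>x\<close>
  that begins like \<open>y\<close>. The bound passes from \<open>x\<close> to \<open>z\<close> with
  the same rate, and from \<open>z\<close> to \<open>y\<close> by distortion, which is why the rate
  has to increase from \<open>q\<close> to \<open>s\<close>.\<close>

lemma exp_bounded_points:
  assumes x: "x \<in> X" "y \<in> X" and w: "w \<in> FP" and q: "0 < q" "q < s"
    and B: "exp_bounded (\<lambda>n. (L ^^ n) (ind w) x) q"
  shows "exp_bounded (\<lambda>n. (L ^^ n) (ind w) y) s"
proof -
  \<comment> \<open>Chosen so that the distortion factor turns \<open>q ^ n\<close> into exactly
    \<open>s ^ n\<close>.\<close>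
  define \<epsilon> where "\<epsilon> = ln (s / q)"
  have \<epsilon>: "\<epsilon> > 0" "exp \<epsilon> = s / q" using q by (auto simp: \<epsilon>_def)
  obtain k0 where k0: "\<forall>x\<in>X. \<forall>y\<in>X. (\<forall>i<k0. x i = y i) \<longrightarrow> \<bar>\<phi> x - \<phi> y\<bar> \<le> \<epsilon>"
    using osc[OF \<epsilon>(1)] by blast
  define k where "k = max k0 (length w)"
  have k: "\<forall>x\<in>X. \<forall>y\<in>X. (\<forall>i<k. x i = y i) \<longrightarrow> \<bar>\<phi> x - \<phi> y\<bar> \<le> \<epsilon>"
    using k0 by (simp add: k_def)
  have len: "length w \<le> k" "k > 0" using FP_not_Nil[OF w] by (simp_all add: k_def less_max_iff_disj)
  have "[x 0] \<in> FP" using x(1) by (simp add: inf_paths_def)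
  then obtain w' where w': "pre y k @ w' @ [x 0] \<in> FP"
    using connecting_word[OF pre_in_FP[OF x(2) len(2)]] by blast
  let ?z = "conc (pre y k @ w') x"
  have xZ: "x \<in> Z [x 0]" using x(1) by (simp add: Z_single)
  have "?z \<in> Z (pre y k @ w' @ [x 0])"
    using conc_in_Z[of "pre y k @ w'" "[x 0]" x] w' xZ by simp
  then have zpre: "?z \<in> Z (pre y k)" using cylinder_append by blast
  then have z: "?z \<in> X" "\<forall>i<k. y i = ?z i" by (auto simp: in_cylinder_pre)
  have "exp_bounded (\<lambda>n. (L ^^ n) (ind w) ?z) q"
    using w' xZ w B by (intro exp_bounded_conc[of _ "[x 0]"]) simp_all
  then obtain C where C: "\<And>n. (L ^^ n) (ind w) ?z \<le> C * q ^ n"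
    unfolding exp_bounded_def by blast
  have "(L ^^ n) (ind w) y \<le> C * s ^ n" for n
  proof -
    have "(L ^^ n) (ind w) y \<le> exp (real n * \<epsilon>) * (L ^^ n) (ind w) ?z"
      by (rule ruelle_pow_distortion[OF w len k x(2) z])
    also have "\<dots> \<le> exp (real n * \<epsilon>) * (C * q ^ n)"
      by (intro mult_left_mono C) simp
    also have "\<dots> = C * s ^ n"
      using q by (simp add: exp_of_nat_mult \<epsilon>(2) power_divide)
    finally show ?thesis .
  qed
  then show ?thesis unfolding exp_bounded_def by blast
qed

text \<open>From above, \<open>f\<close> is dominated by finitely many indicators, all of which grow
  like \<open>ind w\<close>. From below, \<open>f\<close> exceeds half of a positive value
  \<open>f y\<close> on some cylinder around \<open>y\<close>, whose indicator is then at most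
  \<open>2 / f y\<close> times \<open>f\<close>.\<close>

lemma exp_bounded_Cc_iff:
  assumes f: "f \<in> Cc G" "\<forall>y\<in>X. f y \<ge> 0" "\<exists>y\<in>X. f y \<noteq> 0" and w: "w \<in> FP" and x: "x \<in> X"
  shows "exp_bounded (\<lambda>n. (L ^^ n) f x) s \<longleftrightarrow> exp_bounded (\<lambda>n. (L ^^ n) (ind w) x) s"
proof
  assume B: "exp_bounded (\<lambda>n. (L ^^ n) (ind w) x) s"
  obtain F c where F: "finite F" "F \<subseteq> FP" "c \<ge> 0" "\<And>x. x \<in> X \<Longrightarrow> \<bar>f x\<bar> \<le> c * (\<Sum>w\<in>F. ind w x)"
    using Cc_bound[OF f(1)] by metis
  have FSF: "fin_rooted (\<lambda>x. \<Sum>v\<in>F. c * ind v x)" using F by (intro fin_rooted_sum fin_rooted_ind) auto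
  show "exp_bounded (\<lambda>n. (L ^^ n) f x) s"
  proof (rule exp_bounded_mono)
    show "exp_bounded (\<lambda>n. \<Sum>v\<in>F. c * (L ^^ n) (ind v) x) s"
      using F by (intro exp_bounded_sum exp_bounded_scale exp_bounded_ind[OF w _ x B]) auto
    fix n
    have "(L ^^ n) f x \<le> (L ^^ n) (\<lambda>x. \<Sum>v\<in>F. c * ind v x) x"
    proof (rule ruelle_pow_mono[OF fin_rooted_Cc[OF f(1)] FSF _ x])
      show "f y \<le> (\<Sum>v\<in>F. c * ind v y)" if "y \<in> X" for y
        using F(4)[OF that] by (simp add: sum_distrib_left)
    qed
    also have "\<dots> = (\<Sum>v\<in>F. c * (L ^^ n) (ind v) x)"
      using F fin_rooted_ind by (intro ruelle_pow_sum) auto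
    finally show "(L ^^ n) f x \<le> (\<Sum>v\<in>F. c * (L ^^ n) (ind v) x)" .
  qed
next
  assume B: "exp_bounded (\<lambda>n. (L ^^ n) f x) s"
  obtain y where y: "y \<in> X" "f y > 0" using f by force
  have "continuous_map T euclideanreal f" using f(1) by (simp add: Cc_def)
  from continuous_at_cylinder[OF this y(1), of "f y / 2"] obtain n
    where n: "n > 0" "\<forall>q\<in>Z (pre y n). \<bar>f q - f y\<bar> < f y / 2" using y by auto
  let ?v = "pre y n"
  have v: "?v \<in> FP" using pre_in_FP y n by blast
  have "exp_bounded (\<lambda>n. (L ^^ n) (ind ?v) x) s"
  proof (rule exp_bounded_dominated[OF fin_rooted_ind[OF v] fin_rooted_Cc[OF f(1)] _ _ x B])
    show "ind ?v q \<le> 2 / f y * (L ^^ 0) f q" if "q \<in> X" for q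
    proof (cases "q \<in> Z ?v")
      case True
      then have "f q \<ge> f y / 2" using n(2) by (smt (verit) field_sum_of_halves)
      then show ?thesis using True y by (simp add: ind_eq_1 field_simps)
    next
      case False
      then show ?thesis using that f(2) y by (simp add: ind_eq_0)
    qed
  qed (use y in simp)
  then show "exp_bounded (\<lambda>n. (L ^^ n) (ind w) x) s"
    using exp_bounded_ind v w x by blast
qed

text \<open>Justifies the definite description in \<open>pressure_at\<close>: all admissible
  functions share the same exponential bounds, and \<open>ind w\<close> is itself admissible, which
  gives uniqueness.\<close>

lemma pressure_at_eq:
  assumes "w \<in> FP" "x \<in> X"
  shows "pressure_at G \<phi> x = log_ereal (growth (\<lambda>n. (L ^^ n) (ind w) x))"
  unfolding pressure_at_def growth_def[symmetric]
proof (rule the_equality)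
  have pos: "(L ^^ n) f x \<ge> 0" if "\<forall>y\<in>X. f y \<ge> 0" for f n
    using that assms by (intro ruelle_pow_nonneg) auto
  have "growth (\<lambda>n. (L ^^ n) f x) = growth (\<lambda>n. (L ^^ n) (ind w) x)"
    if "f \<in> Cc G" "(\<forall>y\<in>X. f y \<ge> 0) \<and> (\<exists>y\<in>X. f y \<noteq> 0)" for f
    using that pos exp_bounded_Cc_iff[of f w x] assms
    by (intro antisym growth_mono) auto
  then show "\<forall>f\<in>Cc G. (\<forall>y\<in>X. f y \<ge> 0) \<and> (\<exists>y\<in>X. f y \<noteq> 0) \<longrightarrow>
      log_ereal (growth (\<lambda>n. (L ^^ n) (ind w) x)) = log_ereal (growth (\<lambda>n. (L ^^ n) f x))"
    by simp
next
  fix c assume c: "\<forall>f\<in>Cc G. (\<forall>y\<in>X. f y \<ge> 0) \<and> (\<exists>y\<in>X. f y \<noteq> 0) \<longrightarrow>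
      c = log_ereal (growth (\<lambda>n. (L ^^ n) f x))"
  obtain y where "y \<in> Z w" using Z_nonempty[OF assms(1)] by blast
  then have "y \<in> X" "ind w y \<noteq> 0" using cylinder_subset_inf_paths by (auto simp: ind_eq_1)
  then show "c = log_ereal (growth (\<lambda>n. (L ^^ n) (ind w) x))"
    using c ind_in_Cc[OF assms(1)] by auto
qed

lemma pressure_at_le_iff:
  assumes "w \<in> FP" "x \<in> X"
  shows "pressure_at G \<phi> x \<le> ereal t \<longleftrightarrow> (\<forall>s>exp t. exp_bounded (\<lambda>n. (L ^^ n) (ind w) x) s)"
  unfolding pressure_at_eq[OF assms] log_ereal_le_iff
  using assms by (intro growth_le_iff) (auto intro: ruelle_pow_nonneg)

text \<open>One word and one path test the whole supremum: a rate strictly between exp(t) and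
  \<open>s\<close> leaves room for the loss in \<open>exp_bounded_points\<close>.\<close>

lemma pressure_le_iff:
  assumes "w \<in> FP" "x \<in> X"
  shows "pressure G \<phi> \<le> ereal t \<longleftrightarrow> (\<forall>s>exp t. exp_bounded (\<lambda>n. (L ^^ n) (ind w) x) s)"
proof -
  have "pressure G \<phi> \<le> ereal t \<longleftrightarrow> (\<forall>y\<in>X. pressure_at G \<phi> y \<le> ereal t)"
    by (simp add: pressure_def SUP_le_iff)
  also have "\<dots> \<longleftrightarrow> (\<forall>y\<in>X. \<forall>s>exp t. exp_bounded (\<lambda>n. (L ^^ n) (ind w) y) s)"
    using pressure_at_le_iff[OF assms(1)] by auto
  also have "\<dots> \<longleftrightarrow> (\<forall>s>exp t. exp_bounded (\<lambda>n. (L ^^ n) (ind w) x) s)"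
    using exp_bounded_points[OF assms(2) _ assms(1)] assms(2) by (meson dense exp_gt_zero order.strict_trans)
  finally show ?thesis .
qed

end

subsection \<open>Locally finite Borel measures\<close>

context path_graph
begin

text \<open>Generated by cylinders to suit the extension and uniqueness theorems for measures. As
  there are only countably many finite paths, it has the same sets as the Borel \<sigma>-algebra
  (\<open>sets_path_borel_open\<close>).\<close>

definition path_borel :: "(nat \<Rightarrow> 'e) measure" where
  "path_borel = sigma X (Z ` FP)"

lemma space_path_borel [simp]: "space path_borel = X"
  by (simp add: path_borel_def space_measure_of_conv)

lemma sets_path_borel: "sets path_borel = sigma_sets X (Z ` FP)"
  unfolding path_borel_def by (rule sets_measure_of) (use cylinder_subset_inf_paths in auto)

lemma open_in_path_borel:
  assumes "openin T U"
  shows "U \<in> sets path_borel"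
proof -
  have "(\<Union>w\<in>{w \<in> FP. Z w \<subseteq> U}. Z w) \<in> sets path_borel"
    by (rule sets.countable_UN'') (use countable_FP in \<open>auto simp: sets_path_borel intro: countable_subset\<close>)
  then show ?thesis using openin_eq_Union[OF assms] by simp
qed

lemma sets_path_borel_open: "sets path_borel = sigma_sets X {U. openin T U}"
proof
  show "sets path_borel \<subseteq> sigma_sets X {U. openin T U}"
    unfolding sets_path_borel by (rule sigma_sets_mono') (use openin_Z in auto)
  show "sigma_sets X {U. openin T U} \<subseteq> sets path_borel"
    using sets.sigma_sets_subset[of "{U. openin T U}" path_borel] open_in_path_borel by auto
qed

lemma Z_in_path_borel [measurable, simp]: "Z w \<in> sets path_borel"
proof -
  have "X - Z w \<in> sets path_borel" using closedin_Z[of w] by (auto simp only: closedin_def topspace_T intro: open_in_path_borel)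
  then have "X - (X - Z w) \<in> sets path_borel" by (metis sets.compl_sets space_path_borel)
  then show ?thesis using cylinder_subset_inf_paths[of G w] by (simp add: double_diff)
qed

lemma continuous_imp_measurable:
  assumes "continuous_map T euclideanreal f"
  shows "f \<in> borel_measurable path_borel"
proof (rule borel_measurableI)
  fix S :: "real set" assume "open S"
  then have "openin T {x \<in> topspace T. f x \<in> S}"
    using assms by (auto simp: continuous_map_def)
  then have "{x \<in> topspace T. f x \<in> S} \<in> sets path_borel" by (rule open_in_path_borel)
  moreover have "f -` S \<inter> space path_borel = {x \<in> topspace T. f x \<in> S}" by auto
  ultimately show "f -` S \<inter> space path_borel \<in> sets path_borel" by simp
qed

lemma X_eq_Union_nat: "X = (\<Union>n::nat. Z [from_nat_into (arcs G) n])"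
proof -
  have "range (from_nat_into (arcs G)) = arcs G"
    using infinite_arcs countable_arcs by (intro range_from_nat_into) auto
  then have "(\<Union>e\<in>arcs G. Z [e]) = (\<Union>e\<in>range (from_nat_into (arcs G)). Z [e])" by simp
  then show ?thesis unfolding X_eq_Union by (simp only: image_image)
qed

lemma arc_word: "[from_nat_into (arcs G) n] \<in> FP"
  using from_nat_into[of "arcs G" n] infinite_arcs by (metis FP_single finite.emptyI)

text \<open>Equivalent to \<open>regular_borel_measure\<close> by
  \<open>regular_iff_locally_finite\<close>, so that regularity need not be carried along.\<close>

definition locally_finite :: "(nat \<Rightarrow> 'e) measure \<Rightarrow> bool" where
  "locally_finite m \<longleftrightarrow> sets m = sets path_borel \<and> (\<forall>w\<in>FP. emeasure m (Z w) < \<infinity>)"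

lemma locally_finite_space: "locally_finite m \<Longrightarrow> space m = X"
  by (metis locally_finite_def sets_eq_imp_space_eq space_path_borel)

lemma regular_imp_locally_finite: "regular_borel_measure G m \<Longrightarrow> locally_finite m"
  using compactin_Z by (auto simp: regular_borel_measure_def locally_finite_def sets_path_borel_open)

text \<open>Cylinders are nested or disjoint; the empty set has to be added because no cylinder of a
  finite path is empty.\<close>

lemma Int_stable_cylinders: "Int_stable (insert {} (Z ` FP))"
proof (rule Int_stableI)
  have "Z u \<inter> Z v \<in> {{}, Z u, Z v}" for u v
    using cylinder_cases[of u v G] cylinder_cases[of v u G] nat_le_linear[of "length u" "length v"]
    by (auto simp: Int_absorb1 Int_absorb2 Int_commute)
  then show "a \<inter> b \<in> insert {} (Z ` FP)" if "a \<in> insert {} (Z ` FP)" "b \<in> insert {} (Z ` FP)" for a b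
    using that by (elim insertE imageE) (simp_all, blast)
qed

lemma locally_finite_eqI:
  assumes "locally_finite m" "locally_finite m'" "\<And>w. w \<in> FP \<Longrightarrow> emeasure m (Z w) = emeasure m' (Z w)"
  shows "m = m'"
proof (rule measure_eqI_generator_eq[OF Int_stable_cylinders, of X])
  have "sigma_sets X (insert {} (Z ` FP)) = sigma_sets X (Z ` FP)"
    by (rule sigma_sets_eqI) (auto intro: sigma_sets.Empty)
  then show "sets m = sigma_sets X (insert {} (Z ` FP))" "sets m' = sigma_sets X (insert {} (Z ` FP))"
    using assms by (auto simp: locally_finite_def sets_path_borel)
  show "range (\<lambda>n. Z [from_nat_into (arcs G) n]) \<subseteq> insert {} (Z ` FP)"
    using arc_word by blast
  show "(\<Union>i. Z [from_nat_into (arcs G) i]) = X" using X_eq_Union_nat by simp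
  show "emeasure m (Z [from_nat_into (arcs G) i]) \<noteq> \<infinity>" for i
    using assms(1) arc_word[of i] unfolding locally_finite_def by (metis order_less_irrefl)
  show "insert {} (Z ` FP) \<subseteq> Pow X" using cylinder_subset_inf_paths by auto
qed (use assms(3) in auto)

lemma locally_finite_sigma_finite:
  assumes "locally_finite m"
  shows "sigma_finite_measure m"
proof
  let ?A = "range (\<lambda>n. Z [from_nat_into (arcs G) n])"
  have "emeasure m (Z [from_nat_into (arcs G) n]) \<noteq> \<infinity>" for n
    using assms arc_word[of n] unfolding locally_finite_def by (metis order_less_irrefl)
  then have "\<forall>a\<in>?A. emeasure m a \<noteq> \<infinity>" by simp
  moreover have "countable ?A" "?A \<subseteq> sets m" "\<Union>?A = space m"
    using assms X_eq_Union_nat locally_finite_space[OF assms] by (auto simp: locally_finite_def)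
  ultimately show "\<exists>A. countable A \<and> A \<subseteq> sets m \<and> \<Union> A = space m \<and> (\<forall>a\<in>A. emeasure m a \<noteq> \<infinity>)"
    by blast
qed

text \<open>The claim is symmetric in \<open>A\<close> and its complement, so complements are
  handled by exchanging \<open>U\<close> and \<open>V\<close>. It bounds the excess of
  \<open>U\<close>, because \<open>U - A\<close> is contained in \<open>U \<inter> V\<close>. Inside
  a single cylinder all masses are finite.\<close>

lemma approximation_in_cylinder:
  assumes m: "locally_finite m" and w: "w \<in> FP" and A: "A \<in> sets m" and "\<epsilon> > 0"
  shows "\<exists>U V. openin T U \<and> openin T V \<and> A \<inter> Z w \<subseteq> U \<and> U \<subseteq> Z w \<and> Z w - A \<subseteq> V \<and> V \<subseteq> Z w \<and>
    emeasure m (U \<inter> V) \<le> ennreal \<epsilon>"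
proof -
  have sm: "sets m = sets path_borel" using m by (simp add: locally_finite_def)
  have os: "U \<in> sets m" if "openin T U" for U using that open_in_path_borel sm by simp
  have ow: "openin T (Z w)" by (rule openin_Z[OF w])
  have "A \<in> sigma_sets X (Z ` FP)" using A sm sets_path_borel by simp
  then show ?thesis
    using \<open>\<epsilon> > 0\<close>
  proof (induction arbitrary: \<epsilon>)
    case (Basic a)
    then obtain v where v: "a = Z v" "v \<in> FP" by blast
    have "openin T (Z w - Z v)" using ow closedin_Z by (rule openin_diff)
    moreover have "openin T (Z w \<inter> Z v)" using ow openin_Z[OF v(2)] by (rule openin_Int)
    moreover have "(Z w \<inter> Z v) \<inter> (Z w - Z v) = {}" by blast
    ultimately show ?case
      unfolding v(1) by (intro exI[of _ "Z w \<inter> Z v"] exI[of _ "Z w - Z v"]) (simp add: Int_commute)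
  next
    case Empty
    then show ?case using ow by (intro exI[of _ "{}"] exI[of _ "Z w"]) auto
  next
    case (Compl a)
    from Compl.IH[OF Compl.prems] obtain U V where "openin T U" "openin T V" "a \<inter> Z w \<subseteq> U"
      "U \<subseteq> Z w" "Z w - a \<subseteq> V" "V \<subseteq> Z w" "emeasure m (U \<inter> V) \<le> ennreal \<epsilon>" by (elim exE conjE)
    moreover from this have "(X - a) \<inter> Z w \<subseteq> V" "Z w - (X - a) \<subseteq> U" 
      using cylinder_subset_inf_paths[of G w] by auto
    ultimately show ?case by (intro exI[of _ V] exI[of _ U]) (simp add: Int_commute)
  next
    case (Union a)
    have "\<exists>U V. openin T U \<and> openin T V \<and> a i \<inter> Z w \<subseteq> U \<and> U \<subseteq> Z w \<and> Z w - a i \<subseteq> V \<and> V \<subseteq> Z w \<and>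
        emeasure m (U \<inter> V) \<le> ennreal (\<epsilon> / 2 * (1 / 2) ^ Suc i)" for i
      using Union.IH[of "\<epsilon> / 2 * (1 / 2) ^ Suc i" i] Union.prems by simp
    then obtain U V where UV: "\<And>i::nat. openin T (U i)" "\<And>i. openin T (V i)" "\<And>i. a i \<inter> Z w \<subseteq> U i"
      "\<And>i. U i \<subseteq> Z w" "\<And>i. Z w - a i \<subseteq> V i" "\<And>i. V i \<subseteq> Z w"
      "\<And>i. emeasure m (U i \<inter> V i) \<le> ennreal (\<epsilon> / 2 * (1 / 2) ^ Suc i)"
      by metis
    have am: "a i \<in> sets m" for i using Union.hyps sm sets_path_borel by simp
    \<comment> \<open>What the first \<open>n\<close> sets miss of the union. These sets decrease to
      the empty set and have finite mass, so their mass tends to 0.\<close>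
    define D where "D n = Z w \<inter> (\<Union>i. a i) - (\<Union>i<n. a i)" for n
    have Zm: "Z w \<in> sets m" using sm by simp
    have "(\<lambda>n. emeasure m (D n)) \<longlonglongrightarrow> emeasure m (\<Inter>n. D n)"
    proof (rule Lim_emeasure_decseq)
      show "range D \<subseteq> sets m" using am Zm by (auto simp: D_def)
      show "decseq D" by (rule decseq_SucI) (auto simp: D_def)
      show "emeasure m (D i) \<noteq> \<infinity>" for i
      proof -
        have "emeasure m (D i) \<le> emeasure m (Z w)" using Zm by (intro emeasure_mono) (auto simp: D_def)
        then show ?thesis using m w by (auto simp: locally_finite_def top_unique)
      qed
    qed
    moreover have "(\<Inter>n. D n) = {}" by (auto simp: D_def)
    ultimately have "(\<lambda>n. emeasure m (D n)) \<longlonglongrightarrow> 0" by simp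
    then have "\<forall>\<^sub>F n in sequentially. emeasure m (D n) < ennreal (\<epsilon> / 2)"
      using Union.prems by (intro order_tendstoD) auto
    then obtain N where N: "emeasure m (D N) < ennreal (\<epsilon> / 2)"
      by (auto simp: eventually_sequentially)
    \<comment> \<open>Only finitely many of the \<open>V i\<close> may be intersected if openness is
      to be kept; the price is the remainder \<open>D N\<close>.\<close>
    define VV where "VV = Z w \<inter> (\<Inter>i\<in>{..<N}. V i)"
    have oV: "openin T VV"
    proof (cases "N = 0")
      case False
      then show ?thesis unfolding VV_def using UV ow by (intro openin_Int openin_INT2) auto
    qed (simp add: VV_def ow)
    have "(\<Union>i. U i) \<inter> VV \<subseteq> (\<Union>i. U i \<inter> V i) \<union> D N"
    proof
      fix x assume x: "x \<in> (\<Union>i. U i) \<inter> VV"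
      then obtain j where j: "x \<in> U j" "x \<in> Z w" by (auto simp: VV_def)
      show "x \<in> (\<Union>i. U i \<inter> V i) \<union> D N"
      proof (cases "x \<in> a j")
        case False
        then show ?thesis using j UV(5)[of j] by blast
      next
        case True
        show ?thesis
        proof (cases "\<exists>i<N. x \<in> a i")
          case True
          then obtain i where "i < N" "x \<in> a i" by blast
          then have "x \<in> U i" "x \<in> V i" using UV(3)[of i] x j by (auto simp: VV_def)
          then show ?thesis by blast
        next
          case False
          then show ?thesis using True j by (auto simp: D_def)
        qed
      qed
    qed
    then have "emeasure m ((\<Union>i. U i) \<inter> VV) \<le> emeasure m ((\<Union>i. U i \<inter> V i) \<union> D N)"
      using os UV am Zm by (intro emeasure_mono) (auto simp: D_def)
    also have "\<dots> \<le> emeasure m (\<Union>i. U i \<inter> V i) + emeasure m (D N)"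
      using os UV am Zm by (intro emeasure_subadditive) (auto simp: D_def)
    also have "\<dots> \<le> ennreal (\<epsilon> / 2) + ennreal (\<epsilon> / 2)"
    proof (intro add_mono)
      have "emeasure m (\<Union>i. U i \<inter> V i) \<le> (\<Sum>i. emeasure m (U i \<inter> V i))"
        using os UV by (intro emeasure_subadditive_countably) auto
      also have "\<dots> \<le> (\<Sum>i. ennreal (\<epsilon> / 2 * (1 / 2) ^ Suc i))"
        by (intro suminf_le UV) auto
      also have "\<dots> = ennreal (\<epsilon> / 2)"
      proof (rule suminf_ennreal_eq)
        show "(\<lambda>i. \<epsilon> / 2 * (1 / 2) ^ Suc i) sums (\<epsilon> / 2)"
          using sums_mult[OF power_half_series, of "\<epsilon> / 2"] by simp
      qed (use Union.prems in simp)
      finally show "emeasure m (\<Union>i. U i \<inter> V i) \<le> ennreal (\<epsilon> / 2)" .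
    qed (use N in simp)
    also have "\<dots> = ennreal \<epsilon>" using Union.prems by (simp flip: ennreal_plus)
    finally have le: "emeasure m ((\<Union>i. U i) \<inter> VV) \<le> ennreal \<epsilon>" .
    have "openin T (\<Union>i. U i)" using UV(1) by blast
    moreover have "(\<Union>i. a i) \<inter> Z w \<subseteq> (\<Union>i. U i)" using UV(3) by blast
    moreover have "(\<Union>i. U i) \<subseteq> Z w" using UV(4) by blast
    moreover have "Z w - (\<Union>i. a i) \<subseteq> VV" using UV(5) by (auto simp: VV_def)
    moreover have "VV \<subseteq> Z w" by (auto simp: VV_def)
    ultimately show ?case using le oV by blast
  qed
qed

text \<open>\<open>A\<close> is cut along the cylinders of its first edges, the \<open>n\<close>-th
  piece being approximated with error \<open>\<epsilon> * (1 / 2) ^ Suc n\<close>. This also covers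
  sets of infinite mass.\<close>

lemma locally_finite_outer_regular:
  assumes m: "locally_finite m" and A: "A \<in> sets m"
  shows "emeasure m A = (INF U \<in> {U. openin T U \<and> A \<subseteq> U}. emeasure m U)"
proof (rule antisym)
  have sm: "sets m = sets path_borel" using m by (simp add: locally_finite_def)
  have os: "U \<in> sets m" if "openin T U" for U using that open_in_path_borel sm by simp
  show "emeasure m A \<le> (INF U \<in> {U. openin T U \<and> A \<subseteq> U}. emeasure m U)"
    by (intro INF_greatest emeasure_mono) (use os in auto)
  show "(INF U \<in> {U. openin T U \<and> A \<subseteq> U}. emeasure m U) \<le> emeasure m A"
  proof (rule ennreal_le_epsilon)
    fix \<epsilon> :: real assume \<epsilon>: "\<epsilon> > 0"
    define Y where "Y n = Z [from_nat_into (arcs G) n]" for n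
    have "\<exists>U V. openin T U \<and> openin T V \<and> A \<inter> Y n \<subseteq> U \<and> U \<subseteq> Y n \<and> Y n - A \<subseteq> V \<and> V \<subseteq> Y n \<and>
        emeasure m (U \<inter> V) \<le> ennreal (\<epsilon> * (1 / 2) ^ Suc n)" for n
      unfolding Y_def using \<epsilon> by (intro approximation_in_cylinder[OF m arc_word A]) simp
    then obtain U V where UV: "\<And>n::nat. openin T (U n)" "\<And>n. openin T (V n)" "\<And>n. A \<inter> Y n \<subseteq> U n"
      "\<And>n. U n \<subseteq> Y n" "\<And>n. Y n - A \<subseteq> V n"
      "\<And>n. emeasure m (U n \<inter> V n) \<le> ennreal (\<epsilon> * (1 / 2) ^ Suc n)"
      by metis
    have oU: "openin T (\<Union>n. U n)" using UV(1) by blast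
    have AX: "A \<subseteq> X" using A locally_finite_space[OF m] sets.sets_into_space by blast
    have AU: "A \<subseteq> (\<Union>n. U n)"
    proof
      fix x assume "x \<in> A"
      then obtain n where "x \<in> Y n" using AX X_eq_Union_nat by (auto simp: Y_def)
      then show "x \<in> (\<Union>n. U n)" using UV(3)[of n] \<open>x \<in> A\<close> by blast
    qed
    have sub: "(\<Union>n. U n) \<subseteq> A \<union> (\<Union>n. U n \<inter> V n)" using UV(4,5) by blast
    have "(INF U \<in> {U. openin T U \<and> A \<subseteq> U}. emeasure m U) \<le> emeasure m (\<Union>n. U n)"
      using oU AU by (intro INF_lower) auto
    also have "\<dots> \<le> emeasure m (A \<union> (\<Union>n. U n \<inter> V n))"
      using sub A os UV by (intro emeasure_mono) auto
    also have "\<dots> \<le> emeasure m A + emeasure m (\<Union>n. U n \<inter> V n)"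
      using A os UV by (intro emeasure_subadditive) auto
    also have "\<dots> \<le> emeasure m A + ennreal \<epsilon>"
    proof (intro add_mono order_refl)
      have "emeasure m (\<Union>i. U i \<inter> V i) \<le> (\<Sum>i. emeasure m (U i \<inter> V i))"
        using os UV by (intro emeasure_subadditive_countably) auto
      also have "\<dots> \<le> (\<Sum>i. ennreal (\<epsilon> * (1 / 2) ^ Suc i))"
        by (intro suminf_le UV) auto
      also have "\<dots> = ennreal \<epsilon>"
      proof (rule suminf_ennreal_eq)
        show "(\<lambda>i. \<epsilon> * (1 / 2) ^ Suc i) sums \<epsilon>"
          using sums_mult[OF power_half_series, of \<epsilon>] by simp
      qed (use \<epsilon> in simp)
      finally show "emeasure m (\<Union>n. U n \<inter> V n) \<le> ennreal \<epsilon>" .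
    qed
    finally show "(INF U \<in> {U. openin T U \<and> A \<subseteq> U}. emeasure m U) \<le> emeasure m A + ennreal \<epsilon>" .
  qed
qed

text \<open>An open set is a countable union of cylinders, which are compact; their finite unions
  exhaust it.\<close>

lemma locally_finite_inner_regular:
  assumes m: "locally_finite m" and U: "openin T U"
  shows "emeasure m U = (SUP K \<in> {K. compactin T K \<and> K \<subseteq> U}. emeasure m K)"
proof (rule antisym)
  have sm: "sets m = sets path_borel" using m by (simp add: locally_finite_def)
  have os: "U \<in> sets m" using U open_in_path_borel sm by simp
  show "(SUP K \<in> {K. compactin T K \<and> K \<subseteq> U}. emeasure m K) \<le> emeasure m U"
    by (intro SUP_least emeasure_mono) (use os in auto)
  let ?W = "{w \<in> FP. Z w \<subseteq> U}"
  have cW: "countable ?W" by (rule countable_subset[OF _ countable_FP]) auto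
  show "emeasure m U \<le> (SUP K \<in> {K. compactin T K \<and> K \<subseteq> U}. emeasure m K)"
  proof (cases "?W = {}")
    case True
    then have "U = {}" using openin_eq_Union[OF U] by auto
    then show ?thesis by simp
  next
    case False
    let ?w = "from_nat_into ?W"
    define K where "K n = (\<Union>i\<le>n. Z (?w i))" for n
    have w: "?w n \<in> ?W" for n using from_nat_into[OF False] .
    have KU: "(\<Union>n. K n) = U"
    proof -
      have "(\<Union>n. K n) = (\<Union>n. Z (?w n))" by (auto simp: K_def)
      also have "\<dots> = (\<Union>w\<in>range ?w. Z w)" by blast
      also have "\<dots> = U" using range_from_nat_into[OF False cW] openin_eq_Union[OF U] by simp
      finally show ?thesis .
    qed
    have "compactin T (K n)" for n
    proof -
      have K: "K n = (\<Union>w\<in>?w ` {..n}. Z w)" by (simp add: K_def)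
      show ?thesis unfolding K using w by (intro finite_union_Z_compact) auto
    qed
    moreover have "K n \<subseteq> U" for n using KU by blast
    ultimately have "emeasure m (K n) \<le> (SUP K \<in> {K. compactin T K \<and> K \<subseteq> U}. emeasure m K)" for n
      by (intro SUP_upper) auto
    moreover have "(SUP n. emeasure m (K n)) = emeasure m (\<Union>n. K n)"
    proof (rule SUP_emeasure_incseq)
      show "range K \<subseteq> sets m" by (auto simp: K_def sm)
      show "incseq K" unfolding K_def by (intro incseq_SucI UN_mono) auto
    qed
    ultimately show ?thesis unfolding KU by (metis (no_types, lifting) SUP_least)
  qed
qed

lemma locally_finite_imp_regular:
  assumes m: "locally_finite m"
  shows "regular_borel_measure G m"
  unfolding regular_borel_measure_def
proof (intro conjI allI impI ballI)
  show "space m = X" using m by (rule locally_finite_space)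
  show "sets m = sigma_sets X {U. openin T U}" using m sets_path_borel_open by (simp add: locally_finite_def)
  fix K assume K: "compactin T K"
  obtain F where F: "finite F" "F \<subseteq> FP" "K \<subseteq> (\<Union>w\<in>F. Z w)"
    using compactin_finite_cover[OF K, of "\<lambda>_. True"] by (metis zero_less_one)
  have "emeasure m K \<le> emeasure m (\<Union>w\<in>F. Z w)"
    using F m by (intro emeasure_mono) (auto simp: locally_finite_def)
  also have "\<dots> \<le> (\<Sum>w\<in>F. emeasure m (Z w))"
    using F m by (intro emeasure_subadditive_finite) (auto simp: locally_finite_def)
  also have "\<dots> < \<infinity>"
    using F m by (subst infinity_ennreal_def, subst ennreal_sum_less_top) (auto simp: locally_finite_def)
  finally show "emeasure m K < \<infinity>" .
qed (use m locally_finite_outer_regular locally_finite_inner_regular in auto)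

lemma regular_iff_locally_finite: "regular_borel_measure G m \<longleftrightarrow> locally_finite m"
  using regular_imp_locally_finite locally_finite_imp_regular by blast

end

subsection \<open>The dual of the Ruelle operator\<close>

context path_graph
begin

text \<open>An arbitrary path, serving as a junk value: \<open>dual_measure\<close> below gives weight 0 to the pairs where it is used.\<close>

definition base_path :: "nat \<Rightarrow> 'e" where
  "base_path = (SOME x. x \<in> X)"

lemma base_path: "base_path \<in> X"
proof -
  have "[from_nat_into (arcs G) 0] \<in> FP" by (rule arc_word)
  then have "\<exists>x. x \<in> X" using Z_nonempty cylinder_subset_inf_paths by blast
  then show ?thesis unfolding base_path_def by (rule someI_ex)
qed

definition prepend :: "'e \<Rightarrow> (nat \<Rightarrow> 'e) \<Rightarrow> nat \<Rightarrow> 'e" where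
  "prepend e x = (if case_nat e x \<in> X then case_nat e x else base_path)"

lemma inf_path_arc: "x \<in> X \<Longrightarrow> x i \<in> arcs G"
  by (simp add: inf_paths_def)

lemma prependable_measurable: "{x \<in> X. case_nat e x \<in> X} \<in> sets path_borel"
proof -
  have "{x \<in> X. case_nat e x \<in> X} = (\<Union>a\<in>{a \<in> arcs G. e \<in> arcs G \<and> head G e = tail G a}. Z [a])"
    using inf_path_arc[of _ 0] by (auto simp: case_nat_in_X Z_single)
  moreover have "(\<Union>a\<in>{a \<in> arcs G. e \<in> arcs G \<and> head G e = tail G a}. Z [a]) \<in> sets path_borel"
    by (rule sets.countable_UN'') (use countable_arcs in \<open>auto intro: countable_subset\<close>)
  ultimately show ?thesis by simp
qed

lemma prepend_measurable [measurable]: "prepend e \<in> path_borel \<rightarrow>\<^sub>M path_borel"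
proof -
  let ?D = "{x \<in> X. case_nat e x \<in> X}"
  have "prepend e \<in> path_borel \<rightarrow>\<^sub>M sigma X (Z ` FP)"
  proof (rule measurable_measure_of)
    show "Z ` FP \<subseteq> Pow X" using cylinder_subset_inf_paths by blast
    show "prepend e \<in> space path_borel \<rightarrow> X" using base_path by (auto simp: prepend_def)
    fix B assume "B \<in> Z ` FP"
    then obtain w where w: "w \<in> FP" "B = Z w" by blast
    then obtain a v where av: "w = a # v" using FP_not_Nil by (cases w) auto
    have "prepend e -` B \<inter> space path_borel = (if e = a then ?D \<inter> Z v else {}) \<union> (if base_path \<in> B then X - ?D else {})"
      unfolding w(2) av prepend_def by (auto simp: case_nat_in_Z split: if_splits)
    moreover have "?D \<inter> Z v \<in> sets path_borel" using prependable_measurable by auto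
    moreover have "X - ?D \<in> sets path_borel" using sets.compl_sets[OF prependable_measurable[of e]] by simp
    ultimately show "prepend e -` B \<inter> space path_borel \<in> sets path_borel"
      by (cases "e = a"; cases "base_path \<in> B") auto
  qed
  then show ?thesis by (simp add: path_borel_def)
qed

end

context path_potential
begin

lemma phi_measurable [measurable]: "\<phi> \<in> borel_measurable path_borel"
  by (rule continuous_imp_measurable[OF continuous_phi])

lemma ind_measurable [measurable]: "ind w \<in> borel_measurable path_borel"
  unfolding ind_def by measurable

lemma ruelle_eq_prepend:
  assumes "finite E" "\<forall>y\<in>X. f y \<noteq> 0 \<longrightarrow> y 0 \<in> E"
  shows "L f x = (\<Sum>e\<in>E. if case_nat e x \<in> X then exp (\<phi> (prepend e x)) * f (prepend e x) else 0)"
  unfolding ruelle_eq_sum[OF assms] by (intro sum.cong) (auto simp: prepend_def)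

lemma measurable_if_prependable:
  fixes f :: "(nat \<Rightarrow> 'e) \<Rightarrow> 'c :: {topological_space, zero}"
  assumes "f \<in> borel_measurable path_borel"
  shows "(\<lambda>x. if case_nat e x \<in> X then f (prepend e x) else 0) \<in> borel_measurable path_borel"
proof (rule measurable_If)
  show "(\<lambda>x. f (prepend e x)) \<in> borel_measurable path_borel" using assms by measurable
  show "{x \<in> space path_borel. case_nat e x \<in> X} \<in> sets path_borel" using prependable_measurable by simp
qed simp

lemma ruelle_measurable:
  assumes "fin_rooted f" and [measurable]: "f \<in> borel_measurable path_borel"
  shows "L f \<in> borel_measurable path_borel"
proof -
  obtain E where E: "finite E" "\<forall>y\<in>X. f y \<noteq> 0 \<longrightarrow> y 0 \<in> E"
    using assms by (auto simp: fin_rooted_def)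
  have "(\<lambda>y. exp (\<phi> y) * f y) \<in> borel_measurable path_borel" by measurable
  from measurable_if_prependable[OF this]
  have "(\<lambda>x. \<Sum>e\<in>E. if case_nat e x \<in> X then exp (\<phi> (prepend e x)) * f (prepend e x) else 0) \<in> borel_measurable path_borel"
    by (intro borel_measurable_sum)
  moreover have "L f = (\<lambda>x. \<Sum>e\<in>E. if case_nat e x \<in> X then exp (\<phi> (prepend e x)) * f (prepend e x) else 0)"
    using ruelle_eq_prepend[OF E] by (rule ext)
  ultimately show ?thesis by simp
qed

lemma ruelle_pow_measurable:
  assumes "fin_rooted f" "f \<in> borel_measurable path_borel"
  shows "(L ^^ n) f \<in> borel_measurable path_borel"
  by (induction n) (use assms in \<open>auto intro: ruelle_measurable fin_rooted_ruelle_pow\<close>)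

text \<open>\<open>L f x\<close> integrates \<open>f\<close>, weighted by exp(\<phi>), over the
  one-edge backward extensions of \<open>x\<close>. The dual is thus the image of a weighted product
  of counting measure on edges with \<open>m\<close> under prepending.\<close>

definition dual_measure :: "(nat \<Rightarrow> 'e) measure \<Rightarrow> (nat \<Rightarrow> 'e) measure" where
  "dual_measure m = distr
     (density (count_space (arcs G) \<Otimes>\<^sub>M m)
       (\<lambda>(e, x). if case_nat e x \<in> X then ennreal (exp (\<phi> (prepend e x))) else 0))
     path_borel (\<lambda>(e, x). prepend e x)"

lemma sets_dual_measure: "sets (dual_measure m) = sets path_borel"
  by (simp add: dual_measure_def)

text \<open>Tonelli's theorem for two \<sigma>-finite factors. Joint measurability reduces to a
  fixed edge because there are countably many edges.\<close>

lemma nn_integral_dual_measure: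
  assumes m: "locally_finite m" and [measurable]: "f \<in> borel_measurable path_borel"
  shows "(\<integral>\<^sup>+y. f y \<partial>dual_measure m) =
    (\<integral>\<^sup>+x. (\<integral>\<^sup>+e. (if case_nat e x \<in> X then ennreal (exp (\<phi> (prepend e x))) * f (prepend e x) else 0)
      \<partial>count_space (arcs G)) \<partial>m)"
proof -
  let ?N = "count_space (arcs G) \<Otimes>\<^sub>M m"
  let ?d = "\<lambda>(e, x). if case_nat e x \<in> X then ennreal (exp (\<phi> (prepend e x))) else 0"
  interpret sigma_finite_measure m by (rule locally_finite_sigma_finite[OF m])
  interpret C: sigma_finite_measure "count_space (arcs G)"
    by (rule sigma_finite_measure_count_space_countable[OF countable_arcs])
  interpret pair_sigma_finite "count_space (arcs G)" m ..
  have sm: "sets m = sets path_borel" using m by (simp add: locally_finite_def)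
  have cong: "borel_measurable m = borel_measurable path_borel" "m \<rightarrow>\<^sub>M path_borel = path_borel \<rightarrow>\<^sub>M path_borel"
    using sm by (auto intro!: measurable_cong_sets)
  have pm [measurable]: "(\<lambda>(e, x). prepend e x) \<in> ?N \<rightarrow>\<^sub>M path_borel"
    by (rule measurable_pair_measure_countable1[OF countable_arcs]) (simp add: cong)
  have dm [measurable]: "?d \<in> borel_measurable ?N"
  proof (rule measurable_pair_measure_countable1[OF countable_arcs])
    fix e
    have "(\<lambda>y. ennreal (exp (\<phi> y))) \<in> borel_measurable path_borel" by measurable
    from measurable_if_prependable[OF this, of e]
    show "(\<lambda>x. ?d (e, x)) \<in> borel_measurable m" by (simp add: cong)
  qed
  have "(\<integral>\<^sup>+y. f y \<partial>dual_measure m) = (\<integral>\<^sup>+z. f (case z of (e, x) \<Rightarrow> prepend e x) \<partial>density ?N ?d)"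
    unfolding dual_measure_def by (rule nn_integral_distr) (use pm in simp_all)
  also have "\<dots> = (\<integral>\<^sup>+z. ?d z * f (case z of (e, x) \<Rightarrow> prepend e x) \<partial>?N)"
    by (rule nn_integral_density) (use dm pm in measurable)
  also have "\<dots> = (\<integral>\<^sup>+x. \<integral>\<^sup>+e. ?d (e, x) * f (case (e, x) of (e, x) \<Rightarrow> prepend e x) \<partial>count_space (arcs G) \<partial>m)"
    by (rule nn_integral_snd[symmetric]) (use dm pm in measurable)
  also have "\<dots> = (\<integral>\<^sup>+x. (\<integral>\<^sup>+e. (if case_nat e x \<in> X then ennreal (exp (\<phi> (prepend e x))) * f (prepend e x) else 0)
      \<partial>count_space (arcs G)) \<partial>m)"
    by (intro nn_integral_cong) auto
  finally show ?thesis .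
qed

lemma nn_integral_dual_measure_real:
  assumes m: "locally_finite m" and f: "fin_rooted f" "f \<in> borel_measurable path_borel" "\<And>y. y \<in> X \<Longrightarrow> f y \<ge> 0"
  shows "(\<integral>\<^sup>+y. ennreal (f y) \<partial>dual_measure m) = (\<integral>\<^sup>+x. ennreal (L f x) \<partial>m)"
proof -
  obtain E where E: "finite E" "E \<subseteq> arcs G" "\<forall>y\<in>X. f y \<noteq> 0 \<longrightarrow> y 0 \<in> E"
    using f by (auto simp: fin_rooted_def)
  have "(\<integral>\<^sup>+e. (if case_nat e x \<in> X then ennreal (exp (\<phi> (prepend e x))) * ennreal (f (prepend e x)) else 0)
      \<partial>count_space (arcs G)) = ennreal (L f x)" for x
  proof -
    have pX: "prepend e x \<in> X" for e using base_path by (simp add: prepend_def)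
    have "(\<integral>\<^sup>+e. (if case_nat e x \<in> X then ennreal (exp (\<phi> (prepend e x))) * ennreal (f (prepend e x)) else 0)
        \<partial>count_space (arcs G))
      = (\<Sum>e\<in>E. if case_nat e x \<in> X then ennreal (exp (\<phi> (prepend e x))) * ennreal (f (prepend e x)) else 0)"
    proof (rule nn_integral_count_space'[OF E(1) _ E(2)])
      fix e assume "e \<in> arcs G" "e \<notin> E"
      then show "(if case_nat e x \<in> X then ennreal (exp (\<phi> (prepend e x))) * ennreal (f (prepend e x)) else 0) = 0"
        using E(3) by (auto simp: prepend_def)
    qed
    also have "\<dots> = (\<Sum>e\<in>E. ennreal (if case_nat e x \<in> X then exp (\<phi> (prepend e x)) * f (prepend e x) else 0))"
      using f(3) pX by (intro sum.cong) (auto simp: ennreal_mult)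
    also have "\<dots> = ennreal (L f x)"
      unfolding ruelle_eq_prepend[OF E(1,3)] using f(3) pX by (intro sum_ennreal) auto
    finally show ?thesis .
  qed
  moreover have "(\<lambda>y. ennreal (f y)) \<in> borel_measurable path_borel" using f(2) by measurable
  ultimately show ?thesis by (simp add: nn_integral_dual_measure[OF m])
qed

lemma emeasure_eq_nn_integral_ind:
  assumes "sets m = sets path_borel"
  shows "emeasure m (Z w) = (\<integral>\<^sup>+x. ennreal (ind w x) \<partial>m)"
proof -
  have "(\<integral>\<^sup>+x. ennreal (ind w x) \<partial>m) = (\<integral>\<^sup>+x. indicator (Z w) x \<partial>m)"
    by (intro nn_integral_cong) (simp add: ind_def indicator_def)
  then show ?thesis using assms by simp
qed

lemma emeasure_dual_measure:
  assumes "locally_finite m" "w \<in> FP"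
  shows "emeasure (dual_measure m) (Z w) = (\<integral>\<^sup>+x. ennreal (L (ind w) x) \<partial>m)"
  using nn_integral_dual_measure_real[OF assms(1) fin_rooted_ind[OF assms(2)]]
  by (simp add: emeasure_eq_nn_integral_ind[OF sets_dual_measure])

text \<open>On \<open>Z w\<close> the function \<open>L (ind (a # w))\<close> takes values of
  exp(\<phi>) on \<open>Z (a # w)\<close>, and elsewhere it vanishes. So it lies between
  \<open>A * ind w\<close> and \<open>B * ind w\<close>.\<close>

lemma emeasure_dual_measure_bounds:
  assumes m: "locally_finite m" and w: "w \<noteq> []" "a # w \<in> FP"
    and AB: "\<And>x. x \<in> Z (a # w) \<Longrightarrow> A \<le> exp (\<phi> x) \<and> exp (\<phi> x) \<le> B"
  shows "ennreal A * emeasure m (Z w) \<le> emeasure (dual_measure m) (Z (a # w))"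
    and "emeasure (dual_measure m) (Z (a # w)) \<le> ennreal B * emeasure m (Z w)"
proof -
  have sm: "sets m = sets path_borel" using m by (simp add: locally_finite_def)
  have *: "A * ind w x \<le> L (ind (a # w)) x \<and> L (ind (a # w)) x \<le> B * ind w x" for x
  proof (cases "x \<in> Z w")
    case True
    then have "case_nat a x \<in> Z (a # w)"
      using conc_in_Z[of "[a]" w x] w by (simp add: conc_Cons)
    then show ?thesis using AB True by (simp add: ruelle_ind_Cons[OF w] ind_eq_1)
  qed (simp add: ruelle_ind_Cons[OF w] ind_eq_0)
  have int: "(\<integral>\<^sup>+x. ennreal (c * ind w x) \<partial>m) = ennreal c * emeasure m (Z w)" for c
  proof -
    have "(\<integral>\<^sup>+x. ennreal (c * ind w x) \<partial>m) = (\<integral>\<^sup>+x. ennreal c * indicator (Z w) x \<partial>m)"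
      by (intro nn_integral_cong) (simp add: ind_def indicator_def)
    then show ?thesis using sm by (simp add: nn_integral_cmult_indicator)
  qed
  show "ennreal A * emeasure m (Z w) \<le> emeasure (dual_measure m) (Z (a # w))"
    "emeasure (dual_measure m) (Z (a # w)) \<le> ennreal B * emeasure m (Z w)"
    unfolding emeasure_dual_measure[OF m w(2)] int[symmetric]
    using * by (auto intro!: nn_integral_mono ennreal_leI)
qed

text \<open>The bound needs a non-empty word after the first edge, so one-edge cylinders are first
  split into finitely many two-edge ones.\<close>

lemma locally_finite_dual_measure:
  assumes m: "locally_finite m"
  shows "locally_finite (dual_measure m)"
proof -
  have long: "emeasure (dual_measure m) (Z (a # w)) < \<infinity>" if w: "w \<noteq> []" "a # w \<in> FP" for a w
  proof -
    obtain B where B: "\<forall>x\<in>Z (a # w). \<bar>\<phi> x\<bar> \<le> B" using phi_bounded w by blast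
    then have "emeasure (dual_measure m) (Z (a # w)) \<le> ennreal (exp B) * emeasure m (Z w)"
      using w by (intro emeasure_dual_measure_bounds[OF m, where A=0]) (auto simp: abs_le_iff)
    also have "\<dots> < \<infinity>"
      using m w by (auto simp: locally_finite_def FP_Cons ennreal_mult_less_top)
    finally show ?thesis .
  qed
  have "emeasure (dual_measure m) (Z v) < \<infinity>" if v: "v \<in> FP" for v
  proof (cases "length v = 1")
    case True
    then obtain a where a: "v = [a]" by (auto simp: length_Suc_conv)
    let ?E = "{e. v @ [e] \<in> FP}"
    have fin: "finite ?E" using finite_extensions[of v] a by simp
    have "emeasure (dual_measure m) (Z v) \<le> (\<Sum>e\<in>?E. emeasure (dual_measure m) (Z (v @ [e])))"
      unfolding Z_extend[OF v] by (intro emeasure_subadditive_finite fin) (simp add: sets_dual_measure image_subset_iff)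
    also have "\<dots> < \<infinity>"
      using long[of "[_]" a] fin by (subst infinity_ennreal_def, subst ennreal_sum_less_top) (auto simp: a)
    finally show ?thesis .
  next
    case False
    then obtain a w where "v = a # w" "w \<noteq> []"
      using FP_not_Nil[OF v] by (cases v) auto
    then show ?thesis using long v by blast
  qed
  then show ?thesis by (simp add: locally_finite_def sets_dual_measure)
qed

lemma integrable_Cc_abs:
  assumes m: "locally_finite m" and f: "f \<in> Cc G"
  shows "(\<integral>\<^sup>+x. ennreal \<bar>f x\<bar> \<partial>m) < \<infinity>"
proof -
  have sm: "sets m = sets path_borel" using m by (simp add: locally_finite_def)
  have [measurable]: "ind w \<in> borel_measurable m" for w
    using ind_measurable measurable_cong_sets[OF sm refl] by blast
  obtain F c where F: "finite F" "F \<subseteq> FP" "c \<ge> 0" "\<And>x. x \<in> X \<Longrightarrow> \<bar>f x\<bar> \<le> c * (\<Sum>w\<in>F. ind w x)"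
    using Cc_bound[OF f] by metis
  have "(\<integral>\<^sup>+x. ennreal \<bar>f x\<bar> \<partial>m) \<le> (\<integral>\<^sup>+x. (\<Sum>w\<in>F. ennreal c * ennreal (ind w x)) \<partial>m)"
  proof (rule nn_integral_mono)
    fix x assume "x \<in> space m"
    then have "x \<in> X" using locally_finite_space[OF m] by simp
    then have "ennreal \<bar>f x\<bar> \<le> ennreal (c * (\<Sum>w\<in>F. ind w x))" using F by (intro ennreal_leI) auto
    also have "\<dots> = (\<Sum>w\<in>F. ennreal c * ennreal (ind w x))"
      using F(3) by (simp add: ennreal_mult sum_nonneg sum_distrib_left flip: sum_ennreal)
    finally show "ennreal \<bar>f x\<bar> \<le> (\<Sum>w\<in>F. ennreal c * ennreal (ind w x))" .
  qed
  also have "\<dots> = (\<Sum>w\<in>F. ennreal c * emeasure m (Z w))"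
    by (simp add: nn_integral_sum nn_integral_cmult emeasure_eq_nn_integral_ind[OF sm])
  also have "\<dots> < \<infinity>"
    using F m by (subst infinity_ennreal_def, subst ennreal_sum_less_top)
      (auto simp: locally_finite_def ennreal_mult_less_top)
  finally show ?thesis .
qed

lemma dual_measure_integral_nonneg:
  assumes m: "locally_finite m" and f: "fin_rooted f" "f \<in> borel_measurable path_borel" "\<And>y. f y \<ge> 0"
    and fin: "(\<integral>\<^sup>+y. ennreal (f y) \<partial>dual_measure m) < \<infinity>"
  shows "integrable (dual_measure m) f" "integrable m (L f)"
    "(\<integral>y. f y \<partial>dual_measure m) = (\<integral>x. L f x \<partial>m)"
proof -
  have sm: "sets m = sets path_borel" using m by (simp add: locally_finite_def)
  have fm: "f \<in> borel_measurable (dual_measure m)"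
    using f(2) measurable_cong_sets[OF sets_dual_measure refl] by blast
  have Lm: "L f \<in> borel_measurable m"
    using ruelle_measurable[OF f(1,2)] measurable_cong_sets[OF sm refl] by blast
  have L0: "L f x \<ge> 0" for x using f(3) by (rule ruelle_nonneg)
  note eq = nn_integral_dual_measure_real[OF m f]
  show "integrable (dual_measure m) f" using fm f(3) fin by (intro integrableI_nonneg) auto
  show "integrable m (L f)" using Lm L0 fin unfolding eq by (intro integrableI_nonneg) auto
  show "(\<integral>y. f y \<partial>dual_measure m) = (\<integral>x. L f x \<partial>m)"
    using fm f(3) Lm L0 eq by (simp add: integral_eq_nn_integral)
qed

lemma dual_measure_integral:
  assumes m: "locally_finite m" and f: "f \<in> Cc G"
  shows "(\<integral>y. f y \<partial>dual_measure m) = (\<integral>x. L f x \<partial>m)"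
proof -
  let ?p = "\<lambda>x. max (f x) 0" and ?q = "\<lambda>x. max (- f x) 0"
  have fm [measurable]: "f \<in> borel_measurable path_borel"
    using f continuous_imp_measurable by (simp add: Cc_def)
  have FSf: "fin_rooted ?p" "fin_rooted ?q" using fin_rooted_Cc[OF f] unfolding fin_rooted_def by (metis max.idem neg_0_equal_iff_equal)+
  have fin: "(\<integral>\<^sup>+y. ennreal (?p y) \<partial>dual_measure m) < \<infinity>" "(\<integral>\<^sup>+y. ennreal (?q y) \<partial>dual_measure m) < \<infinity>"
    by (rule order.strict_trans1[OF _ integrable_Cc_abs[OF locally_finite_dual_measure[OF m] f]],
        intro nn_integral_mono ennreal_leI, simp)+
  have pm: "?p \<in> borel_measurable path_borel" "?q \<in> borel_measurable path_borel" by measurable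
  note P = dual_measure_integral_nonneg[OF m FSf(1) pm(1) _ fin(1)]
  note Q = dual_measure_integral_nonneg[OF m FSf(2) pm(2) _ fin(2)]
  have pq: "f = (\<lambda>x. ?p x - ?q x)" by (auto simp: max_def)
  have "L f x = L ?p x - L ?q x" for x
  proof -
    \<comment> \<open>The difference is written as a sum over the two truth values with coefficients
      1 and -1, the shape that \<open>ruelle_sum\<close> accepts.\<close>
    have "L (\<lambda>x. \<Sum>b\<in>UNIV. (if b then 1 else -1) * (if b then ?p else ?q) x) x =
        (\<Sum>b\<in>UNIV. (if b then 1 else -1) * L (if b then ?p else ?q) x)"
      using FSf by (intro ruelle_sum) auto
    moreover have "(\<lambda>x. \<Sum>b\<in>UNIV. (if b then 1 else -1) * (if b then ?p else ?q) x) = f"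
      by (rule ext) (simp add: UNIV_bool max_def)
    ultimately show ?thesis by (simp add: UNIV_bool)
  qed
  then have "(\<integral>x. L f x \<partial>m) = (\<integral>x. L ?p x - L ?q x \<partial>m)" by simp
  also have "\<dots> = (\<integral>x. L ?p x \<partial>m) - (\<integral>x. L ?q x \<partial>m)"
    using P(2) Q(2) by (intro Bochner_Integration.integral_diff) auto
  also have "\<dots> = (\<integral>y. ?p y \<partial>dual_measure m) - (\<integral>y. ?q y \<partial>dual_measure m)"
    using P(3) Q(3) by simp
  also have "\<dots> = (\<integral>y. ?p y - ?q y \<partial>dual_measure m)"
    using P(1) Q(1) by (intro Bochner_Integration.integral_diff[symmetric]) auto
  also have "\<dots> = (\<integral>y. f y \<partial>dual_measure m)" by (subst (2) pq) simp
  finally show ?thesis by simp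
qed

text \<open>Evaluates the definite description. Uniqueness already follows from the test functions
  \<open>ind w\<close>, since a locally finite measure is determined by its values on
  cylinders.\<close>

lemma ruelle_dual_eq:
  assumes m: "locally_finite m"
  shows "ruelle_dual G \<phi> m = dual_measure m"
  unfolding ruelle_dual_def regular_iff_locally_finite
proof (rule the_equality)
  show "locally_finite (dual_measure m) \<and> (\<forall>f\<in>Cc G. (\<integral>x. f x \<partial>dual_measure m) = (\<integral>x. L f x \<partial>m))"
    using locally_finite_dual_measure[OF m] dual_measure_integral[OF m] by blast
  fix m' assume m': "locally_finite m' \<and> (\<forall>f\<in>Cc G. (\<integral>x. f x \<partial>m') = (\<integral>x. L f x \<partial>m))"
  show "m' = dual_measure m"
  proof (rule locally_finite_eqI)
    fix w assume w: "w \<in> FP"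
    have *: "emeasure \<mu> (Z w) = ennreal (\<integral>x. ind w x \<partial>\<mu>)" if "locally_finite \<mu>" for \<mu>
    proof -
      have "emeasure \<mu> (Z w) < \<infinity>" "Z w \<inter> space \<mu> = Z w"
        using that w locally_finite_space[OF that] cylinder_subset_inf_paths
        by (auto simp: locally_finite_def)
      then show ?thesis by (simp add: ind_def emeasure_eq_ennreal_measure)
    qed
    show "emeasure m' (Z w) = emeasure (dual_measure m) (Z w)"
      using m' *[of m'] *[OF locally_finite_dual_measure[OF m]] dual_measure_integral[OF m ind_in_Cc[OF w]]
        ind_in_Cc[OF w] by simp
  qed (use m' locally_finite_dual_measure[OF m] in auto)
qed

section \<open>An eigenmeasure bounds the pressure\<close>

lemma eigenmeasure_iterate:
  assumes m: "locally_finite m" and eig: "dual_measure m = scale_measure (ennreal (exp t)) m" and w: "w \<in> FP"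
  shows "(\<integral>\<^sup>+x. ennreal ((L ^^ n) (ind w) x) \<partial>m) = ennreal (exp t) ^ n * emeasure m (Z w)"
proof (induction n)
  case 0
  have "sets m = sets path_borel" using m by (simp add: locally_finite_def)
  then show ?case by (simp add: emeasure_eq_nn_integral_ind)
next
  case (Suc n)
  let ?f = "(L ^^ n) (ind w)"
  have f: "fin_rooted ?f" "?f \<in> borel_measurable path_borel" "\<And>y. y \<in> X \<Longrightarrow> ?f y \<ge> 0"
    using fin_rooted_ruelle_pow[OF fin_rooted_ind[OF w]] ruelle_pow_measurable[OF fin_rooted_ind[OF w] ind_measurable]
    by (auto intro: ruelle_pow_nonneg)
  have sm: "sets m = sets path_borel" using m by (simp add: locally_finite_def)
  have "(\<lambda>x. ennreal (?f x)) \<in> borel_measurable m"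
    using f(2) measurable_cong_sets[OF sm refl] by (metis measurable_compose measurable_ennreal)
  then have "(\<integral>\<^sup>+x. ennreal (?f x) \<partial>dual_measure m) = ennreal (exp t) * (\<integral>\<^sup>+x. ennreal (?f x) \<partial>m)"
    unfolding eig by (rule nn_integral_scale_measure)
  then show ?case
    using nn_integral_dual_measure_real[OF m f] Suc by (simp add: mult.assoc)
qed

lemma positive_cylinder:
  assumes m: "locally_finite m" and pos: "emeasure m X \<noteq> 0"
  shows "\<exists>x\<in>X. emeasure m (Z (pre x k)) \<noteq> 0"
proof (rule ccontr)
  assume "\<not> ?thesis"
  \<comment> \<open>Length \<open>Suc k\<close> keeps the words non-empty when \<open>k = 0\<close>,
    so that they belong to the countable set \<open>FP\<close>.\<close>
  then have 0: "emeasure m (Z (pre x (Suc k))) = 0" if "x \<in> X" for x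
    using that Z_pre_mono[of k "Suc k" x] emeasure_mono[of "Z (pre x (Suc k))" "Z (pre x k)" m] m
    by (auto simp: locally_finite_def)
  let ?W = "(\<lambda>x. pre x (Suc k)) ` X"
  have "X = (\<Union>w\<in>?W. Z w)" using in_Z_pre cylinder_subset_inf_paths by fast
  moreover have "?W \<subseteq> FP" using pre_in_FP by auto
  then have "countable ?W" using countable_FP countable_subset by blast
  then have "(\<Union>w\<in>?W. Z w) \<in> null_sets m"
    using 0 m by (intro null_sets_UN') (auto simp: locally_finite_def)
  ultimately show False using pos by (metis null_setsD1)
qed

text \<open>On a cylinder of positive mass \<open>p\<close> around \<open>x\<close>, the iterate is
  at least its value at \<open>x\<close> divided by exp(n \<epsilon>), while its total integral is
  exp(n t) times the mass of \<open>Z w\<close>. Dividing by \<open>p\<close> bounds the value at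
  \<open>x\<close>.\<close>

lemma eigenmeasure_imp_pressure_le:
  assumes m: "locally_finite m" and eig: "dual_measure m = scale_measure (ennreal (exp t)) m"
    and pos: "emeasure m X \<noteq> 0"
  shows "pressure G \<phi> \<le> ereal t"
proof -
  obtain x0 where x0: "x0 \<in> X" using base_path by blast
  define w where "w = pre x0 1"
  have w: "w \<in> FP" using pre_in_FP[OF x0] by (simp add: w_def)
  have sm: "sets m = sets path_borel" using m by (simp add: locally_finite_def)
  have "exp_bounded (\<lambda>n. (L ^^ n) (ind w) x0) s" if s: "s > exp t" for s
  proof -
    obtain q where q: "exp t < q" "q < s" using dense s by blast
    have q0: "q > 0" using q(1) exp_gt_zero[of t] by linarith
    \<comment> \<open>Chosen so that eigenvalue and distortion together give the rate
      \<open>q\<close>.\<close>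
    define \<epsilon> where "\<epsilon> = ln q - t"
    have "t < ln q" using q(1) q0 by (metis exp_less_cancel_iff exp_ln)
    then have \<epsilon>: "\<epsilon> > 0" "exp t * exp \<epsilon> = q" using q0 by (auto simp: \<epsilon>_def simp flip: exp_add)
    obtain k0 where k0: "\<forall>x\<in>X. \<forall>y\<in>X. (\<forall>i<k0. x i = y i) \<longrightarrow> \<bar>\<phi> x - \<phi> y\<bar> \<le> \<epsilon>"
      using osc[OF \<epsilon>(1)] by blast
    define k where "k = max k0 1"
    have k: "\<forall>x\<in>X. \<forall>y\<in>X. (\<forall>i<k. x i = y i) \<longrightarrow> \<bar>\<phi> x - \<phi> y\<bar> \<le> \<epsilon>"
      using k0 by (simp add: k_def)
    have len: "length w \<le> k" "k > 0" by (auto simp: k_def w_def)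
    obtain x where x: "x \<in> X" "emeasure m (Z (pre x k)) \<noteq> 0" using positive_cylinder[OF m pos] by blast
    have fin: "emeasure m (Z (pre x k)) < \<infinity>" "emeasure m (Z w) < \<infinity>"
      using m w pre_in_FP[OF x(1) len(2)] by (auto simp: locally_finite_def)
    define p where "p = measure m (Z (pre x k))"
    define M where "M = measure m (Z w)"
    have p: "emeasure m (Z (pre x k)) = ennreal p" "p > 0"
      using fin x(2) by (auto simp: p_def emeasure_eq_ennreal_measure zero_less_measure_iff)
    have M: "emeasure m (Z w) = ennreal M" "M \<ge> 0" using fin by (auto simp: M_def emeasure_eq_ennreal_measure)
    have "(L ^^ n) (ind w) x \<le> M / p * q ^ n" for n
    proof -
      let ?g = "(L ^^ n) (ind w)"
      have "ennreal (?g x) * ennreal p = (\<integral>\<^sup>+y. ennreal (?g x) * indicator (Z (pre x k)) y \<partial>m)"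
        using sm p by (simp add: nn_integral_cmult_indicator)
      also have "\<dots> \<le> (\<integral>\<^sup>+y. ennreal (exp (real n * \<epsilon>)) * ennreal (?g y) \<partial>m)"
      proof (rule nn_integral_mono)
        fix y
        show "ennreal (?g x) * indicator (Z (pre x k)) y \<le> ennreal (exp (real n * \<epsilon>)) * ennreal (?g y)"
        proof (cases "y \<in> Z (pre x k)")
          case True
          then have "y \<in> X" "\<forall>i<k. x i = y i" by (auto simp: in_cylinder_pre)
          then have "?g x \<le> exp (real n * \<epsilon>) * ?g y" "?g y \<ge> 0"
            using ruelle_pow_distortion[OF w len k x(1)] by (auto intro: ruelle_pow_nonneg)
          then show ?thesis using True by (simp add: ennreal_leI flip: ennreal_mult)
        qed simp
      qed
      also have "\<dots> = ennreal (exp (real n * \<epsilon>)) * (\<integral>\<^sup>+y. ennreal (?g y) \<partial>m)"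
      proof (rule nn_integral_cmult)
        have "?g \<in> borel_measurable path_borel" by (rule ruelle_pow_measurable[OF fin_rooted_ind[OF w] ind_measurable])
        then show "(\<lambda>y. ennreal (?g y)) \<in> borel_measurable m"
          using measurable_cong_sets[OF sm refl] by (metis measurable_compose measurable_ennreal)
      qed
      also have "\<dots> = ennreal (exp (real n * \<epsilon>)) * (ennreal (exp t) ^ n * ennreal M)"
        unfolding eigenmeasure_iterate[OF m eig w] M ..
      also have "\<dots> = ennreal (q ^ n * M)"
      proof -
        have "exp (real n * \<epsilon>) * exp t ^ n = q ^ n"
          by (simp add: exp_of_nat_mult \<epsilon>(2)[symmetric] power_mult_distrib)
        then show ?thesis using M(2) by (simp add: ennreal_power mult.assoc[symmetric] flip: ennreal_mult)
      qed
      finally have "ennreal (?g x * p) \<le> ennreal (q ^ n * M)"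
        using p by (simp add: ennreal_mult'')
      then have "?g x * p \<le> q ^ n * M" using M(2) q0 by (simp add: ennreal_le_iff)
      then show ?thesis using p by (simp add: field_simps)
    qed
    then have "exp_bounded (\<lambda>n. (L ^^ n) (ind w) x) q" unfolding exp_bounded_def by blast
    \<comment> \<open>The path \<open>x\<close> depends on \<epsilon> through the depth
      \<open>k\<close>. The bound is therefore moved to the fixed \<open>x0\<close>, the rate rising
      from \<open>q\<close> to \<open>s\<close>.\<close>
    then show ?thesis by (rule exp_bounded_points[OF x(1) x0 w q0 q(2)])
  qed
  then show ?thesis using pressure_le_iff[OF w x0] by blast
qed

end

subsection \<open>Measures from additive functions on words\<close>

context path_graph
begin

lemma prefix_imp_cylinder_subset: "prefix u v \<Longrightarrow> Z v \<subseteq> Z u"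
  by (auto simp: prefix_def cylinder_append[THEN subsetD])

lemma not_prefix_cylinder_disjoint:
  assumes "\<not> prefix u v" "\<not> prefix v u"
  shows "Z u \<inter> Z v = {}"
proof (cases "length u \<le> length v")
  case True
  then show ?thesis using assms(1) cylinder_disjoint[of u v G] by (metis take_is_prefix)
next
  case False
  then show ?thesis using assms(2) cylinder_disjoint[of v u G] by (metis Int_commute nat_le_linear take_is_prefix)
qed

lemma prefix_pre: "p \<in> Z u \<Longrightarrow> length u \<le> n \<Longrightarrow> prefix u (pre p n)"
  by (metis pre_length_cylinder take_is_prefix pre_def take_map take_upt add_0 length_map min_absorb2)

text \<open>The difference axiom of a semiring of sets. A cylinder of a word at least as long as
  \<open>v\<close> is contained in \<open>Z v\<close> or disjoint from it; shorter words collect the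
  covers of their finitely many extensions.\<close>

lemma cylinder_diff_cover:
  assumes "u \<in> FP"
  shows "\<exists>C\<subseteq>Z ` FP. finite C \<and> disjoint C \<and> Z u - Z v = \<Union>C"
  using assms
proof (induction rule: cylinder_induct)
  case (extend u)
  let ?E = "{e. u @ [e] \<in> FP}"
  have "\<forall>e\<in>?E. \<exists>C\<subseteq>Z ` FP. finite C \<and> disjoint C \<and> Z (u @ [e]) - Z v = \<Union>C"
    using extend.IH by blast
  then obtain C where C: "\<And>e. e \<in> ?E \<Longrightarrow> C e \<subseteq> Z ` FP \<and> finite (C e) \<and> disjoint (C e) \<and> Z (u @ [e]) - Z v = \<Union>(C e)"
    by metis
  show ?case
  proof (intro exI conjI)
    show "(\<Union>e\<in>?E. C e) \<subseteq> Z ` FP" using C by blast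
    show "finite (\<Union>e\<in>?E. C e)" using C finite_extensions[OF FP_not_Nil[OF extend.hyps]] by blast
    show "disjoint (\<Union>e\<in>?E. C e)"
    proof (rule disjointI)
      fix a b assume a: "a \<in> (\<Union>e\<in>?E. C e)" and b: "b \<in> (\<Union>e\<in>?E. C e)" and ab: "a \<noteq> b"
      then obtain e e' where e: "e \<in> ?E" "a \<in> C e" "e' \<in> ?E" "b \<in> C e'" by blast
      show "a \<inter> b = {}"
      proof (cases "e = e'")
        case True
        then show ?thesis using C e ab by (auto dest: disjointD)
      next
        case False
        have "a \<subseteq> Z (u @ [e])" "b \<subseteq> Z (u @ [e'])" using C e by blast+
        then show ?thesis using cylinder_disjoint_snoc[OF False, of G u] by blast
      qed
    qed
    have "Z u - Z v = (\<Union>e\<in>?E. Z (u @ [e]) - Z v)" unfolding Z_extend[OF extend.hyps] by blast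
    also have "\<dots> = (\<Union>e\<in>?E. \<Union>(C e))" using C by (intro SUP_cong) auto
    finally show "Z u - Z v = \<Union>(\<Union>e\<in>?E. C e)" by blast
  qed
next
  case (path p)
  have p: "p \<in> X" using path cylinder_subset_inf_paths by blast
  have "\<exists>C\<subseteq>Z ` FP. finite C \<and> disjoint C \<and> Z (pre p n) - Z v = \<Union>C" if n: "n \<ge> length v" "n > 0" for n
  proof -
    consider "Z (pre p n) \<subseteq> Z v" | "Z v \<inter> Z (pre p n) = {}"
      using cylinder_cases[of v "pre p n" G] n by auto
    then show ?thesis
    proof cases
      case 1
      then show ?thesis by (intro exI[of _ "{}"]) (auto simp: disjoint_def)
    next
      case 2
      then show ?thesis using pre_in_FP[OF p n(2)] by (intro exI[of _ "{Z (pre p n)}"]) auto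
    qed
  qed
  then show ?case by blast
qed

text \<open>
  Countable additivity on cylinders is obtained by bar induction on the words refining a given one,
  with \<open>inter_weight a v\<close> in the role of the mass of the intersection of the cylinders of \<open>a\<close> and \<open>v\<close>.
\<close>

context
  fixes H :: "'e list \<Rightarrow> ennreal"
  assumes additive: "\<And>w. w \<in> FP \<Longrightarrow> H w = (\<Sum>e\<in>{e. w @ [e] \<in> FP}. H (w @ [e]))"
begin

definition inter_weight :: "'e list \<Rightarrow> 'e list \<Rightarrow> ennreal" where
  "inter_weight a v = (if a = [] then 0 else if prefix a v then H v else if prefix v a then H a else 0)"

lemma inter_weight_extend:
  assumes v: "v \<in> FP" and a: "a = [] \<or> a \<in> FP"
  shows "inter_weight a v = (\<Sum>e\<in>{e. v @ [e] \<in> FP}. inter_weight a (v @ [e]))"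
proof -
  let ?E = "{e. v @ [e] \<in> FP}"
  have fin: "finite ?E" using finite_extensions[OF FP_not_Nil[OF v]] .
  consider "a = []" | "a \<in> FP" "prefix a v" | "a \<in> FP" "\<not> prefix a v" "prefix v a"
    | "a \<in> FP" "\<not> prefix a v" "\<not> prefix v a" using a by blast
  then show ?thesis
  proof cases
    case 1
    then show ?thesis by (simp add: inter_weight_def)
  next
    case 2
    then have "inter_weight a (v @ [e]) = H (v @ [e])" for e
      by (auto simp: inter_weight_def prefix_snoc)
    then show ?thesis using 2 additive[OF v] by (auto simp: inter_weight_def)
  next
    case 3
    then obtain r where "a = v @ r" "r \<noteq> []" by (auto simp: prefix_def)
    then obtain e0 r' where av: "a = (v @ [e0]) @ r'" by (cases r) auto
    then have e0: "e0 \<in> ?E" using 3(1) FP_append[of "v @ [e0]" r'] by (cases "r' = []") auto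
    \<comment> \<open>Here \<open>a\<close> properly extends \<open>v\<close>, so exactly one child
      of \<open>v\<close> lies on the way to \<open>a\<close> and it carries all the weight.\<close>
    have "inter_weight a (v @ [e]) = (if e = e0 then H a else 0)" for e
    proof (cases "e = e0")
      case True
      have "prefix (v @ [e]) a" using av True by (auto simp: prefix_def)
      moreover have "a = v @ [e]" if "prefix a (v @ [e])" using that 3 by (auto simp: prefix_snoc)
      ultimately show ?thesis using True 3(1) by (auto simp: inter_weight_def)
    next
      case False
      then have "\<not> prefix (v @ [e]) a" "a \<noteq> v @ [e]" using av by (auto simp: prefix_def)
      then show ?thesis using False 3(2) by (auto simp: inter_weight_def prefix_snoc)
    qed
    then have "(\<Sum>e\<in>?E. inter_weight a (v @ [e])) = H a" using fin e0 by simp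
    then show ?thesis using 3 by (auto simp: inter_weight_def)
  next
    case 4
    have "inter_weight a (v @ [e]) = 0" for e
    proof -
      have "a \<noteq> v @ [e]" using 4(3) by auto
      then have "\<not> prefix a (v @ [e])" using 4(2) by simp
      moreover have "\<not> prefix (v @ [e]) a" using 4 append_prefixD by blast
      ultimately show ?thesis by (simp add: inter_weight_def)
    qed
    then show ?thesis using 4 by (auto simp: inter_weight_def)
  qed
qed

text \<open>Different words may have the same cylinder, so the weight must be shown to depend on the
  cylinder only. If passing from \<open>v\<close> to its extension \<open>u\<close> loses no path,
  there is no branching in between: a sibling edge would continue to a path outside
  \<open>Z u\<close>. Each additivity sum then has one term.\<close>

lemma weight_eq_of_prefix:
  assumes "prefix u v" "u \<in> FP" "v \<in> FP" "Z u \<subseteq> Z v"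
  shows "H u = H v"
  using assms
proof (induction v rule: rev_induct)
  case (snoc e v)
  show ?case
  proof (cases "u = v @ [e]")
    case False
    then have uv: "prefix u v" using snoc.prems by (auto simp: prefix_snoc)
    then have v: "v \<noteq> []" using snoc.prems(2) by auto
    then have vFP: "v \<in> FP" using snoc.prems(3) by (simp add: FP_snoc)
    have "Z u \<subseteq> Z v" using snoc.prems(4) cylinder_append[of G v "[e]"] by blast
    then have "H u = H v" using snoc.IH uv snoc.prems(2) vFP by blast
    moreover have "{e'. v @ [e'] \<in> FP} = {e}"
    proof -
      have "e' = e" if e': "v @ [e'] \<in> FP" for e'
      proof (rule ccontr)
        assume ne: "e' \<noteq> e"
        obtain x where x: "x \<in> Z (v @ [e'])" using Z_nonempty[OF e'] by blast
        then have "x \<in> Z v" using cylinder_append by blast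
        then have "x \<in> Z u" using prefix_imp_cylinder_subset[OF uv] by blast
        then have "x \<in> Z (v @ [e])" using snoc.prems(4) by blast
        then show False using x cylinder_disjoint_snoc[OF ne, of G v] by blast
      qed
      then show ?thesis using snoc.prems(3) by blast
    qed
    ultimately show ?thesis using additive[OF vFP] by simp
  qed simp
qed auto

lemma weight_eq_of_cylinder_eq:
  assumes "u \<in> FP" "v \<in> FP" "Z u = Z v"
  shows "H u = H v"
proof -
  have "Z u \<inter> Z v \<noteq> {}" using Z_nonempty[OF assms(1)] assms(3) by simp
  then have "prefix u v \<or> prefix v u" using not_prefix_cylinder_disjoint[of u v] by blast
  then show ?thesis using weight_eq_of_prefix[of u v] weight_eq_of_prefix[of v u] assms by auto
qed

text \<open>The empty word is reused as a code for the empty set, not for the whole space, so that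
  words index a semiring of sets.\<close>

definition cyl :: "'e list \<Rightarrow> (nat \<Rightarrow> 'e) set" where
  "cyl w = (if w = [] then {} else Z w)"

definition weight :: "'e list \<Rightarrow> ennreal" where
  "weight w = (if w = [] then 0 else H w)"

lemma suminf_inter_weight:
  assumes A: "\<And>n::nat. A n \<in> insert [] FP" and disj: "disjoint_family (\<lambda>n. cyl (A n))"
    and w: "w \<in> FP" and cover: "Z w \<subseteq> (\<Union>n. cyl (A n))"
  shows "(\<Sum>n. inter_weight (A n) w) = H w"
  using w
proof (induction rule: cylinder_induct)
  case (extend v)
  let ?E = "{e. v @ [e] \<in> FP}"
  have "(\<Sum>n. inter_weight (A n) v) = (\<Sum>n. \<Sum>e\<in>?E. inter_weight (A n) (v @ [e]))"
    using inter_weight_extend[OF extend.hyps] A by (intro arg_cong[where f=suminf] ext) auto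
  also have "\<dots> = (\<Sum>e\<in>?E. \<Sum>n. inter_weight (A n) (v @ [e]))"
    by (rule suminf_sum) simp
  also have "\<dots> = (\<Sum>e\<in>?E. H (v @ [e]))"
    using extend.IH by (intro sum.cong) auto
  also have "\<dots> = H v" using additive[OF extend.hyps] by simp
  finally show ?case .
next
  case (path p)
  then obtain i where i: "p \<in> cyl (A i)" using cover by blast
  then have Ai: "A i \<noteq> []" "p \<in> Z (A i)" by (auto simp: cyl_def split: if_splits)
  have "(\<Sum>n. inter_weight (A n) (pre p k)) = H (pre p k)" if k: "k \<ge> length (A i)" for k
  proof -
    have Aip: "prefix (A i) (pre p k)" using prefix_pre[OF Ai(2) k] .
    \<comment> \<open>A prefix of \<open>p\<close> reaching past \<open>A i\<close> lies in that
      cylinder and, by disjointness, meets no other. The series has a single non-zero term.\<close>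
    have "inter_weight (A n) (pre p k) = (if n = i then H (pre p k) else 0)" for n
    proof (cases "n = i")
      case True
      then show ?thesis using Aip Ai by (simp add: inter_weight_def)
    next
      case False
      show ?thesis
      proof (cases "A n = []")
        case An: False
        have "cyl (A n) \<inter> cyl (A i) = {}" using disj False by (auto simp: disjoint_family_on_def)
        then have dj: "Z (A n) \<inter> Z (A i) = {}" using An Ai by (simp add: cyl_def)
        have "p \<in> Z (pre p k)" using in_Z_pre Ai(2) cylinder_subset_inf_paths by blast
        then have "\<not> prefix (A n) (pre p k)" using prefix_imp_cylinder_subset dj Ai(2) by blast
        moreover have "\<not> prefix (pre p k) (A n)"
        proof
          assume "prefix (pre p k) (A n)"
          then have "Z (A n) \<subseteq> Z (A i)"
            using prefix_imp_cylinder_subset[OF Aip] prefix_imp_cylinder_subset by blast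
          moreover have "Z (A n) \<noteq> {}" using A[of n] An Z_nonempty by blast
          ultimately show False using dj by blast
        qed
        ultimately show ?thesis using False by (simp add: inter_weight_def)
      qed (use False in \<open>simp add: inter_weight_def\<close>)
    qed
    moreover have "(\<Sum>n. if n = i then H (pre p k) else 0) = H (pre p k)"
      using sums_single[of i "\<lambda>_. H (pre p k)"] by (simp add: sums_iff)
    ultimately show ?thesis by simp
  qed
  then show ?case by blast
qed

lemma cylinder_semiring: "semiring_of_sets X (cyl ` insert [] FP)"
proof
  have img: "cyl ` insert [] FP = insert {} (Z ` FP)"
    using FP_not_Nil by (auto simp: cyl_def image_iff)
  show "cyl ` insert [] FP \<subseteq> Pow X" unfolding img using cylinder_subset_inf_paths by auto
  show "{} \<in> cyl ` insert [] FP" unfolding img by simp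
  fix a b assume ab: "a \<in> cyl ` insert [] FP" "b \<in> cyl ` insert [] FP"
  then show "a \<inter> b \<in> cyl ` insert [] FP"
    unfolding img using Int_stable_cylinders by (auto simp: Int_stable_def)
  show "\<exists>C\<subseteq>cyl ` insert [] FP. finite C \<and> disjoint C \<and> a - b = \<Union>C"
  proof (cases "a = {} \<or> b = {}")
    case True
    show ?thesis
    proof (cases "a = {}")
      case True
      then show ?thesis by (intro exI[of _ "{}"]) (simp add: disjoint_def)
    next
      case False
      with True have "a - b = a" by simp
      then show ?thesis using ab(1) by (intro exI[of _ "{a}"]) (simp add: disjoint_def)
    qed
  next
    case False
    then obtain u v where uv: "u \<in> FP" "a = Z u" "b = Z v" using ab unfolding img by blast
    from cylinder_diff_cover[OF uv(1), of v] obtain C where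
      "C \<subseteq> Z ` FP" "finite C" "disjoint C" "Z u - Z v = \<Union>C" by (elim exE conjE)
    then show ?thesis unfolding img uv(2,3) by (intro exI[of _ C]) auto
  qed
qed

lemma cylinder_measure_exists_aux:
  assumes finite: "\<And>w. w \<in> FP \<Longrightarrow> H w < \<infinity>"
  shows "\<exists>m. locally_finite m \<and> (\<forall>w\<in>FP. emeasure m (Z w) = H w)"
proof -
  define m where "m = extend_measure X (insert [] FP) cyl weight"
  have img: "cyl ` insert [] FP = insert {} (Z ` FP)"
    using FP_not_Nil by (auto simp: cyl_def image_iff)
  have "emeasure m (cyl w) = weight w" if "w \<in> insert [] FP" for w
  proof (rule extend_measure_caratheodory[OF m_def that cylinder_semiring])
    show "weight i = 0" if "i \<in> insert [] FP" "cyl i = {}" for i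
      using that Z_nonempty by (auto simp: cyl_def weight_def split: if_splits)
    show "weight i = weight j" if "i \<in> insert [] FP" "j \<in> insert [] FP" "cyl i = cyl j" for i j
    proof (cases "i = [] \<or> j = []")
      case True
      then have "i = [] \<and> j = []" using that Z_nonempty[of i] Z_nonempty[of j] by (auto simp: cyl_def split: if_splits)
      then show ?thesis by simp
    next
      case False
      then show ?thesis using that weight_eq_of_cylinder_eq[of i j] by (simp add: cyl_def weight_def)
    qed
    show "(\<Sum>n. weight (A n)) = weight j"
      if A: "A \<in> UNIV \<rightarrow> insert [] FP" and j: "j \<in> insert [] FP"
        and disj: "disjoint_family (cyl \<circ> A)" and cover: "(\<Union>i. cyl (A i)) = cyl j" for A :: "nat \<Rightarrow> 'e list" and j
    proof (cases "j = []")
      case True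
      then have "cyl (A i) = {}" for i using cover by (auto simp: cyl_def)
      moreover have "A i \<in> insert [] FP" for i using A by auto
      ultimately have "A i = []" for i using Z_nonempty by (metis cyl_def insertE)
      then show ?thesis using True by (simp add: weight_def)
    next
      case False
      then have jFP: "j \<in> FP" and Zj: "cyl j = Z j" using j by (auto simp: cyl_def)
      have A': "A n \<in> insert [] FP" for n using A by auto
      have "(\<Sum>n. inter_weight (A n) j) = H j"
        using disj cover Zj by (intro suminf_inter_weight[OF A' _ jFP]) (auto simp: o_def)
      \<comment> \<open>Each set of the partition is contained in \<open>Z j\<close>, so
        intersecting with it changes nothing. If \<open>A n\<close> is a prefix of \<open>j\<close>,
        the two cylinders coincide and so do their weights.\<close>
      moreover have "inter_weight (A n) j = weight (A n)" for n
      proof (cases "A n = []")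
        case An: False
        then have AFP: "A n \<in> FP" using A'[of n] by blast
        have sub: "Z (A n) \<subseteq> Z j" using cover Zj An by (auto simp: cyl_def split: if_splits)
        have ne: "Z (A n) \<noteq> {}" using Z_nonempty[OF AFP] .
        consider "prefix (A n) j" | "\<not> prefix (A n) j" "prefix j (A n)"
          using not_prefix_cylinder_disjoint[of "A n" j] sub ne by blast
        then show ?thesis
        proof cases
          case 1
          then have "Z j = Z (A n)" using sub prefix_imp_cylinder_subset by blast
          then show ?thesis using 1 An weight_eq_of_cylinder_eq[OF jFP AFP]
            by (simp add: inter_weight_def weight_def)
        qed (use An in \<open>simp add: inter_weight_def weight_def\<close>)
      qed (simp add: inter_weight_def weight_def)
      ultimately show ?thesis using False by (simp add: weight_def)
    qed
  qed simp
  then have em: "emeasure m (Z w) = H w" if "w \<in> FP" for w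
    using that FP_not_Nil[OF that] by (metis cyl_def insertI2 weight_def)
  have "sets m = sigma_sets X (insert {} (Z ` FP))"
    unfolding m_def img[symmetric] by (rule sets_extend_measure) (use cylinder_subset_inf_paths img in auto)
  also have "\<dots> = sets path_borel"
    unfolding sets_path_borel by (rule sigma_sets_eqI) (auto intro: sigma_sets.Empty)
  finally show ?thesis using em finite by (auto simp: locally_finite_def)
qed

end

lemma cylinder_measure_exists:
  fixes h :: "'e list \<Rightarrow> real"
  assumes nonneg: "\<And>w. w \<in> FP \<Longrightarrow> h w \<ge> 0"
    and add: "\<And>w. w \<in> FP \<Longrightarrow> h w = (\<Sum>e\<in>{e. w @ [e] \<in> FP}. h (w @ [e]))"
  obtains m where "locally_finite m" "\<And>w. w \<in> FP \<Longrightarrow> emeasure m (Z w) = ennreal (h w)"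
proof -
  have "ennreal (h w) = (\<Sum>e\<in>{e. w @ [e] \<in> FP}. ennreal (h (w @ [e])))" if "w \<in> FP" for w
  proof -
    have "(\<Sum>e\<in>{e. w @ [e] \<in> FP}. ennreal (h (w @ [e]))) = ennreal (\<Sum>e\<in>{e. w @ [e] \<in> FP}. h (w @ [e]))"
      using nonneg by (intro sum_ennreal) simp
    then show ?thesis using add[OF that] by simp
  qed
  from cylinder_measure_exists_aux[of "\<lambda>w. ennreal (h w)", OF this] show ?thesis
    using that by auto
qed

lemma measure_Z_extend:
  assumes m: "locally_finite m" and w: "w \<in> FP"
  shows "measure m (Z w) = (\<Sum>e\<in>{e. w @ [e] \<in> FP}. measure m (Z (w @ [e])))"
  unfolding Z_extend[OF w]
proof (rule measure_finite_Union)
  show "finite {e. w @ [e] \<in> FP}" using finite_extensions[OF FP_not_Nil[OF w]] .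
  show "(\<lambda>e. Z (w @ [e])) ` {e. w @ [e] \<in> FP} \<subseteq> sets m" using m by (auto simp: locally_finite_def)
  show "disjoint_family_on (\<lambda>e. Z (w @ [e])) {e. w @ [e] \<in> FP}"
    unfolding disjoint_family_on_def using cylinder_disjoint_snoc[of _ _ G w] by blast
  show "emeasure m (Z (w @ [e])) \<noteq> \<infinity>" if "e \<in> {e. w @ [e] \<in> FP}" for e
    using m that unfolding locally_finite_def by (metis mem_Collect_eq order_less_irrefl)
qed

end

lemma le_of_le_mult_exp:
  fixes a b :: real
  assumes "\<And>\<epsilon>. \<epsilon> > 0 \<Longrightarrow> a \<le> exp \<epsilon> * b"
  shows "a \<le> b"
proof (rule tendsto_lowerbound)
  have "((\<lambda>\<epsilon>. exp \<epsilon> * b) \<longlongrightarrow> exp 0 * b) (at_right 0)" by (intro tendsto_intros)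
  then show "((\<lambda>\<epsilon>. exp \<epsilon> * b) \<longlongrightarrow> b) (at_right 0)" by simp
  show "\<forall>\<^sub>F \<epsilon> in at_right 0. a \<le> exp \<epsilon> * b"
    using assms by (auto simp: eventually_at_filter)
qed simp

context path_potential
begin

text \<open>Both measures are additive over extensions, so a comparison up to exp(\<epsilon>) on all
  long words carries back to every word. On long words \<phi> is almost constant, and the one-step
  bounds pin both sides down. Finally \<epsilon> tends to 0.\<close>

lemma eigenmeasure_of_weights:
  assumes m: "locally_finite m" and h: "\<And>w. w \<in> FP \<Longrightarrow> emeasure m (Z w) = ennreal (h w)"
    and nonneg: "\<And>w. w \<in> FP \<Longrightarrow> h w \<ge> 0"
    and eig: "\<And>a w A B. \<lbrakk>w \<noteq> []; a # w \<in> FP; \<forall>x\<in>Z (a # w). A \<le> exp (\<phi> x) \<and> exp (\<phi> x) \<le> B\<rbrakk> \<Longrightarrow>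
      A * h w \<le> exp t * h (a # w) \<and> exp t * h (a # w) \<le> B * h w"
  shows "dual_measure m = scale_measure (ennreal (exp t)) m"
proof (rule locally_finite_eqI)
  let ?D = "\<lambda>w. measure (dual_measure m) (Z w)"
  let ?S = "\<lambda>w. exp t * h w"
  have D: "locally_finite (dual_measure m)" by (rule locally_finite_dual_measure[OF m])
  then show "locally_finite (dual_measure m)" .
  show "locally_finite (scale_measure (ennreal (exp t)) m)"
    using m by (auto simp: locally_finite_def ennreal_mult_less_top)
  have hm: "h w = measure m (Z w)" if "w \<in> FP" for w
    using h[OF that] nonneg[OF that] by (simp add: measure_def)
  have near: "?D w \<le> exp \<epsilon> * ?S w \<and> ?S w \<le> exp \<epsilon> * ?D w" if w: "w \<in> FP" and "\<epsilon> > 0" for w \<epsilon>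
    using w
  proof (induction rule: cylinder_induct)
    case (extend v)
    let ?E = "{e. v @ [e] \<in> FP}"
    have S: "?S v = (\<Sum>e\<in>?E. ?S (v @ [e]))"
      using hm measure_Z_extend[OF m extend.hyps] extend.hyps by (simp add: sum_distrib_left)
    show ?case
      unfolding S measure_Z_extend[OF D extend.hyps] sum_distrib_left
      using extend.IH by (intro conjI sum_mono) auto
  next
    case (path p)
    have p: "p \<in> X" using path cylinder_subset_inf_paths by blast
    obtain k where k: "\<forall>x\<in>X. \<forall>y\<in>X. (\<forall>i<k. x i = y i) \<longrightarrow> \<bar>\<phi> x - \<phi> y\<bar> \<le> \<epsilon> / 2"
      using osc[of "\<epsilon> / 2"] \<open>\<epsilon> > 0\<close> by auto
    \<comment> \<open>Length at least 2 leaves a non-empty word after the first edge.\<close>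
    have "?D (pre p n) \<le> exp \<epsilon> * ?S (pre p n) \<and> ?S (pre p n) \<le> exp \<epsilon> * ?D (pre p n)"
      if n: "n \<ge> max k 2" for n
    proof -
      have preFP: "pre p n \<in> FP" using pre_in_FP[OF p] n by simp
      obtain a w where aw: "pre p n = a # w" "w \<noteq> []"
      proof -
        obtain a w where "pre p n = a # w" using FP_not_Nil[OF preFP] by (cases "pre p n") auto
        moreover from this have "Suc (length w) = n" using length_pre[of p n] by simp
        ultimately show ?thesis using that n by fastforce
      qed
      \<comment> \<open>The ratio of the two bounds is exp(\<epsilon>), and both measures of the
        cylinder lie between their multiples by \<open>h w\<close>.\<close>
      let ?A = "exp (\<phi> p - \<epsilon> / 2)" and ?B = "exp (\<phi> p + \<epsilon> / 2)"
      have AB: "?A \<le> exp (\<phi> x) \<and> exp (\<phi> x) \<le> ?B" if "x \<in> Z (a # w)" for x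
      proof -
        have "x \<in> X" "\<forall>i<k. x i = p i" using that n unfolding aw(1)[symmetric] in_cylinder_pre by auto
        then have "\<bar>\<phi> x - \<phi> p\<bar> \<le> \<epsilon> / 2" using k p by blast
        then have "\<phi> p - \<epsilon> / 2 \<le> \<phi> x" "\<phi> x \<le> \<phi> p + \<epsilon> / 2" by linarith+
        then show ?thesis by simp
      qed
      have wFP: "w \<in> FP" "a # w \<in> FP" using preFP aw by (auto simp: FP_Cons)
      have em: "emeasure (dual_measure m) (Z (a # w)) = ennreal (?D (a # w))"
        using D wFP by (intro emeasure_eq_ennreal_measure) (auto simp: locally_finite_def)
      have "ennreal (?A * h w) \<le> ennreal (?D (a # w))" "ennreal (?D (a # w)) \<le> ennreal (?B * h w)"
        using emeasure_dual_measure_bounds[OF m aw(2) wFP(2) AB] wFP nonneg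
        by (auto simp: em h ennreal_mult)
      then have Dab: "?A * h w \<le> ?D (a # w)" "?D (a # w) \<le> ?B * h w"
        using nonneg[OF wFP(1)] by (auto simp: ennreal_le_iff)
      have Sab: "?A * h w \<le> ?S (a # w)" "?S (a # w) \<le> ?B * h w"
        using eig[OF aw(2) wFP(2), of ?A ?B] AB by auto
      have B: "?B * h w = exp \<epsilon> * (?A * h w)" by (simp flip: exp_add mult.assoc)
      have "exp \<epsilon> * (?A * h w) \<le> exp \<epsilon> * ?S (a # w)" "exp \<epsilon> * (?A * h w) \<le> exp \<epsilon> * ?D (a # w)"
        using Dab Sab by (auto intro: mult_left_mono)
      then show ?thesis unfolding aw(1) using Dab Sab B by linarith
    qed
    then show ?case by blast
  qed
  fix w assume w: "w \<in> FP"
  have "?D w \<le> ?S w" by (rule le_of_le_mult_exp) (use near[OF w] in blast)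
  moreover have "?S w \<le> ?D w" by (rule le_of_le_mult_exp) (use near[OF w] in blast)
  ultimately have "?D w = ?S w" by simp
  moreover have "emeasure (dual_measure m) (Z w) = ennreal (?D w)"
    using D w by (intro emeasure_eq_ennreal_measure) (auto simp: locally_finite_def)
  ultimately show "emeasure (dual_measure m) (Z w) = emeasure (scale_measure (ennreal (exp t)) m) (Z w)"
    using h[OF w] nonneg[OF w] by (simp add: ennreal_mult)
qed

end

subsection \<open>Green functions and the eigenmeasure\<close>

context path_potential
begin

lemma ruelle_pow_cong:
  assumes "fin_rooted f" "fin_rooted g" "\<And>y. y \<in> X \<Longrightarrow> f y = g y" "x \<in> X"
  shows "(L ^^ n) f x = (L ^^ n) g x"
  using ruelle_pow_mono[of f g x n] ruelle_pow_mono[of g f x n] assms by (intro antisym) simp_all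

lemma ind_extend:
  assumes "w \<in> FP"
  shows "ind w y = (\<Sum>e\<in>{e. w @ [e] \<in> FP}. ind (w @ [e]) y)"
proof -
  let ?E = "{e. w @ [e] \<in> FP}"
  have fin: "finite ?E" using finite_extensions[OF FP_not_Nil[OF assms]] .
  show ?thesis
  proof (cases "y \<in> Z w")
    case True
    then obtain e where e: "e \<in> ?E" "y \<in> Z (w @ [e])" unfolding Z_extend[OF assms] by blast
    have "ind (w @ [e']) y = (if e' = e then 1 else 0)" for e'
      using e(2) cylinder_disjoint_snoc[of e' e G w] by (auto simp: ind_eq_1 intro: ind_eq_0)
    then show ?thesis using e fin True by (simp add: ind_eq_1)
  next
    case False
    then have "y \<notin> Z (w @ [e])" for e using cylinder_append by blast
    then show ?thesis using False by (simp add: ind_eq_0)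
  qed
qed

text \<open>Formally the resolvent (1 - r L)^(-1) applied to \<open>ind w\<close> and evaluated at
  \<open>x\<close>.\<close>

definition green :: "real \<Rightarrow> (nat \<Rightarrow> 'e) \<Rightarrow> 'e list \<Rightarrow> real" where
  "green r x w = (\<Sum>n. r ^ n * (L ^^ n) (ind w) x)"

lemma summable_green:
  assumes "exp_bounded (\<lambda>n. (L ^^ n) (ind w) x) q" "q > 0" "r > 0" "q * r < 1" "x \<in> X"
  shows "summable (\<lambda>n. r ^ n * (L ^^ n) (ind w) x)"
proof -
  obtain C where C: "\<And>n. (L ^^ n) (ind w) x \<le> C * q ^ n" using assms(1) unfolding exp_bounded_def by blast
  show ?thesis
  proof (rule summable_comparison_test')
    show "summable (\<lambda>n. C * (q * r) ^ n)" using assms by (intro summable_mult summable_geometric) simp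
    fix n :: nat
    have "r ^ n * (L ^^ n) (ind w) x \<le> r ^ n * (C * q ^ n)" using assms C by (intro mult_left_mono) auto
    also have "\<dots> = C * (q * r) ^ n" by (simp add: power_mult_distrib)
    finally show "norm (r ^ n * (L ^^ n) (ind w) x) \<le> C * (q * r) ^ n"
      using assms ruelle_pow_nonneg[of "ind w" x n] by simp
  qed
qed

context
  fixes r :: real and x :: "nat \<Rightarrow> 'e"
  assumes r: "r > 0" and x: "x \<in> X"
    and summable: "\<And>w. w \<in> FP \<Longrightarrow> summable (\<lambda>n. r ^ n * (L ^^ n) (ind w) x)"
begin

lemma green_term_nonneg: "r ^ n * (L ^^ n) (ind w) x \<ge> 0"
  using r x ruelle_pow_nonneg[of "ind w" x n] by simp

lemma green_nonneg: "w \<in> FP \<Longrightarrow> green r x w \<ge> 0"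
  unfolding green_def using summable green_term_nonneg by (intro suminf_nonneg) auto

lemma green_extend:
  assumes w: "w \<in> FP"
  shows "green r x w = (\<Sum>e\<in>{e. w @ [e] \<in> FP}. green r x (w @ [e]))"
proof -
  let ?E = "{e. w @ [e] \<in> FP}"
  have fin: "finite ?E" using finite_extensions[OF FP_not_Nil[OF w]] .
  have FSE: "fin_rooted (ind (w @ [e]))" if "e \<in> ?E" for e using that fin_rooted_ind by simp
  have "(L ^^ n) (ind w) x = (\<Sum>e\<in>?E. (L ^^ n) (ind (w @ [e])) x)" for n
  proof -
    have fin_rooted: "fin_rooted (\<lambda>y. \<Sum>e\<in>?E. 1 * ind (w @ [e]) y)" by (rule fin_rooted_sum[OF fin FSE])
    have "(L ^^ n) (ind w) x = (L ^^ n) (\<lambda>y. \<Sum>e\<in>?E. 1 * ind (w @ [e]) y) x"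
      by (rule ruelle_pow_cong[OF fin_rooted_ind[OF w] fin_rooted _ x]) (simp add: ind_extend[OF w])
    also have "\<dots> = (\<Sum>e\<in>?E. 1 * (L ^^ n) (ind (w @ [e])) x)"
      by (rule ruelle_pow_sum[OF fin FSE])
    finally show ?thesis by simp
  qed
  then have "green r x w = (\<Sum>n. \<Sum>e\<in>?E. r ^ n * (L ^^ n) (ind (w @ [e])) x)"
    by (simp add: green_def sum_distrib_left)
  also have "\<dots> = (\<Sum>e\<in>?E. green r x (w @ [e]))"
    unfolding green_def using summable by (intro suminf_sum) auto
  finally show ?thesis .
qed

text \<open>Summing the operator inequality over \<open>n\<close> shifts the series by
  \<open>l\<close>, at the cost of \<open>(1 / r) ^ l\<close>; the omitted initial terms are
  non-negative. The constant does not involve \<open>x\<close>, which lets the base path escape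
  later.\<close>

lemma green_harnack:
  assumes uv: "u \<in> FP" "v \<in> FP" and c: "c > 0" "\<forall>y\<in>X. ind v y \<le> c * (L ^^ l) (ind u) y"
  shows "green r x v \<le> c * (1 / r) ^ l * green r x u"
proof -
  let ?a = "\<lambda>n. r ^ n * (L ^^ n) (ind u) x"
  have le: "r ^ n * (L ^^ n) (ind v) x \<le> c * (1 / r) ^ l * ?a (n + l)" for n
  proof -
    have fin_rooted: "fin_rooted ((L ^^ l) (ind u))" using uv by (intro fin_rooted_ruelle_pow fin_rooted_ind)
    then have "fin_rooted (\<lambda>y. c * (L ^^ l) (ind u) y)"
      unfolding fin_rooted_def by (metis mult_zero_right)
    then have "(L ^^ n) (ind v) x \<le> (L ^^ n) (\<lambda>y. c * (L ^^ l) (ind u) y) x"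
      using c x fin_rooted_ind[OF uv(2)] by (intro ruelle_pow_mono) auto
    also have "\<dots> = c * (L ^^ (n + l)) (ind u) x"
      unfolding ruelle_pow_add ruelle_pow_scale[OF fin_rooted] ..
    finally have "r ^ n * (L ^^ n) (ind v) x \<le> r ^ n * (c * (L ^^ (n + l)) (ind u) x)"
      using r by (intro mult_left_mono) auto
    also have "\<dots> = c * (1 / r) ^ l * ?a (n + l)" using r by (simp add: power_add field_simps)
    finally show ?thesis .
  qed
  have s: "summable ?a" using summable uv by blast
  have sl: "summable (\<lambda>n. ?a (n + l))" by (rule iffD2[OF summable_iff_shift[of ?a l] s])
  have "(\<Sum>n. ?a (n + l)) \<le> suminf ?a"
    using suminf_split_initial_segment[OF s, of l] sum_nonneg[of "{..<l}" ?a] green_term_nonneg by simp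
  then have "c * (1 / r) ^ l * (\<Sum>n. ?a (n + l)) \<le> c * (1 / r) ^ l * green r x u"
    using c r unfolding green_def by (intro mult_left_mono) auto
  moreover have "green r x v \<le> (\<Sum>n. c * (1 / r) ^ l * ?a (n + l))"
    unfolding green_def using le summable[OF uv(2)] sl by (intro suminf_le summable_mult) auto
  moreover have "(\<Sum>n. c * (1 / r) ^ l * ?a (n + l)) = c * (1 / r) ^ l * (\<Sum>n. ?a (n + l))"
    by (rule suminf_mult[OF sl])
  ultimately show ?thesis by linarith
qed

text \<open>For the one-edge word through which \<open>x\<close> starts, the term
  \<open>n = 0\<close> already equals 1; the Harnack inequality transfers positivity to
  \<open>u\<close>.\<close>

lemma green_pos:
  assumes u: "u \<in> FP"
  shows "green r x u > 0"
proof -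
  have v: "[x 0] \<in> FP" using x by (simp add: inf_path_arc)
  obtain c l where c: "c > 0" "\<forall>y\<in>X. ind [x 0] y \<le> c * (L ^^ l) (ind u) y"
    using ind_le_ruelle_pow[OF u v] by blast
  have "r ^ 0 * (L ^^ 0) (ind [x 0]) x \<le> green r x [x 0]"
    unfolding green_def
    using sum_le_suminf[OF summable[OF v], of "{0}"] green_term_nonneg by simp
  moreover have "ind [x 0] x = 1" using x by (simp add: ind_eq_1 Z_single)
  ultimately have "1 \<le> c * (1 / r) ^ l * green r x u"
    using green_harnack[OF u v c] by simp
  moreover have "c * (1 / r) ^ l > 0" using c r by simp
  ultimately show ?thesis by (smt (verit) mult_nonneg_nonpos)
qed

text \<open>Applying \<open>L\<close> shifts the series by one and so loses the term
  \<open>n = 0\<close>, which is \<open>ind (a # w) x\<close>: the source at the base path.\<close>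

lemma green_eigen:
  assumes w: "w \<noteq> []" "a # w \<in> FP" and AB: "\<forall>y\<in>Z (a # w). A \<le> exp (\<phi> y) \<and> exp (\<phi> y) \<le> B"
  shows "A * green r x w \<le> 1 / r * (green r x (a # w) - ind (a # w) x)"
    and "1 / r * (green r x (a # w) - ind (a # w) x) \<le> B * green r x w"
proof -
  have wFP: "w \<in> FP" using w by (simp add: FP_Cons)
  let ?f = "ind (a # w)"
  have L: "A * ind w y \<le> L ?f y \<and> L ?f y \<le> B * ind w y" for y
  proof (cases "y \<in> Z w")
    case True
    then have "case_nat a y \<in> Z (a # w)"
      using conc_in_Z[of "[a]" w y] w by (simp add: conc_Cons)
    then show ?thesis using AB True by (simp add: ruelle_ind_Cons[OF w] ind_eq_1)
  qed (simp add: ruelle_ind_Cons[OF w] ind_eq_0)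
  have FSw: "fin_rooted (\<lambda>y. c * ind w y)" for c using fin_rooted_ind[OF wFP] unfolding fin_rooted_def by (metis mult_zero_right)
  have FSL: "fin_rooted (L ?f)" using fin_rooted_ind[OF w(2)] by (rule fin_rooted_ruelle)
  have "(L ^^ n) (\<lambda>y. A * ind w y) x \<le> (L ^^ n) (L ?f) x" for n
    using L by (intro ruelle_pow_mono[OF FSw FSL _ x]) auto
  then have A: "A * (L ^^ n) (ind w) x \<le> (L ^^ Suc n) ?f x" for n
    unfolding ruelle_pow_scale[OF fin_rooted_ind[OF wFP]] by (simp add: funpow_swap1)
  have "(L ^^ n) (L ?f) x \<le> (L ^^ n) (\<lambda>y. B * ind w y) x" for n
    using L by (intro ruelle_pow_mono[OF FSL FSw _ x]) auto
  then have B: "(L ^^ Suc n) ?f x \<le> B * (L ^^ n) (ind w) x" for n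
    unfolding ruelle_pow_scale[OF fin_rooted_ind[OF wFP]] by (simp add: funpow_swap1)
  have s: "summable (\<lambda>n. r ^ n * (L ^^ n) ?f x)" using summable w by blast
  have s1: "summable (\<lambda>n. r ^ Suc n * (L ^^ Suc n) ?f x)" using s by (subst summable_Suc_iff)
  then have s2: "summable (\<lambda>n. 1 / r * (r ^ Suc n * (L ^^ Suc n) ?f x))" by (rule summable_mult)
  have "green r x (a # w) - ?f x = (\<Sum>n. r ^ Suc n * (L ^^ Suc n) ?f x)"
    unfolding green_def using suminf_split_head[OF s] by simp
  then have eq: "1 / r * (green r x (a # w) - ?f x) = (\<Sum>n. 1 / r * (r ^ Suc n * (L ^^ Suc n) ?f x))"
    using suminf_mult[OF s1, of "1 / r"] by simp
  have t: "1 / r * (r ^ Suc n * (L ^^ Suc n) ?f x) = r ^ n * (L ^^ Suc n) ?f x" for n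
    using r by simp
  have sw: "summable (\<lambda>n. c * (r ^ n * (L ^^ n) (ind w) x))" for c
    using summable[OF wFP] by (rule summable_mult)
  have cw: "c * green r x w = (\<Sum>n. c * (r ^ n * (L ^^ n) (ind w) x))" for c
    unfolding green_def using suminf_mult[OF summable[OF wFP], of c] by simp
  show "A * green r x w \<le> 1 / r * (green r x (a # w) - ?f x)"
    unfolding eq cw
  proof (rule suminf_le[OF _ sw s2])
    show "A * (r ^ n * (L ^^ n) (ind w) x) \<le> 1 / r * (r ^ Suc n * (L ^^ Suc n) ?f x)" for n
      unfolding t using mult_left_mono[OF A[of n], of "r ^ n"] r by (simp only: mult.left_commute zero_le_power less_imp_le)
  qed
  show "1 / r * (green r x (a # w) - ?f x) \<le> B * green r x w"
    unfolding eq cw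
  proof (rule suminf_le[OF _ s2 sw])
    show "1 / r * (r ^ Suc n * (L ^^ Suc n) ?f x) \<le> B * (r ^ n * (L ^^ n) (ind w) x)" for n
      unfolding t using mult_left_mono[OF B[of n], of "r ^ n"] r by (simp only: mult.left_commute zero_le_power less_imp_le)
  qed
qed

end

section \<open>Existence of an eigenmeasure by escaping base paths\<close>

lemma eigenmeasure_exists:
  assumes t: "pressure G \<phi> \<le> ereal t"
  shows "\<exists>m. locally_finite m \<and> emeasure m X \<noteq> 0 \<and> dual_measure m = scale_measure (ennreal (exp t)) m"
proof -
  define arc where "arc = from_nat_into (arcs G)"
  have arc: "arc j \<in> arcs G" for j
    unfolding arc_def using infinite_arcs by (intro from_nat_into) auto
  have inj: "inj arc"
    using bij_betw_from_nat_into[OF countable_arcs infinite_arcs] by (simp add: arc_def bij_betw_def)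
  have "\<exists>x. \<forall>j. x j \<in> X \<and> x j 0 = arc j"
    using inf_path_from_arc[OF arc] by (intro choice allI) blast
  then obtain x where x: "\<And>j. x j \<in> X" "\<And>j. x j 0 = arc j" by blast
  \<comment> \<open>Strictly above \<open>t\<close> for convergence of the Green sums, and at most
    \<open>t + 1\<close> for Harnack constants uniform in \<open>j\<close>.\<close>
  define s where "s j = t + 1 / real (Suc j)" for j
  define r where "r j = exp (- s j)" for j
  have r: "r j > 0" "1 / r j = exp (s j)" for j by (simp_all add: r_def exp_minus field_simps)
  have s_le: "s j \<le> t + 1" for j by (simp add: s_def field_simps)
  have summ: "summable (\<lambda>n. r j ^ n * (L ^^ n) (ind w) (x j))" if w: "w \<in> FP" for j w
  proof -
    have "t < s j" by (simp add: s_def)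
    then obtain u where u: "t < u" "u < s j" using dense by blast
    have "exp_bounded (\<lambda>n. (L ^^ n) (ind w) (x j)) (exp u)"
      using pressure_le_iff[OF w x(1)[of j], of t] t u by simp
    then show ?thesis
      by (rule summable_green) (use r x u in \<open>auto simp: r_def simp flip: exp_add\<close>)
  qed
  define w0 where "w0 = [arc 0]"
  have w0: "w0 \<in> FP" by (simp add: w0_def arc)
  let ?g = "\<lambda>j. green (r j) (x j)"
  have gpos: "?g j w0 > 0" for j using green_pos[OF r(1) x(1) summ w0] .
  define f where "f j w = ?g j w / ?g j w0" for j w
  have "\<exists>K. \<forall>j. ?g j w \<le> K * ?g j w0" if w: "w \<in> FP" for w
  proof -
    obtain c l where c: "c > 0" "\<forall>y\<in>X. ind w y \<le> c * (L ^^ l) (ind w0) y"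
      using ind_le_ruelle_pow[OF w0 w] by blast
    have "?g j w \<le> (c * exp (t + 1) ^ l) * ?g j w0" for j
    proof -
      have "?g j w \<le> c * (1 / r j) ^ l * ?g j w0"
        by (rule green_harnack[OF r(1) x(1) summ w0 w c])
      also have "\<dots> \<le> (c * exp (t + 1) ^ l) * ?g j w0"
        using c(1) s_le gpos[of j] unfolding r(2) by (intro mult_right_mono mult_left_mono power_mono) auto
      finally show ?thesis .
    qed
    then show ?thesis by blast
  qed
  then obtain K where K: "\<And>w j. w \<in> FP \<Longrightarrow> ?g j w \<le> K w * ?g j w0" by metis
  have f: "0 \<le> f j w" "f j w \<le> K w" if "w \<in> FP" for j w
    using green_nonneg[OF r(1) x(1) summ that] K[OF that] gpos[of j] by (auto simp: f_def field_simps)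
  have Kp: "\<bar>K w\<bar> + 1 > 0" for w by linarith
  \<comment> \<open>Rescaling each word separately gives the common bound 1 that the diagonal
    argument asks for; the added 1 avoids division by zero.\<close>
  have "norm (f n w / (\<bar>K w\<bar> + 1)) \<le> 1" if "w \<in> FP" for n w
    using f[OF that, of n] Kp[of w] by (simp add: field_simps)
  from function_convergent_subsequence[OF countable_FP, of "\<lambda>n w. f n w / (\<bar>K w\<bar> + 1)", OF this]
  obtain \<sigma> :: "nat \<Rightarrow> nat" where \<sigma>: "strict_mono \<sigma>"
    "\<And>w. w \<in> FP \<Longrightarrow> \<exists>l. (\<lambda>n. f (\<sigma> n) w / (\<bar>K w\<bar> + 1)) \<longlonglongrightarrow> l" by blast
  have "\<exists>l. (\<lambda>n. f (\<sigma> n) w) \<longlonglongrightarrow> l" if w: "w \<in> FP" for w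
  proof -
    obtain l where "(\<lambda>n. f (\<sigma> n) w / (\<bar>K w\<bar> + 1)) \<longlonglongrightarrow> l" using \<sigma>(2)[OF w] by blast
    from tendsto_mult_right[OF this, of "\<bar>K w\<bar> + 1"]
    have "(\<lambda>n. f (\<sigma> n) w) \<longlonglongrightarrow> l * (\<bar>K w\<bar> + 1)" using Kp[of w] by simp
    then show ?thesis by blast
  qed
  then obtain h where h: "\<And>w. w \<in> FP \<Longrightarrow> (\<lambda>n. f (\<sigma> n) w) \<longlonglongrightarrow> h w" by metis
  have h0: "h w \<ge> 0" if "w \<in> FP" for w
    using h[OF that] f(1)[OF that] by (intro LIMSEQ_le_const[OF h[OF that]]) blast
  have hadd: "h w = (\<Sum>e\<in>{e. w @ [e] \<in> FP}. h (w @ [e]))" if w: "w \<in> FP" for w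
  proof (rule LIMSEQ_unique[OF h[OF w]])
    have "(\<lambda>n. \<Sum>e\<in>{e. w @ [e] \<in> FP}. f (\<sigma> n) (w @ [e])) \<longlonglongrightarrow> (\<Sum>e\<in>{e. w @ [e] \<in> FP}. h (w @ [e]))"
      using h by (intro tendsto_sum) simp
    moreover have "f j w = (\<Sum>e\<in>{e. w @ [e] \<in> FP}. f j (w @ [e]))" for j
      unfolding f_def by (subst green_extend[OF r(1) x(1) summ w]) (simp_all add: sum_divide_distrib)
    ultimately show "(\<lambda>n. f (\<sigma> n) w) \<longlonglongrightarrow> (\<Sum>e\<in>{e. w @ [e] \<in> FP}. h (w @ [e]))" by simp
  qed
  \<comment> \<open>The normalisation survives the limit and keeps the measure from
    vanishing.\<close>
  have "f j w0 = 1" for j using gpos[of j] by (simp add: f_def)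
  then have hw0: "h w0 = 1" using h[OF w0] by (simp add: LIMSEQ_const_iff)
  have "s \<longlonglongrightarrow> t + 0" unfolding s_def
    by (intro tendsto_add tendsto_const LIMSEQ_Suc[OF lim_1_over_n])
  then have lim: "(\<lambda>n. exp (s (\<sigma> n))) \<longlonglongrightarrow> exp t"
    using LIMSEQ_subseq_LIMSEQ[OF _ \<sigma>(1), of s t] by (intro tendsto_exp) (simp add: o_def)
  have eig: "A * h w \<le> exp t * h (a # w) \<and> exp t * h (a # w) \<le> B * h w"
    if w: "w \<noteq> []" "a # w \<in> FP" and AB: "\<forall>y\<in>Z (a # w). A \<le> exp (\<phi> y) \<and> exp (\<phi> y) \<le> B" for a w A B
  proof -
    have wFP: "w \<in> FP" using w by (simp add: FP_Cons)
    have "\<forall>\<^sub>F n in sequentially. x (\<sigma> n) \<notin> Z (a # w)"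
    proof -
      \<comment> \<open>The first edges are pairwise distinct, even along the subsequence, so at
        most finitely many base paths start with \<open>a\<close>; for all others the source term
        vanishes.\<close>
      have "finite {n. arc (\<sigma> n) = a}"
      proof (rule finite_subset)
        show "{n. arc (\<sigma> n) = a} \<subseteq> (arc \<circ> \<sigma>) -` {a}" by auto
        have "inj (arc \<circ> \<sigma>)" using inj \<sigma>(1) by (simp add: inj_compose strict_mono_imp_inj_on)
        then show "finite ((arc \<circ> \<sigma>) -` {a})" by (intro finite_vimageI) auto
      qed
      then obtain N where N: "\<forall>n\<in>{n. arc (\<sigma> n) = a}. n \<le> N" by (metis finite_nat_set_iff_bounded_le)
      have away: "x (\<sigma> n) \<notin> Z (a # w)" if "n > N" for n
      proof
        assume "x (\<sigma> n) \<in> Z (a # w)"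
        then have "x (\<sigma> n) 0 = a" by (force simp: cylinder_def)
        then show False using N x(2) that by fastforce
      qed
      show ?thesis by (rule eventually_mono[OF eventually_gt_at_top[of N] away])
    qed
    then have ev: "\<forall>\<^sub>F n in sequentially. A * f (\<sigma> n) w \<le> exp (s (\<sigma> n)) * f (\<sigma> n) (a # w) \<and>
        exp (s (\<sigma> n)) * f (\<sigma> n) (a # w) \<le> B * f (\<sigma> n) w"
    proof eventually_elim
      case (elim n)
      let ?j = "\<sigma> n"
      have "A * ?g ?j w \<le> exp (s ?j) * ?g ?j (a # w)" "exp (s ?j) * ?g ?j (a # w) \<le> B * ?g ?j w"
        using green_eigen[OF r(1) x(1) summ w AB, of ?j] elim by (simp_all add: ind_eq_0 r(2))
      then show ?case using gpos[of ?j] by (simp add: f_def divide_right_mono)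
    qed
    note l = tendsto_mult[OF tendsto_const h[OF wFP]] tendsto_mult[OF lim h[OF w(2)]]
    have "A * h w \<le> exp t * h (a # w)"
      by (rule tendsto_le[OF _ l(2) l(1)]) (use ev in \<open>auto elim: eventually_mono\<close>)
    moreover have "exp t * h (a # w) \<le> B * h w"
      by (rule tendsto_le[OF _ l(1) l(2)]) (use ev in \<open>auto elim: eventually_mono\<close>)
    ultimately show ?thesis by blast
  qed
  obtain m where m: "locally_finite m" "\<And>w. w \<in> FP \<Longrightarrow> emeasure m (Z w) = ennreal (h w)"
    using cylinder_measure_exists[of h] h0 hadd by blast
  have "emeasure m (Z w0) \<le> emeasure m X"
    using m(1) cylinder_subset_inf_paths[of G w0] locally_finite_space[OF m(1)]
    by (metis emeasure_mono sets.top)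
  then have "emeasure m X \<noteq> 0" using m(2)[OF w0] hw0 by auto
  moreover have "dual_measure m = scale_measure (ennreal (exp t)) m"
    by (rule eigenmeasure_of_weights[OF m h0 eig])
  ultimately show ?thesis using m(1) by blast
qed

lemma eigenmeasure_iff_pressure_le:
  "(\<exists>m. regular_borel_measure G m \<and> emeasure m (space m) \<noteq> 0 \<and>
      ruelle_dual G \<phi> m = scale_measure (ennreal (exp t)) m) \<longleftrightarrow> pressure G \<phi> \<le> ereal t"
proof
  assume "pressure G \<phi> \<le> ereal t"
  then obtain m where m: "locally_finite m" "emeasure m X \<noteq> 0" "dual_measure m = scale_measure (ennreal (exp t)) m"
    using eigenmeasure_exists by blast
  then show "\<exists>m. regular_borel_measure G m \<and> emeasure m (space m) \<noteq> 0 \<and>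
      ruelle_dual G \<phi> m = scale_measure (ennreal (exp t)) m"
    using ruelle_dual_eq[OF m(1)] locally_finite_space[OF m(1)] regular_iff_locally_finite by metis
next
  assume "\<exists>m. regular_borel_measure G m \<and> emeasure m (space m) \<noteq> 0 \<and>
      ruelle_dual G \<phi> m = scale_measure (ennreal (exp t)) m"
  then obtain m where m: "locally_finite m" "emeasure m (space m) \<noteq> 0"
    "ruelle_dual G \<phi> m = scale_measure (ennreal (exp t)) m"
    using regular_iff_locally_finite by blast
  then show "pressure G \<phi> \<le> ereal t"
    using eigenmeasure_imp_pressure_le[OF m(1)] ruelle_dual_eq[OF m(1)] locally_finite_space[OF m(1)] by metis
qed

end

section \<open>From the stated hypotheses to the locale assumptions\<close>

lemma osc_of_var:
  assumes "(\<lambda>k. var G k \<phi>) \<longlonglongrightarrow> 0" "\<epsilon> > 0"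
  shows "\<exists>k>0. \<forall>x\<in>inf_paths G. \<forall>y\<in>inf_paths G. (\<forall>i<k. x i = y i) \<longrightarrow> \<bar>\<phi> x - \<phi> y\<bar> \<le> \<epsilon>"
proof -
  have "\<forall>\<^sub>F k in sequentially. var G k \<phi> < ereal \<epsilon>"
    using assms by (intro order_tendstoD) auto
  then obtain N where N: "\<And>k. k \<ge> N \<Longrightarrow> var G k \<phi> < ereal \<epsilon>" by (auto simp: eventually_sequentially)
  \<comment> \<open>\<open>Suc N\<close> instead of \<open>N\<close> makes the depth
    positive.\<close>
  have "\<bar>\<phi> x - \<phi> y\<bar> \<le> \<epsilon>"
    if "x \<in> inf_paths G" "y \<in> inf_paths G" "\<forall>i<Suc N. x i = y i" for x y
  proof -
    have "ereal \<bar>\<phi> x - \<phi> y\<bar> \<le> var G (Suc N) \<phi>"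
      unfolding var_def by (rule SUP_upper2[of "(x, y)"]) (use that in auto)
    also have "\<dots> < ereal \<epsilon>" by (rule N) simp
    finally show ?thesis by simp
  qed
  then show ?thesis by blast
qed

text \<open>With finitely many edges but infinitely many vertices, some vertex has no outgoing edge,
  and from it no other vertex can be reached.\<close>

lemma strongly_connected_infinite_arcs:
  assumes "wf_digraph G" "strongly_connected G" "\<not> (finite (verts G) \<and> finite (arcs G))"
  shows "infinite (arcs G)"
proof
  assume fin: "finite (arcs G)"
  interpret wf_digraph G by fact
  have "infinite (verts G)" using fin assms(3) by blast
  moreover have "finite (tail G ` arcs G)" using fin by simp
  ultimately obtain v where v: "v \<in> verts G" "v \<notin> tail G ` arcs G" by (meson finite_subset subsetI)
  obtain u where u: "u \<in> verts G" "u \<noteq> v"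
    using \<open>infinite (verts G)\<close> by (metis finite.simps finite_subset insertI1 subsetI singletonI)
  have "v \<rightarrow>\<^sup>*\<^bsub>G\<^esub> u" using assms(2) u v by (simp add: strongly_connected_def)
  then obtain p where "awalk v p u" by (auto simp: reachable_awalk)
  then show False using u v by (cases p) (auto simp: awalk_Cons_iff awalk_Nil_iff)
qed

theorem theorem4p8:
  fixes G :: "('v, 'e) pre_digraph" and \<phi> :: "(nat \<Rightarrow> 'e) \<Rightarrow> real" and t :: real
  assumes "wf_digraph G"
    and "countable (verts G)" and "countable (arcs G)"
    and "strongly_connected G"
    and "\<forall>v \<in> verts G. finite (out_arcs G v)"
    and "\<not> (finite (verts G) \<and> finite (arcs G))"
    and "(\<lambda>k. var G k \<phi>) \<longlonglongrightarrow> 0"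
  shows "(\<exists>m. regular_borel_measure G m \<and> emeasure m (space m) \<noteq> 0 \<and>
            ruelle_dual G \<phi> m = scale_measure (ennreal (exp t)) m)
         \<longleftrightarrow> ereal t \<ge> pressure G \<phi>"
proof -
  interpret wf_digraph G by fact
  interpret path_potential G \<phi>
  proof
    show "infinite (arcs G)" using assms strongly_connected_infinite_arcs by blast
  qed (use assms osc_of_var in auto)
  show ?thesis by (rule eigenmeasure_iff_pressure_le)
qed

end
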